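(* The corrected Elliott conjecture (cE-conjecture) implies the Frantzikinakis–Host conjecture (FH-conjecture). That is: suppose that for every $k\ge1$, all $f_1,\ldots,f_k\in\mathcal{M}$ such that $f_{j_0}$ is strongly aperiodic for some $1\le j_0\le k$, and all integers $b_1<\ldots<b_k$, one has $$\lim_{N\to\infty}\frac1N\sum_{n<N}\prod_{j=1}^kf_j(n+b_j)=0.$$ Then every real-valued $f\in\mathcal{M}$ has exactly one Furstenberg system.
   Context: $\mathcal{M}$ is the class of multiplicative functions $f:\mathbb{N}\to\mathbb{C}$ ($f(mn)=f(m)f(n)$ for coprime $m,n$) with $|f|\le1$; values at non-positive integers are set to $0$ (this is irrelevant for the averages). $f\in\mathcal{M}$ is strongly aperiodic if for all $Q\ge1$, $$\lim_{X\to\infty}\inf_{|t|\le X}\min_{\chi\bmod q,\ q\le Q}\sum_{p\le X}\frac1p\big(1-\mathrm{Re}(f(p)\chi(p)p^{it})\big)=+\infty,$$ where $p$ runs over primes and $\chi$ over Dirichlet characters of modulus $q$. Furstenberg systems: let $\mathbb{U}$ be the closed unit disc and $S$ the left shift on $\mathbb{U}^{\mathbb{Z}}$; view $f$ as an element of $\mathbb{U}^{\mathbb{Z}}$ and let $X_f=\overline{\{S^nf:n\in\mathbb{Z}\}}$. A Furstenberg system of $f$ is any system $(X_f,\nu,S)$ with $\nu$ a weak$^*$ limit $\lim_{k\to\infty}\frac1{N_k}\sum_{n\le N_k}\delta_{S^nf}$ for some $N_k\to\infty$. $f$ has exactly one Furstenberg system if $\lim_{N\to\infty}\frac1N\sum_{n\le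 N}\delta_{S^nf}$ exists in the weak$^*$ topology. *)

theory Defs
  imports "HOL-Probability.Probability" "HOL-Number_Theory.Number_Theory"
begin

text \<open>Arithmetic functions are functions \<open>nat \<Rightarrow> complex\<close> of which only the values at positive
  arguments are meaningful; no definition below depends on the value at \<open>0\<close>.\<close>

definition multiplicative_disc :: "(nat \<Rightarrow> complex) set" where
  "multiplicative_disc =
     {f. (\<forall>m>0. \<forall>n>0. coprime m n \<longrightarrow> f (m * n) = f m * f n) \<and> (\<forall>n>0. norm (f n) \<le> 1)}"

definition zero_extend :: "(nat \<Rightarrow> complex) \<Rightarrow> int \<Rightarrow> complex" where
  "zero_extend f n = (if n > 0 then f (nat n) else 0)"


section \<open>Strong aperiodicity\<close>

definition dirichlet_character :: "nat \<Rightarrow> (nat \<Rightarrow> complex) \<Rightarrow> bool" where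
  "dirichlet_character q chi \<longleftrightarrow> q \<ge> 1 \<and>
     (\<forall>m n. chi (m * n) = chi m * chi n) \<and>
     (\<forall>n. chi (n + q) = chi n) \<and>
     (\<forall>n. chi n \<noteq> 0 \<longleftrightarrow> coprime n q)"

definition twisted_prime_sum ::
    "(nat \<Rightarrow> complex) \<Rightarrow> (nat \<Rightarrow> complex) \<Rightarrow> real \<Rightarrow> real \<Rightarrow> real" where
  "twisted_prime_sum f chi t X =
     (\<Sum>p | prime p \<and> real p \<le> X.
        1 / real p * (1 - Re (f p * chi p * of_nat p powr (\<i> * of_real t))))"

text \<open>For \<open>f\<close> bounded by \<open>1\<close> and \<open>X \<ge> 0\<close> the infimum below is taken over a nonempty set of
  nonnegative numbers; the minimum is over a finite nonempty set of characters (proved below).\<close>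

definition strongly_aperiodic :: "(nat \<Rightarrow> complex) \<Rightarrow> bool" where
  "strongly_aperiodic f \<longleftrightarrow>
     (\<forall>Q\<ge>1. filterlim
        (\<lambda>X. INF t\<in>{-X..X}.
           Min {twisted_prime_sum f chi t X | chi q. q \<le> Q \<and> dirichlet_character q chi})
        at_top at_top)"

lemma dirichlet_character_mod:
  assumes "dirichlet_character q chi"
  shows "chi (n mod q) = chi n"
proof -
  have per: "chi (n + q) = chi n" for n
    using assms by (simp add: dirichlet_character_def)
  have "chi (r + k * q) = chi r" for r k
  proof (induction k)
    case (Suc k)
    have "chi (r + Suc k * q) = chi ((r + k * q) + q)" by (simp add: algebra_simps)
    then show ?case using per Suc by simp
  qed simp
  from this[of "n mod q" "n div q"] show ?thesis by simp
qed

lemma dirichlet_character_one: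
  assumes "dirichlet_character q chi"
  shows "chi 1 = 1"
proof -
  have "chi (1 * 1) = chi 1 * chi 1" "chi 1 \<noteq> 0"
    using assms unfolding dirichlet_character_def by (blast, simp)
  then show ?thesis by simp
qed

lemma dirichlet_character_power:
  assumes "dirichlet_character q chi"
  shows "chi (n ^ k) = chi n ^ k"
  using assms dirichlet_character_one[OF assms]
  by (induction k) (auto simp: dirichlet_character_def)

lemma dirichlet_character_values:
  assumes "dirichlet_character q chi"
  shows "chi n \<in> insert 0 {z. z ^ totient q = 1}"
proof (cases "coprime n q")
  case True
  have "[n ^ totient q = 1] (mod q)" using True by (rule euler_theorem)
  then have "chi (n ^ totient q) = chi 1"
    by (metis cong_def assms dirichlet_character_mod)
  then show ?thesis
    by (simp add: dirichlet_character_power[OF assms] dirichlet_character_one[OF assms, simplified])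
next
  case False
  then show ?thesis using assms by (auto simp: dirichlet_character_def)
qed

lemma finite_dirichlet_characters: "finite {chi. dirichlet_character q chi}"
proof (cases "q \<ge> 1")
  case True
  let ?V = "insert 0 {z::complex. z ^ totient q = 1}"
  let ?r = "\<lambda>chi::nat \<Rightarrow> complex. restrict chi {..<q}"
  have "finite ?V" using True finite_nth_roots[of "totient q" 1] by simp
  then have "finite (PiE {..<q} (\<lambda>_. ?V))" by (intro finite_PiE) auto
  moreover have "?r ` {chi. dirichlet_character q chi} \<subseteq> PiE {..<q} (\<lambda>_. ?V)"
  proof (rule image_subsetI, rule restrict_PiE_iff[THEN iffD2], rule ballI)
    fix chi n assume "chi \<in> {chi. dirichlet_character q chi}"
    then show "chi n \<in> ?V" using dirichlet_character_values by blast
  qed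
  ultimately have "finite (?r ` {chi. dirichlet_character q chi})" by (rule rev_finite_subset)
  moreover have "inj_on ?r {chi. dirichlet_character q chi}"
  proof (rule inj_onI, rule ext)
    fix chi \<psi> :: "nat \<Rightarrow> complex" and n
    assume a: "chi \<in> {chi. dirichlet_character q chi}" "\<psi> \<in> {chi. dirichlet_character q chi}"
      and e: "?r chi = ?r \<psi>"
    have "?r chi (n mod q) = ?r \<psi> (n mod q)" using e by simp
    moreover have "n mod q < q" using True by simp
    ultimately have "chi (n mod q) = \<psi> (n mod q)" by simp
    with a show "chi n = \<psi> n" by (simp add: dirichlet_character_mod)
  qed
  ultimately show ?thesis by (rule finite_imageD)
next
  case False
  then show ?thesis by (simp add: dirichlet_character_def)
qed

lemma dirichlet_character_trivial: "dirichlet_character 1 (\<lambda>_. 1)"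
  by (simp add: dirichlet_character_def)

lemma strongly_aperiodic_min_set:
  fixes f t X
  assumes "Q \<ge> 1"
  defines "A \<equiv> {twisted_prime_sum f chi t X | chi q. q \<le> Q \<and> dirichlet_character q chi}"
  shows "finite A" "A \<noteq> {}"
proof -
  have "A = (\<Union>q\<le>Q. (\<lambda>chi. twisted_prime_sum f chi t X) ` {chi. dirichlet_character q chi})"
    by (auto simp: A_def)
  then show "finite A" using finite_dirichlet_characters by simp
  show "A \<noteq> {}" using assms dirichlet_character_trivial by (auto simp: A_def)
qed


section \<open>Furstenberg systems\<close>

text \<open>Bi-infinite sequences \<open>int \<Rightarrow> complex\<close> carry the library's product topology, and \<open>borel\<close> is
  its Borel \<open>\<sigma>\<close>-algebra. The orbit closure of a sequence with values in the closed unit disc stays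
  inside the closed set of all such sequences, so it is immaterial that the closure is taken
  in the full space.\<close>

definition shift_seq :: "int \<Rightarrow> (int \<Rightarrow> complex) \<Rightarrow> int \<Rightarrow> complex" where
  "shift_seq n x = (\<lambda>m. x (m + n))"

definition orbit_closure :: "(int \<Rightarrow> complex) \<Rightarrow> (int \<Rightarrow> complex) set" where
  "orbit_closure x = closure (range (\<lambda>n. shift_seq n x))"

definition borel_prob_on :: "'a::topological_space set \<Rightarrow> 'a measure \<Rightarrow> bool" where
  "borel_prob_on X \<nu> \<longleftrightarrow> prob_space \<nu> \<and> sets \<nu> = sets (restrict_space borel X)"

text \<open>Weak* convergence on the compact space \<open>X\<close>, tested against all continuous functions on \<open>X\<close>.\<close>

definition weak_star_limit ::
    "'a::topological_space set \<Rightarrow> (nat \<Rightarrow> 'a measure) \<Rightarrow> 'a measure \<Rightarrow> bool" where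
  "weak_star_limit X \<mu> \<nu> \<longleftrightarrow>
     (\<forall>\<phi> :: 'a \<Rightarrow> real. continuous_on X \<phi> \<longrightarrow>
        (\<lambda>k. integral\<^sup>L (\<mu> k) \<phi>) \<longlonglongrightarrow> integral\<^sup>L \<nu> \<phi>)"

text \<open>The push-forward of the uniform distribution on \<open>{1..N}\<close> under \<open>n \<mapsto> S\<^sup>n x\<close> is
  the average of the point masses at \<open>S\<^sup>n x\<close> for \<open>1 \<le> n \<le> N\<close> (junk for \<open>N = 0\<close>).\<close>

definition empirical_measure :: "(int \<Rightarrow> complex) \<Rightarrow> nat \<Rightarrow> (int \<Rightarrow> complex) measure" where
  "empirical_measure x N =
     distr (uniform_count_measure {1..N}) (restrict_space borel (orbit_closure x))
       (\<lambda>n. shift_seq (int n) x)"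

definition furstenberg_system :: "(nat \<Rightarrow> complex) \<Rightarrow> (int \<Rightarrow> complex) measure \<Rightarrow> bool" where
  "furstenberg_system f \<nu> \<longleftrightarrow>
     borel_prob_on (orbit_closure (zero_extend f)) \<nu> \<and>
     (\<exists>N. filterlim N at_top sequentially \<and>
        weak_star_limit (orbit_closure (zero_extend f))
          (\<lambda>k. empirical_measure (zero_extend f) (N k)) \<nu>)"

definition exactly_one_furstenberg_system :: "(nat \<Rightarrow> complex) \<Rightarrow> bool" where
  "exactly_one_furstenberg_system f \<longleftrightarrow>
     (\<exists>\<nu>. borel_prob_on (orbit_closure (zero_extend f)) \<nu> \<and>
        weak_star_limit (orbit_closure (zero_extend f)) (empirical_measure (zero_extend f)) \<nu>)"

lemma shift_in_orbit_closure: "shift_seq n x \<in> orbit_closure x"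
  unfolding orbit_closure_def by (rule closure_subset[THEN subsetD]) simp

lemma measurable_shift_orbit:
  "(\<lambda>n. shift_seq (int n) x)
     \<in> measurable (uniform_count_measure {1..N}) (restrict_space borel (orbit_closure x))"
  by (auto simp: measurable_def space_uniform_count_measure sets_uniform_count_measure
      space_restrict_space shift_in_orbit_closure)

lemma integral_empirical_measure:
  fixes \<phi> :: "(int \<Rightarrow> complex) \<Rightarrow> real"
  assumes "continuous_on (orbit_closure x) \<phi>"
  shows "integral\<^sup>L (empirical_measure x N) \<phi> = (\<Sum>n = 1..N. \<phi> (shift_seq (int n) x)) / real N"
  unfolding empirical_measure_def
  using measurable_shift_orbit borel_measurable_continuous_on_restrict[OF assms]
  by (subst integral_distr) (simp_all add: integral_uniform_count_measure)

lemma emeasure_empirical_measure: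
  assumes "A \<in> sets (restrict_space borel (orbit_closure x))"
  shows "emeasure (empirical_measure x N) A
           = ennreal (card {n \<in> {1..N}. shift_seq (int n) x \<in> A} / card {1..N})"
proof -
  have "(\<lambda>n. shift_seq (int n) x) -` A \<inter> {1..N} = {n \<in> {1..N}. shift_seq (int n) x \<in> A}" by auto
  moreover have "emeasure (uniform_count_measure {1..N}) {n \<in> {1..N}. shift_seq (int n) x \<in> A}
      = ennreal (card {n \<in> {1..N}. shift_seq (int n) x \<in> A} / card {1..N})"
    by (rule emeasure_uniform_count_measure) auto
  ultimately show ?thesis
    unfolding empirical_measure_def
    using assms measurable_shift_orbit
    by (simp add: emeasure_distr space_uniform_count_measure)
qed

text \<open>A weak* limit is determined by its integrals, so existence of the limit does give a unique
  Furstenberg system.\<close>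

lemma borel_prob_on_eqI:
  fixes X :: "'a::metric_space set"
  assumes X: "closed X" and \<mu>: "borel_prob_on X \<mu>" and \<nu>: "borel_prob_on X \<nu>"
    and eq: "\<And>\<phi> :: 'a \<Rightarrow> real. continuous_on X \<phi> \<Longrightarrow> integral\<^sup>L \<mu> \<phi> = integral\<^sup>L \<nu> \<phi>"
  shows "\<mu> = \<nu>"
proof -
  interpret \<mu>: prob_space \<mu> using \<mu> by (simp add: borel_prob_on_def)
  interpret \<nu>: prob_space \<nu> using \<nu> by (simp add: borel_prob_on_def)
  have sets: "sets \<mu> = sets (restrict_space borel X)" "sets \<nu> = sets (restrict_space borel X)"
    using \<mu> \<nu> by (simp_all add: borel_prob_on_def)
  have sp: "space \<mu> = X" "space \<nu> = X"
    using sets[THEN sets_eq_imp_space_eq] by (simp_all add: space_restrict_space)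
  let ?E = "(\<inter>) X ` Collect closed"
  have gen: "sets (restrict_space borel X) = sigma_sets X ?E"
  proof -
    have "sets (restrict_space borel X) = (\<inter>) X ` sigma_sets UNIV (Collect closed)"
      by (simp add: sets_restrict_space borel_eq_closed)
    also have "\<dots> = sigma_sets X ?E"
      by (rule sigma_sets_Int) (use X in auto)
    finally show ?thesis .
  qed
  have on_closed: "emeasure \<mu> C = emeasure \<nu> C" if "closed C" "C \<subseteq> X" for C
  proof (cases "C = {}")
    case False
    let ?\<phi> = "\<lambda>k x. max 0 (1 - real k * infdist x C)"
    have lim: "(\<lambda>k. ?\<phi> k x) \<longlonglongrightarrow> indicator C x" for x
    proof (cases "x \<in> C")
      case False
      then have "infdist x C > 0"
        using that \<open>C \<noteq> {}\<close> infdist_pos_not_in_closed by blast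
      then have "eventually (\<lambda>k. real k \<ge> 1 / infdist x C) sequentially"
        using eventually_ge_at_top filterlim_iff filterlim_real_sequentially by blast
      then have "eventually (\<lambda>k. ?\<phi> k x = 0) sequentially"
        by eventually_elim (use \<open>infdist x C > 0\<close> in \<open>simp add: field_simps\<close>)
      then show ?thesis using False by (simp add: tendsto_eventually)
    qed simp
    have cont: "continuous_on X (?\<phi> k)" for k by (intro continuous_intros)
    have meas: "?\<phi> k \<in> borel_measurable (restrict_space borel X)" for k
      by (rule borel_measurable_continuous_on_restrict[OF cont])
    have C: "C \<in> sets (restrict_space borel X)"
      using that X by (auto simp: sets_restrict_space_iff)
    have "(\<lambda>k. integral\<^sup>L M (?\<phi> k)) \<longlonglongrightarrow> measure M C"
      if "prob_space M" "sets M = sets (restrict_space borel X)" for M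
    proof -
      interpret prob_space M by fact
      have "(\<lambda>k. integral\<^sup>L M (?\<phi> k)) \<longlonglongrightarrow> integral\<^sup>L M (indicator C)"
      proof (rule integral_dominated_convergence[where w = "\<lambda>_. 1"])
        show "indicator C \<in> borel_measurable M" using C that(2) by simp
        show "?\<phi> k \<in> borel_measurable M" for k
          using meas that(2) measurable_cong_sets by blast
        show "AE x in M. norm (?\<phi> k x) \<le> 1" for k by (simp add: infdist_nonneg)
      qed (use lim in auto)
      then show ?thesis using C that(2) by simp
    qed
    from this[OF \<mu>.prob_space_axioms sets(1)] this[OF \<nu>.prob_space_axioms sets(2)]
    have "measure \<mu> C = measure \<nu> C"
      by (simp add: eq[OF cont] LIMSEQ_unique)
    then show ?thesis by (simp add: \<mu>.emeasure_eq_measure \<nu>.emeasure_eq_measure)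
  qed simp
  show ?thesis
  proof (rule measure_eqI_generator_eq[where E = ?E and \<Omega> = X and A = "\<lambda>_. X"])
    show "Int_stable ?E"
    proof (rule Int_stableI)
      fix a b assume "a \<in> ?E" "b \<in> ?E"
      then obtain c d where cd: "closed c" "closed d" "a = X \<inter> c" "b = X \<inter> d" by auto
      then have "a \<inter> b = X \<inter> (c \<inter> d)" "closed (c \<inter> d)" by auto
      then show "a \<inter> b \<in> ?E" by blast
    qed
    show "emeasure \<mu> Y = emeasure \<nu> Y" if "Y \<in> ?E" for Y
      using that X by (intro on_closed) auto
    show "range (\<lambda>_::nat. X) \<subseteq> ?E" using X by auto
  qed (use sets gen in auto)
qed

lemma exactly_one_furstenberg_system_imp_ex1:
  assumes "exactly_one_furstenberg_system f"
  shows "\<exists>!\<nu>. furstenberg_system f \<nu>"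
proof -
  let ?x = "zero_extend f"
  obtain \<nu> where \<nu>: "borel_prob_on (orbit_closure ?x) \<nu>"
      "weak_star_limit (orbit_closure ?x) (empirical_measure ?x) \<nu>"
    using assms by (auto simp: exactly_one_furstenberg_system_def)
  show ?thesis
  proof (rule ex1I[of _ \<nu>])
    show "furstenberg_system f \<nu>"
      using \<nu> filterlim_ident unfolding furstenberg_system_def by blast
    fix \<mu> assume "furstenberg_system f \<mu>"
    then obtain N where \<mu>: "borel_prob_on (orbit_closure ?x) \<mu>"
        and N: "filterlim N at_top sequentially"
        and lim: "weak_star_limit (orbit_closure ?x) (\<lambda>k. empirical_measure ?x (N k)) \<mu>"
      by (auto simp: furstenberg_system_def)
    show "\<mu> = \<nu>"
    proof (rule borel_prob_on_eqI[OF _ \<mu> \<nu>(1)])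
      show "closed (orbit_closure ?x)" by (simp add: orbit_closure_def)
      fix \<phi> :: "(int \<Rightarrow> complex) \<Rightarrow> real"
      assume c: "continuous_on (orbit_closure ?x) \<phi>"
      have "(\<lambda>k. integral\<^sup>L (empirical_measure ?x k) \<phi>) \<longlonglongrightarrow> integral\<^sup>L \<nu> \<phi>"
        using \<nu>(2) c by (simp add: weak_star_limit_def)
      then have "(\<lambda>k. integral\<^sup>L (empirical_measure ?x (N k)) \<phi>) \<longlonglongrightarrow> integral\<^sup>L \<nu> \<phi>"
        using N by (rule filterlim_compose)
      moreover have "(\<lambda>k. integral\<^sup>L (empirical_measure ?x (N k)) \<phi>) \<longlonglongrightarrow> integral\<^sup>L \<mu> \<phi>"
        using lim c by (simp add: weak_star_limit_def)
      ultimately show "integral\<^sup>L \<mu> \<phi> = integral\<^sup>L \<nu> \<phi>" by (rule LIMSEQ_unique[rotated])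
    qed
  qed
qed

end

theory Submission
  imports Defs
begin

text \<open>
  A Furstenberg system is determined by the correlations of the powers of \<open>f\<close>. If one of the powers that occur
  is strongly aperiodic, the correlation has mean zero by the cE-conjecture. Otherwise every power that occurs
  has, for arbitrarily large \<open>X\<close>, bounded pretentious distance to some \<open>chi(n) n\<^sup>i\<^sup>t\<close> with \<open>\<bar>t\<bar> \<le> X\<close>.
  Since \<open>f\<close> is real, passing to an even power eliminates \<open>chi\<close>, and the estimate \<open>\<zeta>(1 + 1 / ln X + \<i>\<tau>) = o(ln X)\<close> for
  \<open>1 \<le> \<bar>\<tau>\<bar> \<le> X\<close> (van der Corput differencing) forces \<open>t = O(1 / ln X)\<close>. So \<open>f\<close> pretends to be a
  real character, and for real functions this means \<open>\<Sum>\<^sub>p \<bar>f(p) - chi(p)\<bar> / p < \<infinity>\<close>, which makes the power a limit of periodic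
  functions in mean; shifted products of such functions have mean values. Thus all correlations converge, and by
  Stone--Weierstrass so do the averages of all continuous functions. The limit functional is represented by a
  measure obtained from Helly's selection theorem on a Cantor set that parametrises the orbit closure.\<close>

text \<open>The quantitative crux is the range of the twist. Strong aperiodicity takes its infimum
  over \<bar>t\<bar> \<le> X, so its failure only gives some t that may be as large as X. Bounded
  pretentious distance forces a Dirichlet series at 1 + 1 / ln X to be at least c * ln X with a
  possibly tiny c, and the standard bound O(ln \<bar>\<tau>\<bar>) for zeta allows the same order of
  magnitude, hence excludes nothing. This is why \<open>norm_zeta_le\<close> carries an arbitrarily
  small factor \<epsilon>. The saving comes from counting scales: a dyadic block [N, 2N) with
  \<bar>\<tau>\<bar> well between N^k and N^(k+1) shows cancellation after k differencings, and when
  k is limited to k < A only a proportion of about 1 / A of the blocks escapes. Once t = O(1 / ln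
  X), replacing p^(it) by 1 costs O(1) by a Mertens-type bound, and the dependence of t on X
  disappears. Powers of f enter because a monomial in the coordinates may repeat a shift, while the
  conjecture takes distinct shifts; the dichotomy is applied to each power separately.\<close>

section \<open>Van der Corput differencing\<close>

text \<open>H times the sum is the total of the window sums of \<open>w (m + h)\<close> over
  \<open>h < H\<close>. Cauchy-Schwarz over the at most 2 * N values of m turns the squared windows
  into correlations of \<open>u\<close> with its shifts: H diagonal ones of size at most N, and
  fewer than H^2 others of size at most B.\<close>

lemma van_der_Corput_inequality:
  fixes u :: "nat \<Rightarrow> complex"
  assumes u: "\<And>n. norm (u n) \<le> 1" and MN: "M \<le> N" "H \<le> N" "H \<ge> 1" and B0: "B \<ge> 0"
    and B: "\<And>h. 1 \<le> h \<Longrightarrow> h < H \<Longrightarrow> norm (\<Sum>n\<in>{a..<a+(M-h)}. u (n + h) * cnj (u n)) \<le> B"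
  shows "(norm (\<Sum>n\<in>{a..<a+M}. u n))\<^sup>2 \<le> 2 * real N ^ 2 / real H + 2 * real N * B"
proof -
  \<comment> \<open>\<open>u\<close> cut off to the summation range and moved to start at
    \<open>H\<close>, so that every shift \<open>m + h\<close> with \<open>h \<le> H\<close> still
    sweeps the whole support inside \<open>nat\<close>.\<close>
  define w where "w m = (if m \<in> {H..<H+M} then u (a + m - H) else 0)" for m
  define S where "S = (\<Sum>n\<in>{a..<a+M}. u n)"
  have w1: "norm (w m) \<le> 1" for m using u by (simp add: w_def)
  have S: "(\<Sum>m<M+H. w (m + h)) = S" if "h \<le> H" for h
  proof -
    have "(\<Sum>m<M+H. w (m + h)) = (\<Sum>m\<in>{0+h..<M+H+h}. w m)"
      by (subst sum.shift_bounds_nat_ivl) (simp add: lessThan_atLeast0)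
    also have "\<dots> = (\<Sum>m\<in>{H..<H+M}. w m)"
      by (rule sum.mono_neutral_right) (use that in \<open>auto simp: w_def\<close>)
    also have "\<dots> = (\<Sum>m\<in>{0+H..<M+H}. w m)" by (simp add: add.commute)
    also have "\<dots> = (\<Sum>m\<in>{0..<M}. w (m + H))" by (rule sum.shift_bounds_nat_ivl)
    also have "\<dots> = (\<Sum>m\<in>{0..<M}. u (m + a))"
      by (rule sum.cong) (auto simp: w_def add_ac)
    also have "\<dots> = (\<Sum>m\<in>{0+a..<M+a}. u m)" by (rule sum.shift_bounds_nat_ivl[symmetric])
    finally show ?thesis by (simp add: S_def add.commute)
  qed
  define C where "C h h' = (\<Sum>m<M+H. w (m + h) * cnj (w (m + h')))" for h h'
  have diag: "norm (C h h) \<le> real M" if "h \<le> H" for h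
  proof -
    have "C h h = (\<Sum>m\<in>{0+h..<M+H+h}. w m * cnj (w m))" unfolding C_def
      by (subst sum.shift_bounds_nat_ivl) (simp add: lessThan_atLeast0)
    also have "\<dots> = (\<Sum>m\<in>{H..<H+M}. w m * cnj (w m))"
      by (rule sum.mono_neutral_right) (use that in \<open>auto simp: w_def\<close>)
    also have "norm \<dots> \<le> (\<Sum>m\<in>{H..<H+M}. 1)"
      by (rule sum_norm_le) (use w1 in \<open>auto simp: norm_mult intro!: mult_le_one\<close>)
    finally show ?thesis by simp
  qed
  have off: "norm (C (h + d) h) \<le> B" if "h + d < H" "d \<ge> 1" for h d
  proof -
    have "C (h + d) h = (\<Sum>m\<in>{0+h..<M+H+h}. w (m + d) * cnj (w m))" unfolding C_def
      by (subst sum.shift_bounds_nat_ivl) (simp add: lessThan_atLeast0 add_ac)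
    also have "\<dots> = (\<Sum>m\<in>{H..<H+(M-d)}. w (m + d) * cnj (w m))"
      by (rule sum.mono_neutral_right) (use that in \<open>auto simp: w_def\<close>)
    also have "\<dots> = (\<Sum>m\<in>{0+H..<(M-d)+H}. w (m + d) * cnj (w m))" by (simp add: add.commute)
    also have "\<dots> = (\<Sum>m\<in>{0..<M-d}. w (m + H + d) * cnj (w (m + H)))"
      by (rule sum.shift_bounds_nat_ivl)
    also have "\<dots> = (\<Sum>m\<in>{0..<M-d}. u (m + a + d) * cnj (u (m + a)))"
      by (rule sum.cong) (auto simp: w_def add_ac)
    also have "\<dots> = (\<Sum>m\<in>{0+a..<(M-d)+a}. u (m + d) * cnj (u m))"
      by (rule sum.shift_bounds_nat_ivl[symmetric])
    also have "norm \<dots> \<le> B" using B[of d] that by (simp add: add.commute)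
    finally show ?thesis .
  qed
  have Cbound: "norm (C h h') \<le> (if h = h' then real M else B)" if "h < H" "h' < H" for h h'
  proof (cases h h' rule: linorder_cases)
    case less
    have "C h h' = cnj (C h' h)" by (simp add: C_def mult.commute)
    then have "norm (C h h') = norm (C h' h)" by simp
    then show ?thesis using off[of h "h' - h"] less that by simp
  next
    case greater
    then show ?thesis using off[of h' "h - h'"] that by simp
  qed (use diag that in auto)
  have "(real H * norm S)\<^sup>2 = (norm (\<Sum>m<M+H. \<Sum>h<H. w (m + h)))\<^sup>2"
  proof -
    have "(\<Sum>m<M+H. \<Sum>h<H. w (m + h)) = (\<Sum>h<H. \<Sum>m<M+H. w (m + h))" by (rule sum.swap)
    also have "\<dots> = of_nat H * S" using S by simp
    finally show ?thesis by (simp add: norm_mult)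
  qed
  also have "\<dots> \<le> (\<Sum>m<M+H. norm (\<Sum>h<H. w (m + h)))\<^sup>2"
    by (intro power_mono norm_sum) auto
  also have "\<dots> \<le> (\<Sum>m<M+H. (norm (\<Sum>h<H. w (m + h)))\<^sup>2) * real (card {..<M+H})"
    by (rule sum_squared_le_sum_of_squares) 
  also have "(\<Sum>m<M+H. (norm (\<Sum>h<H. w (m + h)))\<^sup>2) \<le> real H * (real M + real H * B)"
  proof -
    have "complex_of_real (\<Sum>m<M+H. (norm (\<Sum>h<H. w (m + h)))\<^sup>2)
        = (\<Sum>m<M+H. (\<Sum>h<H. w (m + h)) * cnj (\<Sum>h<H. w (m + h)))"
      by (simp only: of_real_sum complex_norm_square)
    also have "\<dots> = (\<Sum>m<M+H. \<Sum>h<H. \<Sum>h'<H. w (m + h) * cnj (w (m + h')))"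
      by (simp add: sum_product)
    also have "\<dots> = (\<Sum>h<H. \<Sum>h'<H. C h h')"
      unfolding C_def by (subst sum.swap, rule sum.cong[OF refl], rule sum.swap)
    finally have eq: "complex_of_real (\<Sum>m<M+H. (norm (\<Sum>h<H. w (m + h)))\<^sup>2) = (\<Sum>h<H. \<Sum>h'<H. C h h')" .
    have "(\<Sum>m<M+H. (norm (\<Sum>h<H. w (m + h)))\<^sup>2)
        = norm (complex_of_real (\<Sum>m<M+H. (norm (\<Sum>h<H. w (m + h)))\<^sup>2))"
      by (simp only: norm_of_real) (simp add: sum_nonneg)
    also have "\<dots> \<le> (\<Sum>h<H. \<Sum>h'<H. (if h = h' then real M else B))" unfolding eq
      by (intro sum_norm_le) (use Cbound in auto)
    also have "\<dots> \<le> (\<Sum>h<H. real M + real H * B)"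
    proof (rule sum_mono)
      fix h assume "h \<in> {..<H}"
      have "(\<Sum>h'<H. (if h = h' then real M else B)) \<le> (\<Sum>h'<H. (if h = h' then real M else 0) + B)"
        by (rule sum_mono) (use B0 in auto)
      also have "\<dots> \<le> real M + real H * B" by (simp add: sum.distrib)
      finally show "(\<Sum>h'<H. (if h = h' then real M else B)) \<le> real M + real H * B" .
    qed
    finally show ?thesis by simp
  qed
  finally have "(real H * norm S)\<^sup>2 \<le> real H * (real M + real H * B) * real (card {..<M+H})"
    by (simp add: mult_right_mono)
  also have "\<dots> \<le> real H * (real N + real H * B) * real (2 * N)"
    using MN B0 by (intro mult_mono) auto
  finally have "real H * (real H * (norm S)\<^sup>2) \<le> real H * (2 * real N * (real N + real H * B))"
    by (simp add: power2_eq_square algebra_simps)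
  then have "real H * (norm S)\<^sup>2 \<le> 2 * real N * (real N + real H * B)" using MN by simp
  then show ?thesis unfolding S_def[symmetric] using MN by (simp add: field_simps power2_eq_square)
qed

text \<open>The phase left after successive van der Corput steps with shifts \<open>hs\<close>:
  multiplying a shifted copy of cis F by the conjugate of cis F gives cis of a difference of
  F.\<close>

fun iterated_diff :: "nat list \<Rightarrow> (real \<Rightarrow> real) \<Rightarrow> real \<Rightarrow> real" where
  "iterated_diff [] F = F"
| "iterated_diff (h # hs) F = iterated_diff hs (\<lambda>x. F (x + real h) - F x)"

text \<open>The recursion applies the head of the list first, while summation by parts needs the
  increment of the fully differenced phase. Commuting difference operators identifies that increment
  with \<open>iterated_diff (1 # hs)\<close>.\<close>

lemma iterated_diff_commute:
  "iterated_diff hs (\<lambda>x. F (x + d) - F x) x = iterated_diff hs F (x + d) - iterated_diff hs F x"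
proof (induction hs arbitrary: F x)
  case (Cons h hs)
  have "iterated_diff (h # hs) (\<lambda>x. F (x + d) - F x) x
      = iterated_diff hs (\<lambda>x. (\<lambda>y. F (y + real h) - F y) (x + d) - (\<lambda>y. F (y + real h) - F y) x) x"
    by (simp add: algebra_simps)
  also have "\<dots> = iterated_diff hs (\<lambda>y. F (y + real h) - F y) (x + d) - iterated_diff hs (\<lambda>y. F (y + real h) - F y) x"
    by (rule Cons.IH)
  also have "\<dots> = iterated_diff (h # hs) F (x + d) - iterated_diff (h # hs) F x" by simp
  finally show ?case .
qed simp

text \<open>The induction runs over whole chains of derivatives: differencing by h replaces every
  \<open>D j\<close> by its difference, again a chain of derivatives, and a single mean value
  theorem then turns the remaining difference into a derivative of one order higher.\<close>

lemma iterated_diff_mean_value: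
  assumes "\<And>j y. y \<ge> a \<Longrightarrow> (D j has_real_derivative D (Suc j) y) (at y)" "x \<ge> a"
  shows "\<exists>\<xi>\<in>{x..x + real (sum_list hs)}.
           iterated_diff hs (D 0) x = real (prod_list hs) * D (length hs) \<xi>"
  using assms
proof (induction hs arbitrary: D)
  case (Cons h hs)
  let ?E = "\<lambda>j x. D j (x + real h) - D j x"
  have "(?E j has_real_derivative ?E (Suc j) y) (at y)" if "y \<ge> a" for j y
    by (rule DERIV_diff) (use that Cons.prems in \<open>auto simp: DERIV_shift[symmetric] add.commute\<close>)
  from Cons.IH[of ?E, OF this Cons.prems(2)] obtain \<xi> where
    \<xi>: "\<xi> \<in> {x..x + real (sum_list hs)}" "iterated_diff hs (?E 0) x = real (prod_list hs) * ?E (length hs) \<xi>"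
    by auto
  show ?case
  proof (cases "h = 0")
    case True
    then show ?thesis using \<xi> by auto
  next
    case False
    have "\<exists>z. z > \<xi> \<and> z < \<xi> + real h \<and> D (length hs) (\<xi> + real h) - D (length hs) \<xi>
              = (\<xi> + real h - \<xi>) * D (Suc (length hs)) z"
      by (rule MVT2) (use False \<xi> Cons.prems in auto)
    then obtain z where "z > \<xi>" "z < \<xi> + real h" "?E (length hs) \<xi> = real h * D (Suc (length hs)) z"
      by auto
    then show ?thesis using \<xi> by (intro bexI[of _ z]) auto
  qed
qed auto

text \<open>k rounds of van der Corput's inequality. H and \<epsilon> depend on \<eta> and k alone,
  which makes the result uniform in the block and in the phase.\<close>

lemma exp_sum_via_iterated_diff:
  assumes "\<eta> > 0"
  shows "\<exists>H \<epsilon>. H \<ge> 1 \<and> \<epsilon> > 0 \<and> (\<forall>N M a F. H \<le> N \<longrightarrow> M \<le> N \<longrightarrow>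
      (\<forall>hs. length hs = k \<longrightarrow> set hs \<subseteq> {1..<H} \<longrightarrow>
          norm (\<Sum>n\<in>{a..<a+(M-sum_list hs)}. cis (iterated_diff hs F (real n))) \<le> \<epsilon> * real N) \<longrightarrow>
      norm (\<Sum>n\<in>{a..<a+M}. cis (F (real n))) \<le> \<eta> * real N)"
  using assms
proof (induction k arbitrary: \<eta>)
  case 0
  then show ?case by (intro exI[of _ 1] exI[of _ \<eta>]) auto
next
  case (Suc k)
  \<comment> \<open>With this value and H1 \<ge> 4 / \<eta>^2, each of the two terms of the
    inequality is at most \<eta>^2 / 2 * N^2.\<close>
  define \<theta> where "\<theta> = \<eta>\<^sup>2 / 4"
  have "\<theta> > 0" using Suc.prems by (simp add: \<theta>_def)
  from Suc.IH[OF this] obtain H0 \<epsilon> where H0: "H0 \<ge> 1" "\<epsilon> > 0" and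
    IH: "\<And>N M a F. H0 \<le> N \<Longrightarrow> M \<le> N \<Longrightarrow>
      (\<And>hs. length hs = k \<Longrightarrow> set hs \<subseteq> {1..<H0} \<Longrightarrow>
          norm (\<Sum>n\<in>{a..<a+(M-sum_list hs)}. cis (iterated_diff hs F (real n))) \<le> \<epsilon> * real N) \<Longrightarrow>
      norm (\<Sum>n\<in>{a..<a+M}. cis (F (real n))) \<le> \<theta> * real N" by metis
  define H1 where "H1 = nat \<lceil>4 / \<eta>\<^sup>2\<rceil> + 1"
  have H1: "H1 \<ge> 1" "real H1 \<ge> 4 / \<eta>\<^sup>2" unfolding H1_def by linarith+
  define H where "H = max H0 H1"
  show ?case
  proof (intro exI[of _ H] exI[of _ \<epsilon>] conjI allI impI)
    fix N M a :: nat and F :: "real \<Rightarrow> real"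
    assume N: "H \<le> N" "M \<le> N" and hyp: "\<forall>hs. length hs = Suc k \<longrightarrow> set hs \<subseteq> {1..<H} \<longrightarrow>
       norm (\<Sum>n\<in>{a..<a+(M-sum_list hs)}. cis (iterated_diff hs F (real n))) \<le> \<epsilon> * real N"
    have "(norm (\<Sum>n\<in>{a..<a+M}. cis (F (real n))))\<^sup>2 \<le> 2 * real N ^ 2 / real H1 + 2 * real N * (\<theta> * real N)"
    proof (rule van_der_Corput_inequality)
      show "norm (cis (F (real n))) \<le> 1" for n by simp
      show "0 \<le> \<theta> * real N" using \<open>\<theta> > 0\<close> by simp
      fix h assume h: "1 \<le> h" "h < H1"
      have "(\<Sum>n\<in>{a..<a+(M-h)}. cis (F (real (n + h))) * cnj (cis (F (real n))))
          = (\<Sum>n\<in>{a..<a+(M-h)}. cis ((\<lambda>x. F (x + real h) - F x) (real n)))"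
        by (simp add: cis_cnj cis_mult)
      also have "norm \<dots> \<le> \<theta> * real N"
      proof (rule IH)
        fix hs assume hs: "length hs = k" "set hs \<subseteq> {1..<H0}"
        have "set (h # hs) \<subseteq> {1..<H}" using hs h unfolding H_def by fastforce
        with hs hyp[rule_format, of "h # hs"]
        show "norm (\<Sum>n\<in>{a..<a + (M - h - sum_list hs)}. cis (iterated_diff hs (\<lambda>x. F (x + real h) - F x) (real n))) \<le> \<epsilon> * real N"
          by simp
      qed (use N H_def in auto)
      finally show "norm (\<Sum>n\<in>{a..<a+(M-h)}. cis (F (real (n + h))) * cnj (cis (F (real n)))) \<le> \<theta> * real N" .
    qed (use N H1 H_def in auto)
    also have "\<dots> \<le> \<eta>\<^sup>2 / 2 * real N ^ 2 + \<eta>\<^sup>2 / 2 * real N ^ 2"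
    proof (rule add_mono)
      have "2 / real H1 \<le> \<eta>\<^sup>2 / 2" using H1 Suc.prems by (simp add: field_simps)
      then have "(2 / real H1) * real N ^ 2 \<le> \<eta>\<^sup>2 / 2 * real N ^ 2" by (rule mult_right_mono) simp
      then show "2 * real N ^ 2 / real H1 \<le> \<eta>\<^sup>2 / 2 * real N ^ 2" by simp
    qed (simp add: \<theta>_def power2_eq_square)
    also have "\<dots> = (\<eta> * real N)\<^sup>2" by (simp add: power_mult_distrib)
    finally show "norm (\<Sum>n\<in>{a..<a+M}. cis (F (real n))) \<le> \<eta> * real N"
      by (rule power2_le_imp_le) (use Suc.prems in simp)
  qed (use H0 H_def in auto)
qed


section \<open>Exponential sums with slowly varying phase, and their application to dyadic
  blocks\<close>

lemma norm_cis_diff_le: "norm (cis x - cis y) \<le> \<bar>x - y\<bar>"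
proof -
  have "cis x - cis y = cis y * (cis (x - y) - 1)"
    by (simp add: algebra_simps cis_mult)
  then have "cis x - cis y = cis y * (exp (\<i> * of_real (x - y)) - 1)"
    by (simp only: cis_conv_exp)
  then have "norm (cis x - cis y) = 2 * \<bar>sin ((x - y) / 2)\<bar>"
    by (simp only: norm_mult norm_cis dist_exp_i_1)
  also have "\<dots> \<le> \<bar>x - y\<bar>" using abs_sin_x_le_abs_x[of "(x - y) / 2"] by simp
  finally show ?thesis .
qed

lemma norm_cis_minus_1_ge:
  assumes "\<bar>x\<bar> \<le> 1"
  shows "norm (cis x - 1) \<ge> \<bar>x\<bar> / 2"
proof -
  have *: "sin y \<ge> y / 2" if "0 \<le> y" "y \<le> 1/2" for y :: real
  proof (cases "y = 0")
    case False
    have "\<exists>z. z > 0 \<and> z < y \<and> sin y - sin 0 = (y - 0) * cos z"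
      by (rule MVT2) (use False that in \<open>auto intro!: derivative_eq_intros\<close>)
    then obtain z where z: "z > 0" "z < y" "sin y = y * cos z" by auto
    \<comment> \<open>y \<le> 1/2 < pi / 3, so the cosine is at least 1/2 here.\<close>
    have "cos z \<ge> cos (pi / 3)"
      by (rule cos_monotone_0_pi_le) (use z that pi_gt3 in auto)
    then show ?thesis using z that by (simp add: cos_60 mult_left_mono)
  qed auto
  have "norm (cis x - 1) = 2 * \<bar>sin (x / 2)\<bar>"
    using dist_exp_i_1[of x] by (simp add: cis_conv_exp)
  moreover have "\<bar>sin (x / 2)\<bar> \<ge> \<bar>x\<bar> / 4"
    using *[of "x/2"] *[of "-x/2"] assms by (cases "x \<ge> 0") auto
  ultimately show ?thesis by simp
qed

text \<open>Summation by parts against \<open>1 / (cis (G (n + 1) - G n) - 1)\<close>; controlling the second differences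
  replaces the monotonicity hypothesis of the Kusmin--Landau inequality.\<close>

lemma norm_sum_cis_le_slowly_varying:
  fixes G :: "nat \<Rightarrow> real"
  assumes l: "l > 0" and \<delta>: "\<And>n. n \<in> {a..a+M} \<Longrightarrow> \<bar>G (Suc n) - G n\<bar> \<in> {l..1}"
    and \<mu>: "\<And>n. n \<in> {a..<a+M} \<Longrightarrow> \<bar>(G (Suc (Suc n)) - G (Suc n)) - (G (Suc n) - G n)\<bar> \<le> \<mu>"
  shows "norm (\<Sum>n\<in>{a..<a+M}. cis (G n)) \<le> 4 / l + 4 * real M * \<mu> / l\<^sup>2"
proof -
  define \<delta> where "\<delta> n = G (Suc n) - G n" for n
  define w where "w n = 1 / (cis (\<delta> n) - 1)" for n
  have w: "norm (w n) \<le> 2 / l" "cis (\<delta> n) \<noteq> 1" if "n \<in> {a..a+M}" for n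
  proof -
    have d: "\<bar>\<delta> n\<bar> \<ge> l" "\<bar>\<delta> n\<bar> \<le> 1" using \<delta>[OF that] by (auto simp: \<delta>_def)
    have *: "norm (cis (\<delta> n) - 1) \<ge> l / 2" using norm_cis_minus_1_ge[OF d(2)] d by linarith
    then show "cis (\<delta> n) \<noteq> 1" using l by auto
    have "norm (w n) = 1 / norm (cis (\<delta> n) - 1)" by (simp add: w_def norm_divide)
    also have "\<dots> \<le> 1 / (l / 2)" by (rule frac_le) (use * l in auto)
    finally show "norm (w n) \<le> 2 / l" by simp
  qed
  have parts: "(\<Sum>n\<in>{a..<a+m}. w n * (cis (G (Suc n)) - cis (G n)))
     = w (a+m) * cis (G (a+m)) - w a * cis (G a) - (\<Sum>n\<in>{a..<a+m}. (w (Suc n) - w n) * cis (G (Suc n)))" for m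
    by (induction m) (simp_all add: algebra_simps)
  have "cis (G n) = w n * (cis (G (Suc n)) - cis (G n))" if "n \<in> {a..a+M}" for n
  proof -
    have "cis (G (Suc n)) - cis (G n) = cis (G n) * (cis (\<delta> n) - 1)"
      by (simp add: \<delta>_def algebra_simps cis_mult)
    then show ?thesis using w[OF that] by (simp add: w_def)
  qed
  then have "(\<Sum>n\<in>{a..<a+M}. cis (G n)) = (\<Sum>n\<in>{a..<a+M}. w n * (cis (G (Suc n)) - cis (G n)))"
    by (intro sum.cong) auto
  also note parts
  also have "norm (w (a+M) * cis (G (a+M)) - w a * cis (G a) - (\<Sum>n\<in>{a..<a+M}. (w (Suc n) - w n) * cis (G (Suc n))))
     \<le> norm (w (a+M)) + norm (w a) + norm (\<Sum>n\<in>{a..<a+M}. (w (Suc n) - w n) * cis (G (Suc n)))"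
    by (intro order.trans[OF norm_triangle_ineq4] add_mono) (simp_all add: norm_mult)
  also have "norm (\<Sum>n\<in>{a..<a+M}. (w (Suc n) - w n) * cis (G (Suc n))) \<le> (\<Sum>n\<in>{a..<a+M}. 4 * \<mu> / l\<^sup>2)"
  proof (rule sum_norm_le)
    fix n assume n: "n \<in> {a..<a+M}"
    \<comment> \<open>A difference of reciprocals produces two factors w of size at most 2 / l each,
      whence 4 * \<mu> / l^2.\<close>
    have "w (Suc n) - w n = (cis (\<delta> n) - cis (\<delta> (Suc n))) * (w n * w (Suc n))"
      using w(2)[of n] w(2)[of "Suc n"] n by (simp add: w_def field_simps)
    then have "norm ((w (Suc n) - w n) * cis (G (Suc n))) = norm (cis (\<delta> n) - cis (\<delta> (Suc n))) * (norm (w n) * norm (w (Suc n)))"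
      by (simp add: norm_mult)
    also have "\<dots> \<le> \<mu> * (2 / l * (2 / l))"
    proof (intro mult_mono)
      show "norm (cis (\<delta> n) - cis (\<delta> (Suc n))) \<le> \<mu>"
        using norm_cis_diff_le[of "\<delta> n" "\<delta> (Suc n)"] \<mu>[OF n] unfolding \<delta>_def by linarith
      then show "0 \<le> \<mu>" using norm_ge_zero order.trans by blast
    qed (use w n l in auto)
    finally show "norm ((w (Suc n) - w n) * cis (G (Suc n))) \<le> 4 * \<mu> / l\<^sup>2"
      by (simp add: power2_eq_square mult.commute)
  qed
  finally have "norm (\<Sum>n\<in>{a..<a+M}. cis (G n)) \<le> norm (w (a+M)) + norm (w a) + 4 * real M * \<mu> / l\<^sup>2"
    by (simp add: mult_ac)
  moreover have "norm (w (a+M)) \<le> 2 / l" "norm (w a) \<le> 2 / l" by (rule w; simp)+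
  moreover have "4 / l = 2 / l + 2 / l" by simp
  ultimately show ?thesis by linarith
qed

text \<open>k differencings turn the phase \<tau> * ln x into one whose increments have size about
  \<bar>\<tau>\<bar> / N^(k+1). The lower bound on \<bar>\<tau>\<bar> makes them much larger than 1
  / N, the upper bound keeps them below 1, and in this range summation by parts gives
  cancellation.\<close>

lemma dyadic_block_bound:
  assumes "\<eta> > 0"
  shows "\<exists>K\<ge>1. \<forall>N M \<tau>. K \<le> real N \<longrightarrow> K * real N ^ k \<le> \<bar>\<tau>\<bar> \<longrightarrow> K * \<bar>\<tau>\<bar> \<le> real N ^ Suc k \<longrightarrow> M \<le> N \<longrightarrow>
     norm (\<Sum>n\<in>{N..<N+M}. cis (\<tau> * ln (real n))) \<le> \<eta> * real N"
proof -
  obtain H \<epsilon> where H: "H \<ge> 1" "\<epsilon> > 0" and main: "\<And>N M a F. H \<le> N \<Longrightarrow> M \<le> N \<Longrightarrow>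
      (\<And>hs. length hs = k \<Longrightarrow> set hs \<subseteq> {1..<H} \<Longrightarrow>
          norm (\<Sum>n\<in>{a..<a+(M-sum_list hs)}. cis (iterated_diff hs F (real n))) \<le> \<epsilon> * real N) \<Longrightarrow>
      norm (\<Sum>n\<in>{a..<a+M}. cis (F (real n))) \<le> \<eta> * real N"
    using exp_sum_via_iterated_diff[OF assms, of k] by metis
  \<comment> \<open>\<open>c\<close> collects the constants of 4 / l + 4 * N * \<mu> / l^2, which
    will equal c * N^(k+1) / \<bar>\<tau>\<bar>.\<close>
  define c where "c = 4 ^ (k+2) + 4 ^ (2*k+3) * real H ^ k * fact (Suc k)"
  \<comment> \<open>The entries serve, in turn: positivity, the final comparison with \<epsilon> *
    N, room so that \<open>H \<le> N\<close> and all intermediate points stay below 4 * N, and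
    increments at most 1.\<close>
  define K where "K = max 1 (max (c / \<epsilon>) (max (real (k * H + 2 + H)) (real H ^ k * fact k)))"
  have K: "K \<ge> 1" "K \<ge> c / \<epsilon>" "K \<ge> real (k * H + 2 + H)" "K \<ge> real H ^ k * fact k"
    by (auto simp: K_def)
  show ?thesis
  proof (intro exI[of _ K] conjI allI impI K(1))
    fix N M \<tau> assume N: "K \<le> real N" "K * real N ^ k \<le> \<bar>\<tau>\<bar>" "K * \<bar>\<tau>\<bar> \<le> real N ^ Suc k" "M \<le> N"
    have NH: "N \<ge> k * H + 2 + H" using K(3) N(1) by linarith
    then have N0: "real N > 0" by simp
    have T0: "\<bar>\<tau>\<bar> > 0" using N(2) K(1) N0
      by (smt (verit) mult_pos_pos zero_less_power)
    define D where "D j x = (if j = 0 then \<tau> * ln x else \<tau> * (-1) ^ (j - 1) * fact (j - 1) / x ^ j)" for j :: nat and x :: real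
    have Dd: "(D j has_real_derivative D (Suc j) y) (at y)" if "y \<ge> 1" for j y
    proof (cases j)
      case 0
      then show ?thesis unfolding D_def using that by (auto intro!: derivative_eq_intros)
    next
      case (Suc i)
      have "((\<lambda>x. \<tau> * (-1) ^ i * fact i / x ^ Suc i) has_real_derivative
          - (\<tau> * (-1) ^ i * fact i * (real (Suc i) * y ^ i)) / (y ^ Suc i * y ^ Suc i)) (at y)"
        by (rule derivative_eq_intros refl | use that in simp)+
      also have "- (\<tau> * (-1) ^ i * fact i * (real (Suc i) * y ^ i)) / (y ^ Suc i * y ^ Suc i)
          = \<tau> * (-1) ^ Suc i * fact (Suc i) / y ^ Suc (Suc i)"
        using that by (simp add: field_simps)
      moreover have "D (Suc i) = (\<lambda>x. \<tau> * (-1) ^ i * fact i / x ^ Suc i)"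
        "D (Suc (Suc i)) y = \<tau> * (-1) ^ Suc i * fact (Suc i) / y ^ Suc (Suc i)"
        unfolding D_def by auto
      ultimately show ?thesis unfolding Suc by (simp only:)
    qed
    have D0: "D 0 = (\<lambda>x. \<tau> * ln x)" by (simp add: D_def fun_eq_iff)
    have absD: "\<bar>D (Suc j) x\<bar> = \<bar>\<tau>\<bar> * fact j / x ^ Suc j" if "x > 0" for j x
      using that by (simp add: D_def abs_mult)
    have "norm (\<Sum>n\<in>{N..<N+M}. cis (D 0 (real n))) \<le> \<eta> * real N"
    proof (rule main)
      fix hs :: "nat list" assume hs: "length hs = k" "set hs \<subseteq> {1..<H}"
      have sum: "sum_list hs \<le> k * H" using hs
        by (induction hs arbitrary: k) (auto intro!: add_mono)
      have prod: "1 \<le> prod_list hs" "prod_list hs \<le> H ^ k" using hs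
        by (induction hs arbitrary: k) (auto intro!: mult_mono)
      define M' where "M' = M - sum_list hs"
      \<comment> \<open>\<open>l\<close> bounds the increments of the k-fold difference from below,
        with intermediate points up to 4 * N; \<open>\<mu>\<close> bounds its second differences
        from above, with intermediate points from N on.\<close>
      define l where "l = \<bar>\<tau>\<bar> / (4 * real N) ^ Suc k"
      define \<mu> where "\<mu> = real H ^ k * fact (Suc k) * \<bar>\<tau>\<bar> / real N ^ Suc (Suc k)"
      have l0: "l > 0" using T0 N0 by (simp add: l_def)
      have dif: "iterated_diff (1 # hs) F x = iterated_diff hs F (x + 1) - iterated_diff hs F x" for F x
        using iterated_diff_commute[of hs F 1 x] by simp
      have dif2: "iterated_diff (1 # 1 # hs) F x = (iterated_diff hs F (x + 1 + 1) - iterated_diff hs F (x + 1)) - (iterated_diff hs F (x + 1) - iterated_diff hs F x)" for F x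
        using iterated_diff_commute[of "1 # hs" F 1 x] dif by simp
      have "norm (\<Sum>n\<in>{N..<N+M'}. cis (iterated_diff hs (D 0) (real n))) \<le> 4 / l + 4 * real M' * \<mu> / l\<^sup>2"
      proof (rule norm_sum_cis_le_slowly_varying[OF l0])
        fix n assume n: "n \<in> {N..N+M'}"
        obtain \<xi> where \<xi>: "\<xi> \<in> {real n..real n + real (sum_list (1 # hs))}"
          "iterated_diff (1 # hs) (D 0) (real n) = real (prod_list (1 # hs)) * D (length (1 # hs)) \<xi>"
          using iterated_diff_mean_value[of 1 D "real n" "1 # hs"] Dd n NH by auto
        have x: "\<xi> \<ge> real N" "\<xi> \<le> 4 * real N" using \<xi>(1) n N(4) NH sum M'_def by auto
        have "\<bar>iterated_diff (1 # hs) (D 0) (real n)\<bar> = real (prod_list hs) * (\<bar>\<tau>\<bar> * fact k / \<xi> ^ Suc k)"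
          unfolding \<xi>(2) using absD[of \<xi> k] x N0 hs(1) by (simp add: abs_mult)
        moreover have "\<dots> \<ge> 1 * (\<bar>\<tau>\<bar> * 1 / (4 * real N) ^ Suc k)"
          using x N0 prod by (intro mult_mono divide_mono power_mono) (auto simp: fact_ge_1 simp del: power_Suc)
        moreover have "real (prod_list hs) * (\<bar>\<tau>\<bar> * fact k / \<xi> ^ Suc k) \<le> real H ^ k * (\<bar>\<tau>\<bar> * fact k / real N ^ Suc k)"
          using x N0 prod by (intro mult_mono divide_mono power_mono) (auto simp del: power_Suc simp flip: of_nat_power)
        moreover have "real H ^ k * (\<bar>\<tau>\<bar> * fact k / real N ^ Suc k) \<le> 1"
        proof -
          have "real H ^ k * fact k * \<bar>\<tau>\<bar> \<le> K * \<bar>\<tau>\<bar>" using K(4) by (intro mult_right_mono) auto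
          also note N(3)
          finally show ?thesis using N0 by (simp add: field_simps del: power_Suc)
        qed
        ultimately show "\<bar>iterated_diff hs (D 0) (real (Suc n)) - iterated_diff hs (D 0) (real n)\<bar> \<in> {l..1}"
          using dif[of "D 0" "real n"] by (auto simp: l_def add.commute simp del: power_Suc)
      next
        fix n assume n: "n \<in> {N..<N+M'}"
        obtain \<xi> where \<xi>: "\<xi> \<in> {real n..real n + real (sum_list (1 # 1 # hs))}"
          "iterated_diff (1 # 1 # hs) (D 0) (real n) = real (prod_list (1 # 1 # hs)) * D (length (1 # 1 # hs)) \<xi>"
          using iterated_diff_mean_value[of 1 D "real n" "1 # 1 # hs"] Dd n NH by auto
        have x: "\<xi> \<ge> real N" using \<xi>(1) n by auto
        have "\<bar>iterated_diff (1 # 1 # hs) (D 0) (real n)\<bar> = real (prod_list hs) * (\<bar>\<tau>\<bar> * fact (Suc k) / \<xi> ^ Suc (Suc k))"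
          unfolding \<xi>(2) using absD[of \<xi> "Suc k"] x N0 hs(1) by (simp add: abs_mult)
        also have "\<dots> \<le> real H ^ k * (\<bar>\<tau>\<bar> * fact (Suc k) / real N ^ Suc (Suc k))"
          using x N0 prod by (intro mult_mono divide_mono power_mono) (auto simp del: power_Suc simp flip: of_nat_power)
        finally show "\<bar>(iterated_diff hs (D 0) (real (Suc (Suc n))) - iterated_diff hs (D 0) (real (Suc n))) - (iterated_diff hs (D 0) (real (Suc n)) - iterated_diff hs (D 0) (real n))\<bar> \<le> \<mu>"
          using dif2[of "D 0" "real n"] by (simp add: \<mu>_def add_ac mult_ac del: power_Suc)
      qed
      also have "\<dots> \<le> 4 / l + 4 * real N * \<mu> / l\<^sup>2"
        using N(4) by (intro add_mono divide_right_mono mult_right_mono) (use l0 in \<open>auto simp: M'_def \<mu>_def simp del: power_Suc fact_Suc\<close>)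
      also have "\<dots> = c * (real N ^ Suc k / \<bar>\<tau>\<bar>)"
      proof -
        define P Q A T where "P = real N ^ Suc k" and "Q = (4::real) ^ Suc k"
          and "A = real H ^ k * (fact (Suc k) :: real)" and "T = \<bar>\<tau>\<bar>"
        have pos: "P > 0" "Q > 0" "T > 0" using N0 T0 by (simp_all add: P_def Q_def T_def)
        have lP: "l = T / (Q * P)" by (simp add: l_def P_def Q_def T_def power_mult_distrib del: power_Suc)
        have \<mu>P: "\<mu> = A * T / (P * real N)" by (simp add: \<mu>_def P_def A_def T_def del: fact_Suc)
        have "4 / l = (4 * Q) * (P / T)" unfolding lP using pos by simp
        then have "4 / l = 4 ^ (k+2) * (real N ^ Suc k / \<bar>\<tau>\<bar>)" by (simp add: Q_def P_def T_def)
        moreover have "4 * real N * \<mu> / l\<^sup>2 = (4 * Q\<^sup>2) * A * (P / T)"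
          unfolding lP \<mu>P using pos N0 by (simp add: power2_eq_square)
        moreover have "(4::real) ^ (2*k+3) = 4 * Q\<^sup>2"
          unfolding Q_def by (simp only: power_even_eq[symmetric]) (simp add: power_add)
        ultimately have "4 / l + 4 * real N * \<mu> / l\<^sup>2 = 4 ^ (k+2) * (P / T) + 4 ^ (2*k+3) * A * (P / T)"
          unfolding P_def T_def by simp
        also have "\<dots> = c * (P / T)" unfolding c_def A_def by (simp only: distrib_right mult.assoc)
        finally show ?thesis unfolding P_def T_def .
      qed
      also have "\<dots> \<le> (K * \<epsilon>) * (real N ^ Suc k / \<bar>\<tau>\<bar>)"
        using K(2) H(2) by (intro mult_right_mono) (auto simp: field_simps)
      also have "\<dots> = \<epsilon> * real N * (K * real N ^ k / \<bar>\<tau>\<bar>)" by simp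
      also have "\<dots> \<le> \<epsilon> * real N * 1"
        using N(2) T0 H(2) by (intro mult_left_mono) (auto simp: field_simps)
      finally show "norm (\<Sum>n\<in>{N..<N+(M-sum_list hs)}. cis (iterated_diff hs (D 0) (real n))) \<le> \<epsilon> * real N"
        by (simp add: M'_def)
    qed (use NH N in auto)
    then show "norm (\<Sum>n\<in>{N..<N+M}. cis (\<tau> * ln (real n))) \<le> \<eta> * real N" by (simp add: D0)
  qed
qed

section \<open>The zeta function near the line of absolute convergence\<close>

text \<open>Abel summation; since the weights decrease, their total variation telescopes to c a - c
  (a + M).\<close>

lemma norm_sum_decreasing_weights_le:
  fixes u :: "nat \<Rightarrow> complex" and c :: "nat \<Rightarrow> real"
  assumes dec: "\<And>n. a \<le> n \<Longrightarrow> c (Suc n) \<le> c n" and nonneg: "\<And>n. a \<le> n \<Longrightarrow> 0 \<le> c n"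
    and B: "\<And>m. m \<le> M \<Longrightarrow> norm (\<Sum>n\<in>{a..<a+m}. u n) \<le> B"
  shows "norm (\<Sum>n\<in>{a..<a+M}. u n * of_real (c n)) \<le> B * c a"
proof -
  define U where "U m = (\<Sum>n\<in>{a..<a+m}. u n)" for m
  have "(\<Sum>n\<in>{a..<a+m}. u n * of_real (c n))
      = U m * of_real (c (a+m)) + (\<Sum>i<m. U (Suc i) * of_real (c (a+i) - c (a + Suc i)))" for m
    by (induction m) (simp_all add: U_def algebra_simps)
  then have "norm (\<Sum>n\<in>{a..<a+M}. u n * of_real (c n))
      \<le> norm (U M * of_real (c (a+M))) + norm (\<Sum>i<M. U (Suc i) * of_real (c (a+i) - c (a + Suc i)))"
    by (simp only: norm_triangle_ineq)
  also have "\<dots> \<le> B * c (a+M) + (\<Sum>i<M. B * (c (a+i) - c (a + Suc i)))"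
  proof (intro add_mono sum_norm_le)
    show "norm (U M * of_real (c (a+M))) \<le> B * c (a+M)"
      unfolding norm_mult norm_of_real using B[of M] nonneg[of "a+M"] by (auto simp: U_def intro!: mult_right_mono)
    fix i assume i: "i \<in> {..<M}"
    then have "norm (U (Suc i)) \<le> B" using B[of "Suc i"] by (simp add: U_def)
    then show "norm (U (Suc i) * of_real (c (a+i) - c (a + Suc i))) \<le> B * (c (a+i) - c (a + Suc i))"
      unfolding norm_mult norm_of_real using dec[of "a+i"] by (auto intro!: mult_right_mono)
  qed
  also have "(\<Sum>i<M. B * (c (a+i) - c (a + Suc i))) = B * (c a - c (a+M))"
    using sum_lessThan_telescope'[of "\<lambda>i. c (a+i)" M] by (simp add: sum_distrib_left[symmetric])
  finally show ?thesis by (simp add: algebra_simps)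
qed

text \<open>The general term of zeta(\<sigma> - i * \<tau>). At n = 0 it vanishes because
  \<open>0 powr _\<close> is 0, so series over all of \<open>nat\<close> need no special
  case.\<close>

definition zeta_term :: "real \<Rightarrow> real \<Rightarrow> nat \<Rightarrow> complex" where
  "zeta_term \<sigma> \<tau> n = cis (\<tau> * ln (real n)) * of_real (real n powr - \<sigma>)"

lemma norm_zeta_term [simp]: "norm (zeta_term \<sigma> \<tau> n) = real n powr - \<sigma>"
  by (simp add: zeta_term_def norm_mult)

lemma summable_zeta_term: "\<sigma> > 1 \<Longrightarrow> summable (zeta_term \<sigma> \<tau>)"
  by (rule summable_norm_cancel) (simp add: summable_real_powr_iff)

lemma zeta_term_powr:
  assumes "n \<ge> 1"
  shows "zeta_term \<sigma> \<tau> n = of_nat n powr (Complex (-\<sigma>) \<tau>)"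
proof -
  have "Complex (-\<sigma>) \<tau> * of_real (ln (real n)) = of_real (-\<sigma> * ln (real n)) + \<i> * of_real (\<tau> * ln (real n))"
    by (simp add: complex_eq_iff)
  then have "exp (Complex (-\<sigma>) \<tau> * of_real (ln (real n))) = of_real (exp (-\<sigma> * ln (real n))) * cis (\<tau> * ln (real n))"
    by (simp only: exp_add cis_conv_exp exp_of_real)
  moreover have "Ln (of_nat n) = of_real (ln (real n))"
    using assms Ln_of_real[of "real n"] by simp
  ultimately show ?thesis using assms by (simp add: zeta_term_def powr_def mult.commute)
qed

lemma zeta_term_block_le:
  assumes "\<And>m. m \<le> M \<Longrightarrow> norm (\<Sum>n\<in>{N..<N+m}. cis (\<tau> * ln (real n))) \<le> \<eta> * real N" "\<sigma> \<ge> 1" "N \<ge> 1" "\<eta> \<ge> 0"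
  shows "norm (\<Sum>n\<in>{N..<N+M}. zeta_term \<sigma> \<tau> n) \<le> \<eta>"
proof -
  have "norm (\<Sum>n\<in>{N..<N+M}. zeta_term \<sigma> \<tau> n) \<le> \<eta> * real N * real N powr - \<sigma>"
    unfolding zeta_term_def
    by (rule norm_sum_decreasing_weights_le) (use assms in \<open>auto intro!: powr_mono2'\<close>)
  also have "\<dots> \<le> \<eta> * real N * real N powr - 1"
    using assms by (intro mult_left_mono powr_mono) auto
  also have "\<dots> = \<eta>" using assms by (simp add: powr_minus)
  finally show ?thesis .
qed

section \<open>Comparison of the zeta series with an integral\<close>

lemma sum_inverse_squares_le:
  assumes "1 \<le> a" "a \<le> b"
  shows "(\<Sum>n\<in>{a..<b}. 1 / (real n)\<^sup>2) \<le> 2 / real a - 2 / real b"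
  using assms(2)
proof (induction b rule: dec_induct)
  case (step n)
  have "1 / (real n)\<^sup>2 \<le> 2 / real n - 2 / real (Suc n)"
  proof -
    have "real n + 1 \<le> 2 * real n" using assms step by simp
    then have "real n * (real n + 1) \<le> real n * (2 * real n)" by (intro mult_left_mono) auto
    then have "2 / (real n * (2 * real n)) \<le> 2 / (real n * (real n + 1))"
      using assms step by (intro divide_left_mono) auto
    then have "1 / (real n)\<^sup>2 \<le> 2 / (real n * (real n + 1))"
      by (simp add: power2_eq_square)
    also have "\<dots> = 2 / real n - 2 / real (Suc n)" using assms step by (simp add: field_simps)
    finally show ?thesis .
  qed
  then show ?case using step by simp
qed simp

text \<open>\<Phi> is a primitive of x^v with v = -\<sigma> + i * \<tau>, so the difference compares
  the term with the integral over [n, n + 1]. The mean value inequality is applied twice: to x^v,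
  and then to the primitive minus its linear part.\<close>

lemma zeta_term_telescope:
  assumes n: "n \<ge> 1" and \<sigma>: "\<sigma> \<ge> 1" and w: "Complex (1 - \<sigma>) \<tau> \<noteq> 0"
  defines "\<Phi> \<equiv> \<lambda>n::nat. of_nat n powr (Complex (1 - \<sigma>) \<tau>) / Complex (1 - \<sigma>) \<tau>"
  shows "norm (\<Phi> (Suc n) - \<Phi> n - zeta_term \<sigma> \<tau> n) \<le> norm (Complex (-\<sigma>) \<tau>) / (real n)\<^sup>2"
proof -
  define v where "v = Complex (-\<sigma>) \<tau>"
  have v1: "Complex (1 - \<sigma>) \<tau> = v + 1" by (rule complex_eqI) (simp_all add: v_def)
  have v2: "v + 1 \<noteq> 0" using w unfolding v1 .
  note v = v1 v2
  define S where "S = closed_segment (of_nat n :: complex) (of_nat (Suc n))"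
  have S: "\<exists>u. z = of_real u \<and> real n \<le> u \<and> u \<le> real n + 1" if zS: "z \<in> S" for z
  proof -
    have "S = of_real ` closed_segment (real n) (real (Suc n))"
      using closed_segment_of_real[of "real n" "real (Suc n)", where 'a = complex]
      unfolding S_def of_real_of_nat_eq .
    then show ?thesis using zS by (auto simp: closed_segment_eq_real_ivl)
  qed
  have ends: "of_nat n \<in> S" "of_nat (Suc n) \<in> S" by (simp_all add: S_def)
  have nonneg: "z \<notin> \<real>\<^sub>\<le>\<^sub>0" if "z \<in> S" for z
    using S[OF that] n by (auto simp: complex_nonpos_Reals_iff)
  have d1: "((\<lambda>z. z powr v) has_field_derivative v * z powr (v - 1)) (at z within S)" if "z \<in> S" for z
    using has_field_derivative_powr[OF nonneg[OF that]] by (rule has_field_derivative_at_within)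
  have n1: "norm (v * z powr (v - 1)) \<le> norm v / (real n)\<^sup>2" if zS: "z \<in> S" for z
  proof -
    obtain u where u: "z = of_real u" "real n \<le> u" using S[OF zS] by auto
    have "norm (z powr (v - 1)) = u powr (- \<sigma> - 1)"
      using u n by (simp add: norm_powr_real_powr v_def)
    also have "\<dots> \<le> real n powr (- \<sigma> - 1)" using u n \<sigma> by (intro powr_mono2') auto
    also have "\<dots> \<le> real n powr (-2)" using n \<sigma> by (intro powr_mono) auto
    also have "\<dots> = 1 / (real n)\<^sup>2" using n by (simp add: powr_minus divide_inverse)
    finally show ?thesis unfolding norm_mult by (simp add: divide_inverse mult_left_mono)
  qed
  have b1: "norm (z powr v - of_nat n powr v) \<le> norm v / (real n)\<^sup>2" if zS: "z \<in> S" for z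
  proof -
    have "norm (z powr v - of_nat n powr v) \<le> norm v / (real n)\<^sup>2 * norm (z - of_nat n)"
      by (rule field_differentiable_bound[OF _ d1 n1]) (use zS ends S_def in auto)
    also have "\<dots> \<le> norm v / (real n)\<^sup>2 * 1"
    proof (rule mult_left_mono)
      obtain u where u: "z = of_real u" "real n \<le> u" "u \<le> real n + 1" using S[OF zS] by auto
      have "norm (z - of_nat n) = norm (complex_of_real (u - real n))" using u by simp
      then show "norm (z - of_nat n) \<le> 1" using u by (simp only: norm_of_real)
    qed simp
    finally show ?thesis by simp
  qed
  define h where "h z = z powr (v + 1) / (v + 1) - z * of_nat n powr v" for z
  have "norm (h (of_nat (Suc n)) - h (of_nat n)) \<le> norm v / (real n)\<^sup>2 * norm (of_nat (Suc n) - of_nat n :: complex)"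
  proof (rule field_differentiable_bound[where S = S and f' = "\<lambda>z. z powr v - of_nat n powr v"])
    fix z assume "z \<in> S"
    have "((\<lambda>z. z powr (v + 1)) has_field_derivative (v + 1) * z powr v) (at z)"
      using has_field_derivative_powr[OF nonneg[OF \<open>z \<in> S\<close>], of "v + 1"] by simp
    then have "(h has_field_derivative ((v + 1) * z powr v) / (v + 1) - 1 * of_nat n powr v) (at z)"
      unfolding h_def by (intro DERIV_diff DERIV_cdivide DERIV_cmult_right DERIV_ident)
    then show "(h has_field_derivative z powr v - of_nat n powr v) (at z within S)"
      using v(2) by (simp add: has_field_derivative_at_within)
  qed (use b1 ends in \<open>auto simp: S_def\<close>)
  moreover have "h (of_nat (Suc n)) - h (of_nat n) = \<Phi> (Suc n) - \<Phi> n - zeta_term \<sigma> \<tau> n"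
    unfolding zeta_term_powr[OF n] \<Phi>_def v(1) h_def by (simp add: v_def algebra_simps)
  ultimately show ?thesis by (simp add: v_def)
qed

text \<open>Euler-Maclaurin summation of lowest order. The second term is harmless only for a at
  least of order \<bar>\<tau>\<bar>; smaller indices are left to the exponential sum
  estimates.\<close>

lemma norm_zeta_tail_le:
  assumes a: "1 \<le> a" "a \<le> b" and \<sigma>: "\<sigma> \<ge> 1" and w: "Complex (1 - \<sigma>) \<tau> \<noteq> 0"
  shows "norm (\<Sum>n\<in>{a..<b}. zeta_term \<sigma> \<tau> n)
      \<le> 2 / norm (Complex (1 - \<sigma>) \<tau>) + 2 * norm (Complex (-\<sigma>) \<tau>) / real a"
proof -
  let ?w = "Complex (1 - \<sigma>) \<tau>"
  define \<Phi> where "\<Phi> = (\<lambda>n::nat. of_nat n powr ?w / Complex (1 - \<sigma>) \<tau>)"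
  have \<Phi>: "norm (\<Phi> n) \<le> 1 / norm ?w" if "n \<ge> 1" for n
  proof -
    have "norm (of_nat n powr ?w) = real n powr (1 - \<sigma>)"
      using norm_powr_real_powr[of "of_nat n" "Complex (1 - \<sigma>) \<tau>"] that by simp
    also have "\<dots> \<le> real n powr 0" using that \<sigma> by (intro powr_mono) auto
    finally show ?thesis using that by (simp add: \<Phi>_def norm_divide divide_right_mono)
  qed
  have "(\<Sum>n\<in>{a..<b}. \<Phi> (Suc n) - \<Phi> n) = \<Phi> b - \<Phi> a" using a(2) by (rule sum_Suc_diff')
  then have "(\<Sum>n\<in>{a..<b}. zeta_term \<sigma> \<tau> n) = \<Phi> b - \<Phi> a - (\<Sum>n\<in>{a..<b}. \<Phi> (Suc n) - \<Phi> n - zeta_term \<sigma> \<tau> n)"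
    by (simp add: sum_subtractf)
  also have "norm \<dots> \<le> norm (\<Phi> b) + norm (\<Phi> a) + norm (\<Sum>n\<in>{a..<b}. \<Phi> (Suc n) - \<Phi> n - zeta_term \<sigma> \<tau> n)"
    by (intro order.trans[OF norm_triangle_ineq4] add_mono norm_triangle_ineq4 order.refl)
  also have "norm (\<Sum>n\<in>{a..<b}. \<Phi> (Suc n) - \<Phi> n - zeta_term \<sigma> \<tau> n)
      \<le> (\<Sum>n\<in>{a..<b}. norm (Complex (-\<sigma>) \<tau>) / (real n)\<^sup>2)"
    unfolding \<Phi>_def by (rule sum_norm_le, rule zeta_term_telescope) (use a \<sigma> w in auto)
  also have "\<dots> = norm (Complex (-\<sigma>) \<tau>) * (\<Sum>n\<in>{a..<b}. 1 / (real n)\<^sup>2)"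
    by (simp add: sum_distrib_left)
  also have "\<dots> \<le> norm (Complex (-\<sigma>) \<tau>) * (2 / real a)"
  proof (rule mult_left_mono)
    have "2 / real b \<ge> 0" by simp
    then show "(\<Sum>n\<in>{a..<b}. 1 / (real n)\<^sup>2) \<le> 2 / real a" using sum_inverse_squares_le[OF a] by linarith
  qed simp
  finally show ?thesis using \<Phi>[of a] \<Phi>[of b] a by (simp add: mult.commute)
qed

section \<open>Counting the dyadic scales without cancellation, and the bound for zeta\<close>

lemma card_nat_in_real_interval:
  fixes x y :: real
  assumes "x \<le> y"
  shows "finite {j::nat. x \<le> real j \<and> real j \<le> y}" "real (card {j::nat. x \<le> real j \<and> real j \<le> y}) \<le> y - x + 1"
proof -
  let ?A = "{j::nat. x \<le> real j \<and> real j \<le> y}"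
  have sub: "int ` ?A \<subseteq> {\<lceil>x\<rceil>..\<lfloor>y\<rfloor>}" by (auto simp: ceiling_le_iff le_floor_iff)
  then have "finite (int ` ?A)" by (rule finite_subset) simp
  then show "finite ?A" by (rule finite_imageD) simp
  have "card ?A = card (int ` ?A)" by (simp add: card_image)
  also have "\<dots> \<le> card {\<lceil>x\<rceil>..\<lfloor>y\<rfloor>}" by (rule card_mono[OF _ sub]) simp
  finally have "real (card ?A) \<le> real (nat (\<lfloor>y\<rfloor> - \<lceil>x\<rceil> + 1))" by simp
  also have "\<dots> \<le> y - x + 1" using assms by (cases "\<lfloor>y\<rfloor> - \<lceil>x\<rceil> + 1 \<ge> 0") (simp_all, linarith)
  finally show "real (card ?A) \<le> y - x + 1" .
qed


text \<open>On the logarithmic scale, with l = log 2 T, a scale j fails only if it is bounded, or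
  lies below about l / A, so that about A or more differencings would be called for, or lies within
  a bounded distance of some l / k with k < A, where T is comparable to a power of 2^j. Each k
  accounts for O(1) scales.\<close>

lemma card_bad_dyadic_scales:
  fixes K :: real
  assumes A: "A \<ge> 2" and K: "K \<ge> 1"
  shows "\<exists>C. \<forall>T J. T \<ge> 1 \<longrightarrow> real J \<le> log 2 (T + 2) + 1 \<longrightarrow>
    real (card {j. j < J \<and> \<not> (\<exists>k\<in>{1..<A}. K \<le> 2 ^ j \<and> K * (2 ^ j) ^ k \<le> T \<and> K * T \<le> (2 ^ j) ^ Suc k)})
      \<le> log 2 (T + 2) / real A + C"
proof -
  define \<kappa> where "\<kappa> = log 2 K"
  have \<kappa>: "\<kappa> \<ge> 0" "K = 2 powr \<kappa>" using K by (auto simp: \<kappa>_def)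
  define C where "C = (\<kappa> + 1) + (\<kappa> + 1) + real A * (2 * (\<kappa> + 3) + 1)"
  show ?thesis
  proof (intro exI[of _ C] allI impI)
    fix T :: real and J assume T: "T \<ge> 1" and J: "real J \<le> log 2 (T + 2) + 1"
    define l where "l = log 2 T"
    have l: "l \<ge> 0" "T = 2 powr l" using T by (auto simp: l_def)
    have "log 2 (T + 2) \<le> log 2 (4 * T)" using T by (subst log_le_cancel_iff) auto
    also have "\<dots> = l + 2" using T log_nat_power[of 2 2 2] by (simp add: log_mult l_def)
    finally have Jl: "real J \<le> l + 3" using J by simp
    have ll: "l \<le> log 2 (T + 2)" unfolding l_def using T by (subst log_le_cancel_iff) auto
    have p: "(2::real) ^ m = 2 powr real m" for m by (simp add: powr_realpow)
    have good: "K \<le> 2 ^ j \<longleftrightarrow> \<kappa> \<le> real j" "K * (2 ^ j) ^ k \<le> T \<longleftrightarrow> \<kappa> + real j * real k \<le> l"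
      "K * T \<le> (2 ^ j) ^ k \<longleftrightarrow> \<kappa> + l \<le> real j * real k" for j k
      unfolding \<kappa>(2) l(2) power_mult[symmetric] unfolding p of_nat_mult by (simp_all flip: powr_add)
    let ?bad = "{j. j < J \<and> \<not> (\<exists>k\<in>{1..<A}. K \<le> 2 ^ j \<and> K * (2 ^ j) ^ k \<le> T \<and> K * T \<le> (2 ^ j) ^ Suc k)}"
    define S1 where "S1 = {j::nat. 0 \<le> real j \<and> real j \<le> \<kappa>}"
    define S2 where "S2 = {j::nat. 0 \<le> real j \<and> real j \<le> (l + \<kappa>) / real A}"
    define S3 where "S3 k = {j::nat. (l - (\<kappa> + 3)) / real k \<le> real j \<and> real j \<le> (l + (\<kappa> + 3)) / real k}" for k
    have "?bad \<subseteq> S1 \<union> S2 \<union> (\<Union>k\<in>{1..<A}. S3 k)"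
    proof
      fix j assume j: "j \<in> ?bad"
      show "j \<in> S1 \<union> S2 \<union> (\<Union>k\<in>{1..<A}. S3 k)"
      proof (cases "real j \<le> \<kappa> \<or> real j * real A \<le> l + \<kappa>")
        case True
        then show ?thesis using A by (auto simp: S1_def S2_def field_simps)
      next
        case False
        let ?P = "\<lambda>k. k \<ge> 1 \<and> \<kappa> + l \<le> real j * real (Suc k)"
        have ex: "?P (A - 1)" using False A by auto
        \<comment> \<open>The least \<open>k\<close> for which K * T \<le> (2^j)^(k+1). For a bad
          scale the inequality on the other side must fail, so j * k > l - \<kappa>. Minimality
          bounds j * k from above, and for \<open>k = 1\<close> the bound on \<open>J\<close>
          does.\<close>
        define k where "k = (LEAST k. ?P k)"
        have k: "?P k" unfolding k_def by (rule LeastI[of ?P, OF ex])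
        have kA: "k < A" using Least_le[of ?P, OF ex] A unfolding k_def by linarith
        have hi: "\<kappa> + real j * real k > l"
        proof -
          have "\<not> (K \<le> 2 ^ j \<and> K * (2 ^ j) ^ k \<le> T \<and> K * T \<le> (2 ^ j) ^ Suc k)" using j k kA by auto
          then show ?thesis using False k unfolding good by linarith
        qed
        have lo: "real j * real k \<le> l + (\<kappa> + 3)"
        proof (cases "k = 1")
          case True
          then show ?thesis using Jl j \<kappa> by auto
        next
          case False
          then have "\<not> ?P (k - 1)" using k unfolding k_def by (intro not_less_Least) linarith
          then show ?thesis using False k by auto
        qed
        have "j \<in> S3 k" using hi lo k by (auto simp: S3_def field_simps)
        then show ?thesis using k kA by auto
      qed
    qed
    moreover have fin: "finite S1" "finite S2" "\<And>k. k \<in> {1..<A} \<Longrightarrow> finite (S3 k)"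
      unfolding S1_def S2_def S3_def
      by (intro card_nat_in_real_interval(1) divide_right_mono; use \<kappa> l in simp)+
    ultimately have "card ?bad \<le> card (S1 \<union> S2 \<union> (\<Union>k\<in>{1..<A}. S3 k))"
      by (intro card_mono) auto
    also have "\<dots> \<le> card (S1 \<union> S2) + card (\<Union>k\<in>{1..<A}. S3 k)" by (rule card_Un_le)
    also have "\<dots> \<le> card S1 + card S2 + (\<Sum>k\<in>{1..<A}. card (S3 k))"
      by (intro add_mono card_Un_le card_UN_le) auto
    finally have "real (card ?bad) \<le> real (card S1) + real (card S2) + (\<Sum>k\<in>{1..<A}. real (card (S3 k)))"
      by (simp flip: of_nat_sum of_nat_add)
    also have "\<dots> \<le> (\<kappa> - 0 + 1) + ((l + \<kappa>) / real A - 0 + 1) + (\<Sum>k\<in>{1..<A}. 2 * (\<kappa> + 3) + 1)"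
    proof (intro add_mono sum_mono)
      show "real (card S1) \<le> \<kappa> - 0 + 1" unfolding S1_def using \<kappa> by (intro card_nat_in_real_interval(2))
      show "real (card S2) \<le> (l + \<kappa>) / real A - 0 + 1" unfolding S2_def using \<kappa> l by (intro card_nat_in_real_interval(2)) auto
      fix k assume k: "k \<in> {1..<A}"
      have "real (card (S3 k)) \<le> (l + (\<kappa> + 3)) / real k - (l - (\<kappa> + 3)) / real k + 1"
        unfolding S3_def using \<kappa> by (intro card_nat_in_real_interval(2) divide_right_mono) auto
      also have "\<dots> = 2 * (\<kappa> + 3) / real k + 1" by (simp add: diff_divide_distrib add_divide_distrib)
      also have "\<dots> \<le> 2 * (\<kappa> + 3) / 1 + 1" using k \<kappa> by (intro add_mono divide_left_mono) auto
      finally show "real (card (S3 k)) \<le> 2 * (\<kappa> + 3) + 1" by simp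
    qed
    also have "\<dots> \<le> log 2 (T + 2) / real A + C"
    proof -
      have "(l + \<kappa>) / real A \<le> log 2 (T + 2) / real A + \<kappa>"
      proof -
        have "\<kappa> / real A \<le> \<kappa> / 1" using \<kappa> A by (intro divide_left_mono) auto
        moreover have "l / real A \<le> log 2 (T + 2) / real A" using ll by (intro divide_right_mono) auto
        ultimately show ?thesis by (simp add: add_divide_distrib)
      qed
      moreover have "(\<Sum>k\<in>{1..<A}. 2 * (\<kappa> + 3) + 1) \<le> real A * (2 * (\<kappa> + 3) + 1)"
        using \<kappa> by (simp add: mult_right_mono)
      ultimately show ?thesis by (simp add: C_def)
    qed
    finally show "real (card ?bad) \<le> log 2 (T + 2) / real A + C" .
  qed
qed

lemma zeta_term_dyadic_sum:
  "(\<Sum>n\<in>{1..<2 ^ J}. zeta_term \<sigma> \<tau> n) = (\<Sum>j<J. \<Sum>n\<in>{2 ^ j..<2 ^ j + 2 ^ j}. zeta_term \<sigma> \<tau> n)"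
proof (induction J)
  case (Suc J)
  have "{1..<2 ^ Suc J :: nat} = {1..<2 ^ J} \<union> {2 ^ J..<2 ^ J + 2 ^ J}"
    by (auto simp: Suc_le_eq)
  then show ?case using Suc by (simp add: sum.union_disjoint)
qed simp

lemma zeta_term_block_le_1:
  assumes "\<sigma> \<ge> 1" "N \<ge> 1"
  shows "norm (\<Sum>n\<in>{N..<N+N}. zeta_term \<sigma> \<tau> n) \<le> 1"
proof (rule zeta_term_block_le)
  fix m assume "m \<le> N"
  have "norm (\<Sum>n\<in>{N..<N+m}. cis (\<tau> * ln (real n))) \<le> (\<Sum>n\<in>{N..<N+m}. 1)" by (rule sum_norm_le) simp
  then show "norm (\<Sum>n\<in>{N..<N+m}. cis (\<tau> * ln (real n))) \<le> 1 * real N" using \<open>m \<le> N\<close> by simp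
qed (use assms in auto)

text \<open>Good scales contribute \<eta> each, the others at most 1 each, and the latter number at
  most log / A + C. The range stops at 2^J of order \<bar>\<tau>\<bar>, so a saving per scale is a
  saving against log \<bar>\<tau>\<bar>.\<close>

lemma zeta_dyadic_partial_sum_le:
  assumes "\<epsilon> > 0"
  shows "\<exists>C\<ge>0. \<forall>\<sigma> \<tau> J. \<sigma> \<ge> 1 \<longrightarrow> real J \<le> log 2 (\<bar>\<tau>\<bar> + 2) + 1 \<longrightarrow>
    norm (\<Sum>n\<in>{1..<2 ^ J}. zeta_term \<sigma> \<tau> n) \<le> \<epsilon> * log 2 (\<bar>\<tau>\<bar> + 2) + C"
proof -
  define \<eta> where "\<eta> = \<epsilon> / 2"
  have \<eta>: "\<eta> > 0" using assms by (simp add: \<eta>_def)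
  have "\<exists>K. \<forall>k. K k \<ge> 1 \<and> (\<forall>N M \<tau>. K k \<le> real N \<longrightarrow> K k * real N ^ k \<le> \<bar>\<tau>\<bar> \<longrightarrow> K k * \<bar>\<tau>\<bar> \<le> real N ^ Suc k \<longrightarrow> M \<le> N \<longrightarrow>
     norm (\<Sum>n\<in>{N..<N+M}. cis (\<tau> * ln (real n))) \<le> \<eta> * real N)"
    using dyadic_block_bound[OF \<eta>] by (intro choice) blast
  then obtain K where K1: "\<And>k. K k \<ge> 1" and K: "\<And>k N M \<tau>. K k \<le> real N \<Longrightarrow> K k * real N ^ k \<le> \<bar>\<tau>\<bar> \<Longrightarrow> K k * \<bar>\<tau>\<bar> \<le> real N ^ Suc k \<Longrightarrow> M \<le> N \<Longrightarrow>
     norm (\<Sum>n\<in>{N..<N+M}. cis (\<tau> * ln (real n))) \<le> \<eta> * real N" by blast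
  define A where "A = nat \<lceil>1 / \<eta>\<rceil> + 2"
  have "real A \<ge> 1 / \<eta>" unfolding A_def by linarith
  moreover have A2: "A \<ge> 2" by (simp add: A_def)
  ultimately have A: "1 / real A \<le> \<eta>" using \<eta> by (simp add: field_simps)
  \<comment> \<open>One threshold that serves all exponents k < A at once.\<close>
  define L where "L = 1 + (\<Sum>k<A. K k)"
  have LK: "K k \<le> L" if "k < A" for k
  proof -
    have "K k \<le> (\<Sum>k<A. K k)" using that K1 by (intro member_le_sum) (auto intro: order.trans[OF zero_le_one])
    then show ?thesis by (simp add: L_def)
  qed
  have L1: "L \<ge> 1" unfolding L_def using sum_nonneg[of "{..<A}" K] order.trans[OF zero_le_one K1] by simp
  obtain C where C: "\<And>T J. T \<ge> 1 \<Longrightarrow> real J \<le> log 2 (T + 2) + 1 \<Longrightarrow>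
    real (card {j. j < J \<and> \<not> (\<exists>k\<in>{1..<A}. L \<le> 2 ^ j \<and> L * (2 ^ j) ^ k \<le> T \<and> L * T \<le> (2 ^ j) ^ Suc k)})
      \<le> log 2 (T + 2) / real A + C"
    using card_bad_dyadic_scales[OF A2 L1] by (elim exE) blast
  show ?thesis
  proof (intro exI[of _ "\<bar>C\<bar> + \<eta> + 3"] conjI allI impI)
    show "\<bar>C\<bar> + \<eta> + 3 \<ge> 0" using \<eta> by simp
    fix \<sigma> \<tau> :: real and J assume \<sigma>: "\<sigma> \<ge> 1" and J: "real J \<le> log 2 (\<bar>\<tau>\<bar> + 2) + 1"
    let ?l = "log 2 (\<bar>\<tau>\<bar> + 2)"
    let ?b = "\<lambda>j. norm (\<Sum>n\<in>{2 ^ j..<2 ^ j + 2 ^ j}. zeta_term \<sigma> \<tau> n)"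
    have l0: "?l \<ge> 0" by simp
    have le1: "?b j \<le> 1" for j using zeta_term_block_le_1[OF \<sigma>, of "2 ^ j" \<tau>] by simp
    have total: "norm (\<Sum>n\<in>{1..<2 ^ J}. zeta_term \<sigma> \<tau> n) \<le> (\<Sum>j<J. ?b j)"
      unfolding zeta_term_dyadic_sum by (rule norm_sum)
    show "norm (\<Sum>n\<in>{1..<2 ^ J}. zeta_term \<sigma> \<tau> n) \<le> \<epsilon> * ?l + (\<bar>C\<bar> + \<eta> + 3)"
    proof (cases "\<bar>\<tau>\<bar> \<ge> 1")
      case False
      have "?l \<le> log 2 (2 ^ 2)" using False by (subst log_le_cancel_iff) auto
      also have "\<dots> = 2" by (subst log_nat_power) auto
      finally have "real J \<le> 3" using J by simp
      moreover have "(\<Sum>j<J. ?b j) \<le> (\<Sum>j<J. 1)" by (intro sum_mono le1)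
      ultimately have "norm (\<Sum>n\<in>{1..<2 ^ J}. zeta_term \<sigma> \<tau> n) \<le> 3" using total by simp
      then show ?thesis using mult_nonneg_nonneg[OF less_imp_le[OF assms] l0] \<eta> by linarith
    next
      case True
      let ?good = "\<lambda>j::nat. \<exists>k\<in>{1..<A}. L \<le> 2 ^ j \<and> L * (2 ^ j) ^ k \<le> \<bar>\<tau>\<bar> \<and> L * \<bar>\<tau>\<bar> \<le> (2 ^ j) ^ Suc k"
      have good: "?b j \<le> \<eta>" if gj: "?good j" for j
      proof (rule zeta_term_block_le)
        obtain k where k: "k < A" "L \<le> 2 ^ j" "L * (2 ^ j) ^ k \<le> \<bar>\<tau>\<bar>" "L * \<bar>\<tau>\<bar> \<le> (2 ^ j) ^ Suc k" using gj by auto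
        fix m :: nat assume m: "m \<le> 2 ^ j"
        show "norm (\<Sum>n\<in>{2 ^ j..<2 ^ j + m}. cis (\<tau> * ln (real n))) \<le> \<eta> * real (2 ^ j)"
        proof (rule K[of k])
          show "K k \<le> real (2 ^ j)" using LK[OF k(1)] k(2) by simp
          have "K k * (2 ^ j) ^ k \<le> L * (2 ^ j) ^ k" using LK[OF k(1)] by (intro mult_right_mono) auto
          then show "K k * real (2 ^ j) ^ k \<le> \<bar>\<tau>\<bar>" using k(3) unfolding of_nat_power of_nat_numeral by linarith
          have "K k * \<bar>\<tau>\<bar> \<le> L * \<bar>\<tau>\<bar>" using LK[OF k(1)] by (intro mult_right_mono) auto
          then show "K k * \<bar>\<tau>\<bar> \<le> real (2 ^ j) ^ Suc k" using k(4) unfolding of_nat_power of_nat_numeral by linarith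
        qed (use m in auto)
      qed (use \<sigma> \<eta> in auto)
      have "(\<Sum>j<J. ?b j) \<le> (\<Sum>j<J. \<eta> + (if ?good j then 0 else 1))"
        by (rule sum_mono) (use good le1 \<eta> in \<open>auto intro: order.trans[OF le1]\<close>)
      also have "\<dots> = real J * \<eta> + (\<Sum>j<J. if ?good j then 0 else 1)" by (simp add: sum.distrib)
      also have "(\<Sum>j<J. if ?good j then 0 else 1 :: real) = (\<Sum>j\<in>{j. j < J \<and> \<not> ?good j}. 1)"
        by (rule sum.mono_neutral_cong_right) auto
      also have "\<dots> = real (card {j. j < J \<and> \<not> ?good j})" by simp
      also have "\<dots> \<le> ?l / real A + C" by (rule C[OF True J])
      also have "real J * \<eta> \<le> (?l + 1) * \<eta>" using J \<eta> by (intro mult_right_mono) auto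
      also have "?l / real A \<le> ?l * \<eta>"
        using mult_left_mono[OF A l0] by simp
      finally have "(\<Sum>j<J. ?b j) \<le> (?l + 1) * \<eta> + (?l * \<eta> + C)" by simp
      also have "\<dots> = \<epsilon> * ?l + (C + \<eta>)" by (simp add: \<eta>_def field_simps)
      finally show ?thesis using total by linarith
    qed
  qed
qed

text \<open>The series is cut at 2^J \<ge> \<bar>\<tau>\<bar> + 2, with exponential sums below and
  comparison with the integral above. The first term reflects the pole at 1.\<close>

lemma norm_zeta_le:
  assumes "\<epsilon> > 0"
  shows "\<exists>C. \<forall>\<sigma> \<tau>. 1 < \<sigma> \<longrightarrow> \<sigma> \<le> 2 \<longrightarrow>
    norm (suminf (zeta_term \<sigma> \<tau>)) \<le> 2 / norm (Complex (1 - \<sigma>) \<tau>) + \<epsilon> * log 2 (\<bar>\<tau>\<bar> + 2) + C"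
proof -
  obtain C where C: "\<And>\<sigma> \<tau> J. \<sigma> \<ge> 1 \<Longrightarrow> real J \<le> log 2 (\<bar>\<tau>\<bar> + 2) + 1 \<Longrightarrow>
    norm (\<Sum>n\<in>{1..<2 ^ J}. zeta_term \<sigma> \<tau> n) \<le> \<epsilon> * log 2 (\<bar>\<tau>\<bar> + 2) + C"
    using zeta_dyadic_partial_sum_le[OF assms] by blast
  show ?thesis
  \<comment> \<open>The extra 2 absorbs the error of the integral comparison, which is at most 2 *
    (\<bar>\<tau>\<bar> + 2) / 2^J.\<close>
  proof (intro exI[of _ "C + 2"] allI impI)
    fix \<sigma> \<tau> :: real assume \<sigma>: "1 < \<sigma>" "\<sigma> \<le> 2"
    let ?B = "2 / norm (Complex (1 - \<sigma>) \<tau>) + \<epsilon> * log 2 (\<bar>\<tau>\<bar> + 2) + (C + 2)"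
    let ?S = "\<lambda>A. \<Sum>n\<in>A. zeta_term \<sigma> \<tau> n"
    define J where "J = nat \<lceil>log 2 (\<bar>\<tau>\<bar> + 2)\<rceil>"
    have J: "real J \<le> log 2 (\<bar>\<tau>\<bar> + 2) + 1" "real J \<ge> log 2 (\<bar>\<tau>\<bar> + 2)"
      unfolding J_def using zero_le_log_cancel_iff[of 2 "\<bar>\<tau>\<bar> + 2"] by linarith+
    have J2: "\<bar>\<tau>\<bar> + 2 \<le> 2 ^ J"
    proof -
      have "\<bar>\<tau>\<bar> + 2 = 2 powr log 2 (\<bar>\<tau>\<bar> + 2)" by simp
      also have "\<dots> \<le> 2 powr real J" using J(2) by (intro powr_mono) auto
      finally show ?thesis by (simp add: powr_realpow)
    qed
    have "(\<lambda>b. norm (\<Sum>n<b. zeta_term \<sigma> \<tau> n)) \<longlonglongrightarrow> norm (suminf (zeta_term \<sigma> \<tau>))"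
      using summable_LIMSEQ[OF summable_zeta_term[OF \<sigma>(1)]] by (rule tendsto_norm)
    then show "norm (suminf (zeta_term \<sigma> \<tau>)) \<le> ?B"
    proof (rule tendsto_upperbound)
      show "\<forall>\<^sub>F b in sequentially. norm (\<Sum>n<b. zeta_term \<sigma> \<tau> n) \<le> ?B"
        using eventually_ge_at_top[of "2 ^ J"]
      proof eventually_elim
        case (elim b)
        have "zeta_term \<sigma> \<tau> 0 = 0" by (simp add: zeta_term_def)
        moreover have "{..<b} = insert 0 ({1..<2 ^ J} \<union> {2 ^ J..<b})"
          using elim by (auto simp: Suc_le_eq intro: Nat.gr0I)
        ultimately have "(\<Sum>n<b. zeta_term \<sigma> \<tau> n) = (?S {1..<2 ^ J}) + (?S {2 ^ J..<b})"
          by (simp add: sum.union_disjoint)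
        then have "norm (\<Sum>n<b. zeta_term \<sigma> \<tau> n) \<le> norm (?S {1..<2 ^ J}) + norm (?S {2 ^ J..<b})"
          by (simp add: norm_triangle_ineq)
        moreover have "norm (?S {2 ^ J..<b}) \<le> 2 / norm (Complex (1 - \<sigma>) \<tau>) + 2 * norm (Complex (-\<sigma>) \<tau>) / real (2 ^ J)"
          by (rule norm_zeta_tail_le) (use elim \<sigma> in \<open>auto simp: complex_eq_iff\<close>)
        moreover have "2 * norm (Complex (-\<sigma>) \<tau>) / real (2 ^ J) \<le> 2"
        proof -
          have "norm (Complex (-\<sigma>) \<tau>) \<le> \<bar>\<tau>\<bar> + 2" using cmod_le[of "Complex (-\<sigma>) \<tau>"] \<sigma> by simp
          then show ?thesis using J2 by (simp add: field_simps)
        qed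
        ultimately show ?case using C[of \<sigma> J \<tau>] J(1) \<sigma> by linarith
      qed
    qed simp
  qed
qed

section \<open>Euler products\<close>

definition completely_multiplicative :: "(nat \<Rightarrow> complex) \<Rightarrow> bool" where
  "completely_multiplicative g \<longleftrightarrow> g 1 = 1 \<and> (\<forall>m>0. \<forall>n>0. g (m * n) = g m * g n) \<and> (\<forall>n>0. norm (g n) \<le> 1)"

definition dirichlet_term :: "(nat \<Rightarrow> complex) \<Rightarrow> real \<Rightarrow> nat \<Rightarrow> complex" where
  "dirichlet_term g \<sigma> n = g n * of_real (real n powr - \<sigma>)"

lemma dirichlet_term_0 [simp]: "dirichlet_term g \<sigma> 0 = 0"
  by (simp add: dirichlet_term_def)

lemma dirichlet_term_mult:
  assumes "completely_multiplicative g"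
  shows "dirichlet_term g \<sigma> (m * n) = dirichlet_term g \<sigma> m * dirichlet_term g \<sigma> n"
  using assms by (cases "m = 0 \<or> n = 0") (auto simp: completely_multiplicative_def dirichlet_term_def powr_mult)

lemma norm_dirichlet_term_le:
  assumes "completely_multiplicative g"
  shows "norm (dirichlet_term g \<sigma> n) \<le> real n powr - \<sigma>"
  using assms by (cases "n = 0") (auto simp: completely_multiplicative_def dirichlet_term_def norm_mult mult_left_le_one_le)

lemma summable_nat_powr: "\<sigma> > 1 \<Longrightarrow> summable (\<lambda>n. real n powr - \<sigma>)"
  by (simp add: summable_real_powr_iff)

lemma suminf_multiples:
  fixes h :: "nat \<Rightarrow> 'a::{real_normed_vector, t2_space}"
  assumes "p > 0"
  shows "(\<Sum>n. if p dvd n then h n else 0) = (\<Sum>n. h (p * n))"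
proof -
  have "(\<Sum>n. (\<lambda>n. if p dvd n then h n else 0) (p * n)) = (\<Sum>n. if p dvd n then h n else 0)"
    by (rule suminf_mono_reindex) (use assms in \<open>auto simp: strict_mono_def\<close>)
  then show ?thesis by simp
qed

text \<open>A sieve: by complete multiplicativity, multiplying by 1 - g(p) p^(-\<sigma>) deletes
  from the remaining series exactly the terms whose index is divisible by p.\<close>

lemma finite_euler_product:
  assumes g: "completely_multiplicative g" and \<sigma>: "\<sigma> > 1" and A: "finite A" "\<And>p. p \<in> A \<Longrightarrow> prime p"
  shows "suminf (dirichlet_term g \<sigma>) * (\<Prod>p\<in>A. 1 - dirichlet_term g \<sigma> p)
       = (\<Sum>n. if \<exists>p\<in>A. p dvd n then 0 else dirichlet_term g \<sigma> n)"
  using A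
proof (induction A rule: finite_induct)
  case (insert p A)
  define h where "h n = (if \<exists>p\<in>A. p dvd n then 0 else dirichlet_term g \<sigma> n)" for n
  have p: "prime p" "p > 0" using insert.prems prime_gt_0_nat by auto
  have hs: "summable h"
    by (rule summable_comparison_test'[OF summable_nat_powr[OF \<sigma>], of 0])
      (use norm_dirichlet_term_le[OF g] in \<open>auto simp: h_def\<close>)
  have hs': "summable (\<lambda>n. if p dvd n then h n else 0)"
    by (rule summable_comparison_test'[OF summable_nat_powr[OF \<sigma>], of 0])
      (use norm_dirichlet_term_le[OF g] in \<open>auto simp: h_def\<close>)
  have hp: "h (p * n) = dirichlet_term g \<sigma> p * h n" for n
  proof -
    have "q dvd p * n \<longleftrightarrow> q dvd n" if "q \<in> A" for q
    proof -
      have "prime q" "q \<noteq> p" using insert that by auto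
      then show ?thesis using p primes_dvd_imp_eq prime_dvd_mult_iff by blast
    qed
    then show ?thesis by (simp add: h_def dirichlet_term_mult[OF g])
  qed
  have "suminf (dirichlet_term g \<sigma>) * (\<Prod>p\<in>insert p A. 1 - dirichlet_term g \<sigma> p)
      = suminf h * (1 - dirichlet_term g \<sigma> p)"
    using insert by (simp add: h_def[abs_def] mult.commute mult.left_commute)
  also have "\<dots> = suminf h - (\<Sum>n. dirichlet_term g \<sigma> p * h n)"
    using suminf_mult[OF hs, of "dirichlet_term g \<sigma> p"] by (simp add: algebra_simps)
  also have "(\<Sum>n. dirichlet_term g \<sigma> p * h n) = (\<Sum>n. if p dvd n then h n else 0)"
    using suminf_multiples[OF p(2), of h] by (simp add: hp)
  also have "suminf h - \<dots> = (\<Sum>n. h n - (if p dvd n then h n else 0))"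
    by (rule suminf_diff[OF hs hs'])
  also have "\<dots> = (\<Sum>n. if \<exists>p\<in>insert p A. p dvd n then 0 else dirichlet_term g \<sigma> n)"
    by (rule suminf_cong) (auto simp: h_def)
  finally show ?case .
qed simp

text \<open>Phrased as a limit 1, so that no division by the series or by the product occurs. After
  sieving by the primes up to y, the index 1 is the only one left up to y, and the rest is the tail
  of a convergent series.\<close>

lemma euler_product_tendsto:
  assumes g: "completely_multiplicative g" and \<sigma>: "\<sigma> > 1"
  shows "(\<lambda>y. suminf (dirichlet_term g \<sigma>) * (\<Prod>p | prime p \<and> p \<le> y. 1 - dirichlet_term g \<sigma> p)) \<longlonglongrightarrow> 1"
proof -
  define f where "f n = real n powr - \<sigma>" for n
  have sf: "summable f" using summable_nat_powr[OF \<sigma>] by (simp add: f_def[abs_def])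
  have tail: "(\<lambda>y. \<Sum>n. f (n + Suc y)) \<longlonglongrightarrow> 0"
  proof -
    have "(\<lambda>y. suminf f - (\<Sum>n<Suc y. f n)) \<longlonglongrightarrow> suminf f - suminf f"
      by (intro tendsto_diff tendsto_const LIMSEQ_Suc summable_LIMSEQ sf)
    then show ?thesis by (simp only: suminf_minus_initial_segment[OF sf] diff_self)
  qed
  have "(\<lambda>y. suminf (dirichlet_term g \<sigma>) * (\<Prod>p | prime p \<and> p \<le> y. 1 - dirichlet_term g \<sigma> p) - 1) \<longlonglongrightarrow> 0"
  proof (rule Lim_null_comparison[OF _ tail])
    show "\<forall>\<^sub>F y in sequentially. norm (suminf (dirichlet_term g \<sigma>) * (\<Prod>p | prime p \<and> p \<le> y. 1 - dirichlet_term g \<sigma> p) - 1) \<le> (\<Sum>n. f (n + Suc y))"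
      using eventually_ge_at_top[of 1]
    proof eventually_elim
      case (elim y)
      define h where "h n = (if \<exists>p\<in>{p. prime p \<and> p \<le> y}. p dvd n then 0 else dirichlet_term g \<sigma> n)" for n
      have hf: "norm (h n) \<le> f n" for n using norm_dirichlet_term_le[OF g] by (auto simp: h_def f_def)
      have hs: "summable h" by (rule summable_comparison_test'[OF sf, of 0]) (use hf in auto)
      have hz: "h n = (if n = 1 then 1 else 0)" if "n < Suc y" for n
      proof -
        consider "n = 0" | "n = 1" | "n \<ge> 2" by linarith
        then show ?thesis
        proof cases
          case 3
          then obtain p where p: "prime p" "p dvd n" using prime_factor_nat[of n] by auto
          then have "p \<le> n" using 3 dvd_imp_le by simp
          then show ?thesis using p 3 that by (force simp: h_def)
        qed (use g in \<open>auto simp: h_def dirichlet_term_def completely_multiplicative_def prime_nat_iff\<close>)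
      qed
      have "suminf (dirichlet_term g \<sigma>) * (\<Prod>p | prime p \<and> p \<le> y. 1 - dirichlet_term g \<sigma> p) = suminf h"
        unfolding h_def by (rule finite_euler_product[OF g \<sigma>]) auto
      also have "\<dots> = (\<Sum>n. h (n + Suc y)) + (\<Sum>n<Suc y. h n)" by (rule suminf_split_initial_segment[OF hs])
      also have "(\<Sum>n<Suc y. h n) = (\<Sum>n<Suc y. if n = 1 then 1 else 0)" by (rule sum.cong) (use hz in auto)
      also have "\<dots> = 1" using elim by simp
      finally have "suminf (dirichlet_term g \<sigma>) * (\<Prod>p | prime p \<and> p \<le> y. 1 - dirichlet_term g \<sigma> p) - 1 = (\<Sum>n. h (n + Suc y))"
        by simp
      also have "norm \<dots> \<le> (\<Sum>n. f (n + Suc y))"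
        by (rule norm_suminf_le[OF hf]) (use sf in \<open>simp only: summable_iff_shift\<close>)
      finally show ?case .
    qed
  qed
  then show ?thesis by (simp only: LIM_zero_iff)
qed

section \<open>Zeta on the real axis and weighted sums over primes\<close>

lemma nat_powr_telescope:
  assumes n: "n \<ge> 1" and \<sigma>: "\<sigma> > 1"
  defines "a \<equiv> (real n powr (1 - \<sigma>) - real (Suc n) powr (1 - \<sigma>)) / (\<sigma> - 1)"
  shows "real (Suc n) powr - \<sigma> \<le> a" "a \<le> real n powr - \<sigma>"
proof -
  have "\<exists>z. z > real n \<and> z < real (Suc n) \<and> real (Suc n) powr (1 - \<sigma>) - real n powr (1 - \<sigma>)
      = (real (Suc n) - real n) * ((1 - \<sigma>) * z powr - \<sigma>)"
  proof (rule MVT2)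
    fix x assume "real n \<le> x"
    then show "((\<lambda>x. x powr (1 - \<sigma>)) has_real_derivative (1 - \<sigma>) * x powr - \<sigma>) (at x)"
      using has_real_derivative_powr[of x "1 - \<sigma>"] n by simp
  qed simp
  then obtain z where z: "z > real n" "z < real (Suc n)"
    "real (Suc n) powr (1 - \<sigma>) - real n powr (1 - \<sigma>) = (1 - \<sigma>) * z powr - \<sigma>" by auto
  then have "real n powr (1 - \<sigma>) - real (Suc n) powr (1 - \<sigma>) = (\<sigma> - 1) * z powr - \<sigma>" by (simp add: algebra_simps)
  then have a: "a = z powr - \<sigma>" unfolding a_def using \<sigma> by simp
  show "real (Suc n) powr - \<sigma> \<le> a" "a \<le> real n powr - \<sigma>"
    unfolding a using z n \<sigma> by (auto intro!: powr_mono2')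
qed

lemma zeta_real_bounds:
  assumes \<sigma>: "\<sigma> > 1"
  shows "1 / (\<sigma> - 1) \<le> (\<Sum>n. real n powr - \<sigma>)" "(\<Sum>n. real n powr - \<sigma>) \<le> 1 + 1 / (\<sigma> - 1)"
proof -
  define a where "a n = (real (Suc n) powr (1 - \<sigma>) - real (Suc (Suc n)) powr (1 - \<sigma>)) / (\<sigma> - 1)" for n
  have "(\<lambda>n. real n powr (1 - \<sigma>)) \<longlonglongrightarrow> 0"
    by (rule tendsto_neg_powr) (use \<sigma> in \<open>auto intro: filterlim_real_sequentially\<close>)
  then have "(\<lambda>n. real (Suc n) powr (1 - \<sigma>)) \<longlonglongrightarrow> 0" by (rule LIMSEQ_Suc)
  then have "(\<lambda>n. real (Suc n) powr (1 - \<sigma>) - real (Suc (Suc n)) powr (1 - \<sigma>)) sums (real (Suc 0) powr (1 - \<sigma>) - 0)"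
    by (rule telescope_sums')
  then have a: "a sums (1 / (\<sigma> - 1))" unfolding a_def[abs_def] using sums_divide by fastforce
  note s0 = summable_nat_powr[OF \<sigma>]
  have s1: "summable (\<lambda>n. real (Suc n) powr - \<sigma>)" using s0 by (subst summable_Suc_iff)
  have s2: "summable (\<lambda>n. real (Suc (Suc n)) powr - \<sigma>)" using s1 by (subst summable_Suc_iff)
  have e0: "(\<Sum>n. real n powr - \<sigma>) = (\<Sum>n. real (Suc n) powr - \<sigma>)"
    using suminf_split_head[OF s0] by simp
  have e1: "(\<Sum>n. real (Suc n) powr - \<sigma>) = 1 + (\<Sum>n. real (Suc (Suc n)) powr - \<sigma>)"
    using suminf_split_head[OF s1] by simp
  have "1 / (\<sigma> - 1) = suminf a" using a sums_unique by blast
  moreover have "suminf a \<le> (\<Sum>n. real (Suc n) powr - \<sigma>)"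
    unfolding a_def by (rule suminf_le[OF nat_powr_telescope(2)])
      (use \<sigma> s1 sums_summable[OF a] in \<open>simp_all add: a_def[abs_def]\<close>)
  moreover have "(\<Sum>n. real (Suc (Suc n)) powr - \<sigma>) \<le> suminf a"
    unfolding a_def by (rule suminf_le[OF nat_powr_telescope(1)])
      (use \<sigma> s2 sums_summable[OF a] in \<open>simp_all add: a_def[abs_def]\<close>)
  ultimately show "1 / (\<sigma> - 1) \<le> (\<Sum>n. real n powr - \<sigma>)" "(\<Sum>n. real n powr - \<sigma>) \<le> 1 + 1 / (\<sigma> - 1)"
    using e0 e1 by linarith+
qed

lemma prod_primes_dvd:
  assumes "finite A" "\<And>p. p \<in> A \<Longrightarrow> prime (p::nat) \<and> p dvd n"
  shows "\<Prod>A dvd n"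
  using assms
proof (induction A rule: finite_induct)
  case (insert p A)
  have "coprime p (\<Prod>A)"
    by (rule prod_coprime_right) (use insert in \<open>auto intro: primes_coprime\<close>)
  then show ?case using insert by (simp add: divides_mult)
qed simp

text \<open>Multiplying by zeta(\<sigma>) gives the sum over n of n^(-\<sigma>) times the sum of ln
  p over those p in A that divide n; the inner sum is at most ln n. Replacing ln n by n^\<delta> /
  \<delta> leaves zeta(1 + \<delta>) / \<delta>, and dividing by zeta(\<sigma>) \<ge> 1 / (\<sigma>
  - 1) wins one factor back.\<close>

lemma sum_ln_prime_powr_le:
  assumes \<sigma>: "1 < \<sigma>" "\<sigma> \<le> 2" and A: "finite A" "\<And>p. p \<in> A \<Longrightarrow> prime p"
  shows "(\<Sum>p\<in>A. ln (real p) * real p powr - \<sigma>) \<le> 6 / (\<sigma> - 1)"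
proof -
  define f where "f n = real n powr - \<sigma>" for n
  define Z where "Z = suminf f"
  \<comment> \<open>Half of the exponent beyond 1 pays for the logarithm, the other half keeps the
    series convergent.\<close>
  define \<delta> where "\<delta> = (\<sigma> - 1) / 2"
  have \<delta>: "\<delta> > 0" using \<sigma> by (simp add: \<delta>_def)
  have sf: "summable f" using summable_nat_powr[OF \<sigma>(1)] by (simp add: f_def[abs_def])
  have sfp: "summable (\<lambda>n. if p dvd n then f n else 0)" for p
    by (rule summable_comparison_test'[OF sf, of 0]) (auto simp: f_def)
  have Zp: "f p * Z = (\<Sum>n. if p dvd n then f n else 0)" if "p \<in> A" for p
  proof -
    have "p > 0" using A that prime_gt_0_nat by auto
    then have "(\<Sum>n. if p dvd n then f n else 0) = (\<Sum>n. f (p * n))" by (rule suminf_multiples)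
    also have "\<dots> = (\<Sum>n. f p * f n)" by (simp add: f_def powr_mult)
    finally show ?thesis using suminf_mult[OF sf] by (simp add: Z_def)
  qed
  have "(\<Sum>p\<in>A. ln (real p) * f p) * Z = (\<Sum>p\<in>A. ln (real p) * (\<Sum>n. if p dvd n then f n else 0))"
    by (simp add: sum_distrib_right mult.assoc Zp)
  also have "\<dots> = (\<Sum>p\<in>A. \<Sum>n. ln (real p) * (if p dvd n then f n else 0))"
    by (simp add: suminf_mult[OF sfp])
  also have "\<dots> = (\<Sum>n. \<Sum>p\<in>A. ln (real p) * (if p dvd n then f n else 0))"
    by (rule suminf_sum[symmetric]) (intro summable_mult sfp)
  also have "\<dots> \<le> (\<Sum>n. (1 / \<delta>) * real n powr - (1 + \<delta>))"
  proof (rule suminf_le)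
    show "summable (\<lambda>n. \<Sum>p\<in>A. ln (real p) * (if p dvd n then f n else 0))"
      by (intro summable_sum summable_mult sfp)
    show "summable (\<lambda>n. 1 / \<delta> * real n powr - (1 + \<delta>))"
      by (intro summable_mult summable_nat_powr) (use \<delta> in auto)
    fix n show "(\<Sum>p\<in>A. ln (real p) * (if p dvd n then f n else 0)) \<le> (1 / \<delta>) * real n powr - (1 + \<delta>)"
    proof (cases "n = 0")
      case False
      let ?B = "{p \<in> A. p dvd n}"
      have B: "\<Prod>?B dvd n" by (rule prod_primes_dvd) (use A in auto)
      have "(\<Sum>p\<in>A. ln (real p) * (if p dvd n then f n else 0)) = (\<Sum>p\<in>?B. ln (real p)) * f n"
        unfolding sum_distrib_right using A by (intro sum.mono_neutral_cong_right) auto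
      also have "(\<Sum>p\<in>?B. ln (real p)) = ln (real (\<Prod>?B))"
        unfolding of_nat_prod by (subst ln_prod) (use A prime_gt_0_nat in auto)
      also have "\<dots> \<le> ln (real n)"
      proof -
        have "\<Prod>?B > 0" using A prime_gt_0_nat by (intro prod_pos) auto
        then show ?thesis using dvd_imp_le[OF B] False by (subst ln_le_cancel_iff) (auto simp del: of_nat_prod)
      qed
      also have "\<dots> \<le> real n powr \<delta> / \<delta>" using False \<delta> by (intro ln_powr_bound) auto
      also have "real n powr \<delta> / \<delta> * f n = (1 / \<delta>) * real n powr - (1 + \<delta>)"
      proof -
        have "\<delta> + - \<sigma> = - (1 + \<delta>)" by (simp add: \<delta>_def field_simps)
        then have "real n powr \<delta> * real n powr - \<sigma> = real n powr - (1 + \<delta>)"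
          by (simp only: powr_add[symmetric])
        then show ?thesis by (simp add: f_def)
      qed
      finally show ?thesis by (simp add: f_def mult_right_mono)
    qed (simp add: f_def)
  qed
  also have "\<dots> = (1 / \<delta>) * (\<Sum>n. real n powr - (1 + \<delta>))"
    by (rule suminf_mult, rule summable_nat_powr) (use \<delta> in auto)
  also have "\<dots> \<le> (1 / \<delta>) * (1 + 1 / (1 + \<delta> - 1))"
    using \<delta> zeta_real_bounds(2)[of "1 + \<delta>"] by (intro mult_left_mono) auto
  finally have le: "(\<Sum>p\<in>A. ln (real p) * f p) * Z \<le> (1 / \<delta>) * (1 + 1 / \<delta>)" by simp
  have nonneg: "(\<Sum>p\<in>A. ln (real p) * f p) \<ge> 0"
    using A prime_ge_1_nat by (intro sum_nonneg) (auto simp: f_def)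
  have "(\<Sum>p\<in>A. ln (real p) * f p) * (1 / (\<sigma> - 1)) \<le> (\<Sum>p\<in>A. ln (real p) * f p) * Z"
    using zeta_real_bounds(1)[OF \<sigma>(1)] nonneg by (intro mult_left_mono) (auto simp: Z_def f_def[abs_def])
  also note le
  finally have "(\<Sum>p\<in>A. ln (real p) * f p) / (\<sigma> - 1) \<le> (2 / (\<sigma> - 1)) * (1 + 2 / (\<sigma> - 1))" by (simp add: \<delta>_def)
  also have "\<dots> \<le> (2 / (\<sigma> - 1)) * (3 / (\<sigma> - 1))" 
  proof (rule mult_left_mono)
    have "1 \<le> 1 / (\<sigma> - 1)" using \<sigma> by simp
    then show "1 + 2 / (\<sigma> - 1) \<le> 3 / (\<sigma> - 1)" by (simp add: field_simps)
  qed (use \<sigma> in auto)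
  finally have "(\<Sum>p\<in>A. ln (real p) * f p) / (\<sigma> - 1) \<le> (6 / (\<sigma> - 1)) / (\<sigma> - 1)" by simp
  then have "0 < \<sigma> - 1 \<longrightarrow> (\<Sum>p\<in>A. ln (real p) * f p) \<le> 6 / (\<sigma> - 1)" unfolding divide_le_cancel by blast
  then show ?thesis using \<sigma> by (simp add: f_def)
qed

text \<open>The square is at most (1 - u)^2 + 2 * u * (1 - Re z). Because u \<le> 1/2, the factor (1
  - u)^2 \<ge> 1/4 can be pulled out of the second term at the price of a constant 8, which the
  square root halves.\<close>

lemma euler_factor_le:
  fixes z :: complex
  assumes "norm z \<le> 1" "0 \<le> u" "u \<le> 1 / 2"
  shows "norm (1 - z * of_real u) \<le> (1 - u) * exp (4 * (u * (1 - Re z)))"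
proof (rule power2_le_imp_le)
  have R: "Re z \<le> 1" using assms(1) complex_Re_le_cmod order.trans by blast
  have "(norm (1 - z * of_real u))\<^sup>2 = 1 - 2 * u * Re z + u\<^sup>2 * (norm z)\<^sup>2"
    unfolding cmod_power2 by (simp add: power2_eq_square algebra_simps)
  also have "\<dots> \<le> 1 - 2 * u * Re z + u\<^sup>2 * 1"
    using assms(1) by (intro add_mono mult_left_mono) (auto simp: power_le_one)
  also have "\<dots> = (1 - u)\<^sup>2 + (1/4) * (8 * (u * (1 - Re z)))" by (simp add: power2_eq_square algebra_simps)
  also have "\<dots> \<le> (1 - u)\<^sup>2 + (1 - u)\<^sup>2 * (8 * (u * (1 - Re z)))"
  proof -
    have "(1/2)\<^sup>2 \<le> (1 - u)\<^sup>2" using assms by (intro power_mono) auto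
    then have "1/4 \<le> (1 - u)\<^sup>2" by (simp add: power2_eq_square)
    then show ?thesis using assms R by (intro add_mono mult_right_mono) auto
  qed
  also have "\<dots> = (1 - u)\<^sup>2 * (1 + 8 * (u * (1 - Re z)))" by (simp add: algebra_simps)
  also have "\<dots> \<le> (1 - u)\<^sup>2 * exp (8 * (u * (1 - Re z)))"
    by (intro mult_left_mono exp_ge_add_one_self) auto
  also have "\<dots> = ((1 - u) * exp (4 * (u * (1 - Re z))))\<^sup>2"
    by (simp add: power_mult_distrib power2_eq_square flip: exp_add)
  finally show "(norm (1 - z * of_real u))\<^sup>2 \<le> ((1 - u) * exp (4 * (u * (1 - Re z))))\<^sup>2" .
qed (use assms in auto)

text \<open>Comparing the Euler product of g with that of zeta factor by factor loses at most exp (4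
  * D), and zeta(\<sigma>) \<ge> 1 / (\<sigma> - 1).\<close>

lemma norm_dirichlet_series_ge:
  assumes g: "completely_multiplicative g" and \<sigma>: "\<sigma> > 1"
    and D: "\<And>y::nat. (\<Sum>p | prime p \<and> p \<le> y. real p powr - \<sigma> * (1 - Re (g p))) \<le> D"
  shows "norm (suminf (dirichlet_term g \<sigma>)) \<ge> exp (- 4 * D) / (\<sigma> - 1)"
proof -
  let ?G = "norm (suminf (dirichlet_term g \<sigma>))"
  let ?P = "\<lambda>y::nat. {p. prime p \<and> p \<le> y}"
  let ?Q = "\<lambda>y. \<Prod>p\<in>?P y. 1 - real p powr - \<sigma>"
  have one: "completely_multiplicative (\<lambda>_. 1)" by (simp add: completely_multiplicative_def)
  have t1: "dirichlet_term (\<lambda>_. 1) \<sigma> = (\<lambda>n. of_real (real n powr - \<sigma>))" by (simp add: dirichlet_term_def fun_eq_iff)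
  define Z where "Z = (\<Sum>n. real n powr - \<sigma>)"
  have Z: "suminf (dirichlet_term (\<lambda>_. 1) \<sigma>) = of_real Z"
    unfolding t1 Z_def by (rule suminf_of_real[OF summable_nat_powr[OF \<sigma>], symmetric])
  have Zge: "Z \<ge> 1 / (\<sigma> - 1)" unfolding Z_def by (rule zeta_real_bounds(1)[OF \<sigma>])
  have Z0: "Z > 0" using Zge \<sigma> by (meson less_le_trans diff_gt_0_iff_gt zero_less_divide_1_iff)
  have u: "0 \<le> real p powr - \<sigma>" "real p powr - \<sigma> \<le> 1 / 2" if "prime p" for p
  proof -
    have "real p \<ge> 2" using prime_ge_2_nat[OF that] by simp
    then have "real p powr - \<sigma> \<le> 2 powr - \<sigma>" using \<sigma> by (intro powr_mono2') auto
    also have "\<dots> \<le> 2 powr -1" using \<sigma> by (intro powr_mono) auto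
    finally show "real p powr - \<sigma> \<le> 1 / 2" by (simp add: powr_minus)
  qed simp
  have limG: "(\<lambda>y. ?G * (\<Prod>p\<in>?P y. norm (1 - dirichlet_term g \<sigma> p))) \<longlonglongrightarrow> 1"
    using tendsto_norm[OF euler_product_tendsto[OF g \<sigma>]] by (simp add: norm_mult prod_norm)
  have "(\<lambda>y. of_real (Z * ?Q y)) \<longlonglongrightarrow> (of_real 1 :: complex)"
    using euler_product_tendsto[OF one \<sigma>] unfolding Z by (simp add: t1)
  then have "(\<lambda>y. Z * ?Q y) \<longlonglongrightarrow> 1" by (simp only: tendsto_of_real_iff)
  then have "(\<lambda>y. ?G * exp (4 * D) / Z * (Z * ?Q y))
     \<longlonglongrightarrow> ?G * exp (4 * D) / Z * 1"
    by (intro tendsto_mult tendsto_const)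
  then have "(\<lambda>y. ?G * exp (4 * D) * ?Q y)
     \<longlonglongrightarrow> ?G * exp (4 * D) / Z"
    using Z0 by (simp add: field_simps)
  then have "1 \<le> ?G * exp (4 * D) / Z"
  proof (rule tendsto_le[OF sequentially_bot _ limG], intro always_eventually allI)
    fix y
    have pg: "norm (g p) \<le> 1" if "prime p" for p
      using g prime_gt_0_nat[OF that] by (simp add: completely_multiplicative_def)
    have "(\<Prod>p\<in>?P y. norm (1 - dirichlet_term g \<sigma> p)) \<le> (\<Prod>p\<in>?P y. (1 - real p powr - \<sigma>) * exp (4 * (real p powr - \<sigma> * (1 - Re (g p)))))"
      unfolding dirichlet_term_def by (intro prod_mono conjI norm_ge_zero euler_factor_le) (use u pg in auto)
    also have "\<dots> = ?Q y * exp (4 * (\<Sum>p\<in>?P y. real p powr - \<sigma> * (1 - Re (g p))))"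
      by (simp add: prod.distrib exp_sum sum_distrib_left)
    also have "\<dots> \<le> ?Q y * exp (4 * D)"
    proof (intro mult_left_mono prod_nonneg)
      show "exp (4 * (\<Sum>p\<in>?P y. real p powr - \<sigma> * (1 - Re (g p)))) \<le> exp (4 * D)" using D[of y] by simp
      fix p assume "p \<in> ?P y"
      then show "0 \<le> 1 - real p powr - \<sigma>" using u(2)[of p] by auto
    qed
    finally show "?G * (\<Prod>p\<in>?P y. norm (1 - dirichlet_term g \<sigma> p))
       \<le> ?G * exp (4 * D) * ?Q y"
      by (simp add: mult_left_mono mult_ac)
  qed
  then have "Z \<le> ?G * exp (4 * D)" using Z0 by (simp add: field_simps)
  with Zge have "1 / (\<sigma> - 1) \<le> ?G * exp (4 * D)" by linarith
  then have "exp (- 4 * D) * (1 / (\<sigma> - 1)) \<le> exp (- 4 * D) * (?G * exp (4 * D))"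
    by (intro mult_left_mono) auto
  also have "\<dots> = ?G * (exp (- 4 * D) * exp (4 * D))" by (simp only: mult_ac)
  also have "exp (- 4 * D) * exp (4 * D) = 1" by (simp flip: exp_add)
  finally show ?thesis by simp
qed

lemma finite_primes_le: "finite {p::nat. prime p \<and> real p \<le> X}"
  by (rule finite_subset[OF _ finite_atMost[of "nat \<lfloor>X\<rfloor>"]]) (auto simp: le_nat_floor)

text \<open>At \<sigma> = 1 + 1 / ln X the truncated sum controls the full one: for p > X the
  deviation 1 - Re (g p) is at most 2 \<le> 2 * ln p / ln X, and the sum of ln p * p^(-\<sigma>) is
  at most 6 * ln X. This is the origin of the 12.\<close>

lemma norm_dirichlet_series_ge_ln:
  assumes g: "completely_multiplicative g" and X: "X \<ge> 3"
    and C: "(\<Sum>p | prime p \<and> real p \<le> X. 1 / real p * (1 - Re (g p))) \<le> C"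
  shows "norm (suminf (dirichlet_term g (1 + 1 / ln X))) \<ge> exp (- 4 * (C + 12)) * ln X"
proof -
  define L where "L = ln X"
  have "exp 1 \<le> X" using X exp_le by linarith
  then have L1: "L \<ge> 1" unfolding L_def using X by (subst ln_ge_iff) auto
  define \<sigma> where "\<sigma> = 1 + 1 / L"
  have \<sigma>: "1 < \<sigma>" "\<sigma> \<le> 2" using L1 by (auto simp: \<sigma>_def)
  have Re1: "Re (g p) \<le> 1" "Re (g p) \<ge> -1" if "prime p" for p
  proof -
    have "norm (g p) \<le> 1" using g prime_gt_0_nat[OF that] by (simp add: completely_multiplicative_def)
    then show "Re (g p) \<le> 1" "Re (g p) \<ge> -1" using abs_Re_le_cmod[of "g p"] by linarith+
  qed
  have "norm (suminf (dirichlet_term g \<sigma>)) \<ge> exp (- 4 * (C + 12)) / (\<sigma> - 1)"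
  proof (rule norm_dirichlet_series_ge[OF g \<sigma>(1)])
    fix y :: nat
    let ?A = "{p. prime p \<and> p \<le> y}"
    have "(\<Sum>p\<in>?A. real p powr - \<sigma> * (1 - Re (g p)))
        \<le> (\<Sum>p\<in>?A. (if real p \<le> X then 1 / real p * (1 - Re (g p)) else 0) + 2 / L * (ln (real p) * real p powr - \<sigma>))"
    proof (rule sum_mono)
      fix p assume "p \<in> ?A"
      then have p: "prime p" "real p \<ge> 1" using prime_ge_1_nat[of p] by auto
      show "real p powr - \<sigma> * (1 - Re (g p)) \<le> (if real p \<le> X then 1 / real p * (1 - Re (g p)) else 0) + 2 / L * (ln (real p) * real p powr - \<sigma>)"
      proof (cases "real p \<le> X")
        case True
        have "real p powr - \<sigma> \<le> real p powr - 1" using p \<sigma> by (intro powr_mono) auto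
        then have "real p powr - \<sigma> * (1 - Re (g p)) \<le> 1 / real p * (1 - Re (g p))"
          using Re1[OF p(1)] p by (intro mult_right_mono) (auto simp: powr_minus divide_inverse)
        moreover have "2 / L * (ln (real p) * real p powr - \<sigma>) \<ge> 0" using L1 p by auto
        ultimately show ?thesis using True by simp
      next
        case False
        then have "L \<le> ln (real p)" unfolding L_def using X by (subst ln_le_cancel_iff) auto
        then have "1 \<le> ln (real p) / L" using L1 by simp
        then have "1 - Re (g p) \<le> 2 * (ln (real p) / L)" using Re1[OF p(1)] by linarith
        then have "real p powr - \<sigma> * (1 - Re (g p)) \<le> real p powr - \<sigma> * (2 * (ln (real p) / L))"
          by (intro mult_left_mono) auto
        then show ?thesis using False by (simp add: mult_ac)
      qed
    qed
    also have "\<dots> = (\<Sum>p\<in>?A. if real p \<le> X then 1 / real p * (1 - Re (g p)) else 0) + 2 / L * (\<Sum>p\<in>?A. ln (real p) * real p powr - \<sigma>)"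
      by (simp only: sum.distrib sum_distrib_left)
    also have "(\<Sum>p\<in>?A. if real p \<le> X then 1 / real p * (1 - Re (g p)) else 0) = (\<Sum>p\<in>{p\<in>?A. real p \<le> X}. 1 / real p * (1 - Re (g p)))"
      by (rule sum.mono_neutral_cong_right) auto
    also have "\<dots> \<le> (\<Sum>p | prime p \<and> real p \<le> X. 1 / real p * (1 - Re (g p)))"
      by (rule sum_mono2[OF finite_primes_le]) (use Re1 in auto)
    also note C
    also have "2 / L * (\<Sum>p\<in>?A. ln (real p) * real p powr - \<sigma>) \<le> 2 / L * (6 / (\<sigma> - 1))"
      using L1 \<sigma> by (intro mult_left_mono sum_ln_prime_powr_le) auto
    also have "\<dots> = 12" using L1 by (simp add: \<sigma>_def)
    finally show "(\<Sum>p\<in>?A. real p powr - \<sigma> * (1 - Re (g p))) \<le> C + 12" by simp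
  qed
  then show ?thesis by (simp add: \<sigma>_def L_def)
qed

text \<open>For p \<le> X the weight 1 / p exceeds p^(-\<sigma>) by a factor p^(1 / ln X) \<le> e
  \<le> 3, so the constant is 3 * 6.\<close>

lemma sum_ln_prime_div_le:
  assumes X: "X \<ge> 3"
  shows "(\<Sum>p | prime p \<and> real p \<le> X. ln (real p) / real p) \<le> 18 * ln X"
proof -
  define L where "L = ln X"
  have "exp 1 \<le> X" using X exp_le by linarith
  then have L1: "L \<ge> 1" unfolding L_def using X by (subst ln_ge_iff) auto
  define \<sigma> where "\<sigma> = 1 + 1 / L"
  have \<sigma>: "1 < \<sigma>" "\<sigma> \<le> 2" using L1 by (auto simp: \<sigma>_def)
  have "(\<Sum>p | prime p \<and> real p \<le> X. ln (real p) / real p) \<le> (\<Sum>p | prime p \<and> real p \<le> X. 3 * (ln (real p) * real p powr - \<sigma>))"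
  proof (rule sum_mono)
    fix p assume "p \<in> {p. prime p \<and> real p \<le> X}"
    then have p: "real p \<ge> 1" "real p \<le> X" using prime_ge_1_nat[of p] by auto
    have "real p powr (1 / L) \<le> X powr (1 / L)" using p L1 by (intro powr_mono2) auto
    also have "\<dots> = exp 1" using X L1 by (simp add: powr_def L_def)
    also have "\<dots> \<le> 3" by (rule exp_le)
    finally have "real p powr (1 / L) * real p powr - \<sigma> \<le> 3 * real p powr - \<sigma>" by (intro mult_right_mono) auto
    moreover have "real p powr (1 / L) * real p powr - \<sigma> = 1 / real p"
      using p by (simp add: \<sigma>_def powr_minus divide_inverse flip: powr_add)
    ultimately have "ln (real p) * (1 / real p) \<le> ln (real p) * (3 * real p powr - \<sigma>)"
      using p by (intro mult_left_mono) auto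
    then show "ln (real p) / real p \<le> 3 * (ln (real p) * real p powr - \<sigma>)" by simp
  qed
  also have "\<dots> = 3 * (\<Sum>p | prime p \<and> real p \<le> X. ln (real p) * real p powr - \<sigma>)" by (simp only: sum_distrib_left)
  also have "\<dots> \<le> 3 * (6 / (\<sigma> - 1))" using \<sigma> finite_primes_le by (intro mult_left_mono sum_ln_prime_powr_le) auto
  also have "\<dots> = 18 * L" using L1 by (simp add: \<sigma>_def)
  finally show ?thesis by (simp add: L_def)
qed

section \<open>Pretentious real multiplicative functions\<close>

lemma dirichlet_term_cis: "dirichlet_term (\<lambda>n. cis (\<tau> * ln (real n))) \<sigma> = zeta_term \<sigma> \<tau>"
  by (simp add: dirichlet_term_def zeta_term_def fun_eq_iff)

lemma completely_multiplicative_cis: "completely_multiplicative (\<lambda>n. cis (\<tau> * ln (real n)))"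
  by (auto simp: completely_multiplicative_def cis_mult ln_mult algebra_simps)

text \<open>The hypothesis makes \<open>\<zeta>(1 + 1 / ln X - \<i> * \<tau>)\<close> as large as a constant times \<open>ln X\<close>, while
  \<open>norm_zeta_le\<close> with a small \<open>\<epsilon>\<close> allows this only near the pole.\<close>

lemma pretentious_twist_small:
  fixes B C :: real
  assumes B: "B \<ge> 1"
  shows "\<exists>K X0. X0 \<ge> 3 \<and> K \<ge> 0 \<and> (\<forall>X \<tau>. X \<ge> X0 \<longrightarrow> \<bar>\<tau>\<bar> \<le> B * X \<longrightarrow>
     (\<Sum>p | prime p \<and> real p \<le> X. 1 / real p * (1 - cos (\<tau> * ln (real p)))) \<le> C \<longrightarrow> \<bar>\<tau>\<bar> \<le> K / ln X)"
proof -
  define c where "c = exp (- 4 * (C + 12))"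
  have c: "c > 0" by (simp add: c_def)
  \<comment> \<open>Chosen so that \<epsilon> * log 2 (_) becomes c / 4 * ln (_): for
    \<bar>\<tau>\<bar> \<le> B * X this uses up a quarter of c * ln X, apart from a
    constant.\<close>
  define \<epsilon> where "\<epsilon> = c * ln 2 / 4"
  have \<epsilon>: "\<epsilon> > 0" using c by (simp add: \<epsilon>_def)
  obtain D where D: "\<And>\<sigma> \<tau>. 1 < \<sigma> \<Longrightarrow> \<sigma> \<le> 2 \<Longrightarrow>
    norm (suminf (zeta_term \<sigma> \<tau>)) \<le> 2 / norm (Complex (1 - \<sigma>) \<tau>) + \<epsilon> * log 2 (\<bar>\<tau>\<bar> + 2) + D"
    using norm_zeta_le[OF \<epsilon>] by blast
  \<comment> \<open>The terms independent of X. From \<open>X0\<close> on they use up a second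
    quarter of c * ln X, which leaves c / 2 * ln X to be matched by the pole term.\<close>
  define R where "R = \<bar>D\<bar> + c / 4 * ln (B + 1)"
  have R: "R \<ge> 0" using c B by (simp add: R_def)
  define X0 where "X0 = max 3 (exp (4 * R / c))"
  show ?thesis
  proof (rule exI[of _ "4 / c"], rule exI[of _ X0], intro conjI allI impI)
    show "3 \<le> X0" by (simp add: X0_def)
    show "0 \<le> 4 / c" using c by simp
    fix X \<tau> :: real
    assume X: "X0 \<le> X" and \<tau>: "\<bar>\<tau>\<bar> \<le> B * X"
      and sum: "(\<Sum>p | prime p \<and> real p \<le> X. 1 / real p * (1 - cos (\<tau> * ln (real p)))) \<le> C"
    have X3: "X \<ge> 3" using X by (simp add: X0_def)
    define L where "L = ln X"
    have "exp 1 \<le> X" using X3 exp_le by linarith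
    then have L1: "L \<ge> 1" unfolding L_def using X3 by (subst ln_ge_iff) auto
    have "exp (4 * R / c) \<le> X" using X by (simp add: X0_def)
    then have "4 * R / c \<le> L" unfolding L_def using X3 by (subst ln_ge_iff) auto
    then have LR: "R \<le> c / 4 * L" using c by (simp add: field_simps)
    define \<sigma> where "\<sigma> = 1 + 1 / L"
    have \<sigma>: "1 < \<sigma>" "\<sigma> \<le> 2" using L1 by (auto simp: \<sigma>_def)
    have "c * L \<le> norm (suminf (zeta_term \<sigma> \<tau>))"
      using norm_dirichlet_series_ge_ln[OF completely_multiplicative_cis X3, of \<tau> C] sum
      by (simp add: dirichlet_term_cis c_def L_def \<sigma>_def)
    also have "\<dots> \<le> 2 / norm (Complex (1 - \<sigma>) \<tau>) + \<epsilon> * log 2 (\<bar>\<tau>\<bar> + 2) + D" by (rule D[OF \<sigma>])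
    also have "\<epsilon> * log 2 (\<bar>\<tau>\<bar> + 2) \<le> c / 4 * (ln (B + 1) + L)"
    proof -
      have "\<bar>\<tau>\<bar> + 2 \<le> (B + 1) * X" using \<tau> X3 by (simp add: algebra_simps)
      then have "ln (\<bar>\<tau>\<bar> + 2) \<le> ln ((B + 1) * X)" by simp
      also have "\<dots> = ln (B + 1) + L" using B X3 by (simp add: ln_mult L_def)
      finally have "c / 4 * ln (\<bar>\<tau>\<bar> + 2) \<le> c / 4 * (ln (B + 1) + L)" using c by (intro mult_left_mono) auto
      moreover have "\<epsilon> * log 2 (\<bar>\<tau>\<bar> + 2) = c / 4 * ln (\<bar>\<tau>\<bar> + 2)" by (simp add: \<epsilon>_def log_def)
      ultimately show ?thesis by simp
    qed
    finally have "c * L \<le> 2 / norm (Complex (1 - \<sigma>) \<tau>) + c / 4 * L + R"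
      using abs_ge_self[of D] unfolding R_def distrib_left by linarith
    then have main: "c / 2 * L \<le> 2 / norm (Complex (1 - \<sigma>) \<tau>)" using LR by linarith
    show "\<bar>\<tau>\<bar> \<le> 4 / c / ln X"
    proof (cases "\<tau> = 0")
      case True
      then show ?thesis using c L1 by (simp add: L_def)
    next
      case False
      have "\<bar>\<tau>\<bar> \<le> norm (Complex (1 - \<sigma>) \<tau>)" using abs_Im_le_cmod[of "Complex (1 - \<sigma>) \<tau>"] by simp
      then have "2 / norm (Complex (1 - \<sigma>) \<tau>) \<le> 2 / \<bar>\<tau>\<bar>" using False by (intro frac_le) auto
      with main have "c / 2 * L \<le> 2 / \<bar>\<tau>\<bar>" by linarith
      then show ?thesis using False c L1 by (simp add: L_def field_simps)
    qed
  qed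
qed

lemma norm_power_minus_1_le:
  fixes z :: complex
  assumes "norm z \<le> 1"
  shows "norm (z ^ k - 1) \<le> real k * norm (z - 1)"
  using norm_power_diff[of z 1 k] assms by simp

text \<open>Squaring makes the sign of x irrelevant: x * Re w \<le> \<bar>Re w\<bar>, and 1 -
  \<bar>Re w\<bar> controls 1 - Re (w^2). Passing from w^2 to its k-th power costs k^2, because on
  the unit circle 1 - Re v is half the square of the distance from v to 1.\<close>

lemma one_minus_Re_power_le:
  fixes w :: complex
  assumes "norm w = 1" "x \<in> {-1..1}"
  shows "1 - Re (w ^ (2 * k)) \<le> 4 * real k ^ 2 * (1 - x * Re w)"
proof -
  have half: "1 - Re v = (norm (v - 1))\<^sup>2 / 2" if "norm v = 1" for v
  proof -
    have "(Re v)\<^sup>2 + (Im v)\<^sup>2 = 1" using that cmod_power2[of v] by simp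
    then show ?thesis unfolding cmod_power2 by (simp add: power2_eq_square algebra_simps)
  qed
  have "1 - Re (w ^ (2 * k)) = (norm ((w\<^sup>2) ^ k - 1))\<^sup>2 / 2"
    using assms half[of "w ^ (2 * k)"] by (simp add: norm_power power_mult)
  also have "\<dots> \<le> (real k * norm (w\<^sup>2 - 1))\<^sup>2 / 2"
    using assms by (intro divide_right_mono power_mono norm_power_minus_1_le) (auto simp: norm_power)
  also have "\<dots> = real k ^ 2 * (1 - Re (w\<^sup>2))"
    using half[of "w\<^sup>2"] assms by (simp add: norm_power power_mult_distrib)
  also have "1 - Re (w\<^sup>2) = 2 * (1 - (Re w)\<^sup>2)"
  proof -
    have "(Re w)\<^sup>2 + (Im w)\<^sup>2 = 1" using assms cmod_power2[of w] by simp
    then show ?thesis by (simp add: power2_eq_square)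
  qed
  also have "real k ^ 2 * (2 * (1 - (Re w)\<^sup>2)) \<le> real k ^ 2 * (4 * (1 - x * Re w))"
  proof (rule mult_left_mono)
    have r: "\<bar>Re w\<bar> \<le> 1" using assms abs_Re_le_cmod[of w] by simp
    have "x * Re w \<le> \<bar>x\<bar> * \<bar>Re w\<bar>" by (metis abs_ge_self abs_mult)
    also have "\<dots> \<le> 1 * \<bar>Re w\<bar>" using assms(2) by (intro mult_right_mono) auto
    finally have a: "x * Re w \<le> \<bar>Re w\<bar>" by simp
    have "1 - (Re w)\<^sup>2 = (1 - \<bar>Re w\<bar>) * (1 + \<bar>Re w\<bar>)" by (simp add: power2_eq_square algebra_simps flip: abs_mult)
    also have "\<dots> \<le> (1 - \<bar>Re w\<bar>) * 2" using r by (intro mult_left_mono) auto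
    finally have "2 * (1 - (Re w)\<^sup>2) \<le> 4 * (1 - \<bar>Re w\<bar>)" by simp
    also have "\<dots> \<le> 4 * (1 - x * Re w)" using a by simp
    finally show "2 * (1 - (Re w)\<^sup>2) \<le> 4 * (1 - x * Re w)" .
  qed simp
  finally show ?thesis by (simp add: algebra_simps)
qed

section \<open>Dirichlet characters and the failure of strong aperiodicity\<close>

lemma dirichlet_character_eq_0: "dirichlet_character q chi \<Longrightarrow> \<not> coprime n q \<Longrightarrow> chi n = 0"
  unfolding dirichlet_character_def by blast

lemma dirichlet_character_power_totient:
  assumes "dirichlet_character q chi" "coprime n q"
  shows "chi n ^ totient q = 1"
proof -
  have "chi n \<noteq> 0" using assms by (simp add: dirichlet_character_def)
  then show ?thesis using dirichlet_character_values[OF assms(1), of n] by auto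
qed

lemma norm_dirichlet_character_eq:
  assumes "dirichlet_character q chi" "coprime n q"
  shows "norm (chi n) = 1"
proof -
  have "norm (chi n) ^ totient q = 1 ^ totient q"
    using dirichlet_character_power_totient[OF assms] by (simp flip: norm_power)
  moreover have "totient q > 0" using assms by (simp add: dirichlet_character_def)
  ultimately show ?thesis by (intro power_eq_imp_eq_base[of "norm (chi n)" "totient q" 1]) auto
qed

lemma norm_dirichlet_character_le:
  assumes "dirichlet_character q chi"
  shows "norm (chi n) \<le> 1"
  using norm_dirichlet_character_eq[OF assms, of n] assms
  by (cases "coprime n q") (auto simp: dirichlet_character_def)

lemma twist_cis: "p > 0 \<Longrightarrow> complex_of_nat p powr (\<i> * of_real t) = cis (t * ln (real p))"
  using Ln_of_real[of "real p"] by (simp add: powr_def cis_conv_exp mult_ac)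

lemma twisted_prime_sum_eq:
  "twisted_prime_sum f chi t X =
     (\<Sum>p | prime p \<and> real p \<le> X. 1 / real p * (1 - Re (f p * chi p * cis (t * ln (real p)))))"
  unfolding twisted_prime_sum_def by (rule sum.cong) (auto simp: twist_cis prime_gt_0_nat)

text \<open>Multiplication by a permutes the residues mod q, so the sum equals chi(a)^2 times
  itself.\<close>

lemma mean_zero_of_nonprincipal:
  assumes chi: "dirichlet_character q chi" and a: "coprime a q" "chi a ^ 2 \<noteq> 1"
  shows "(\<Sum>n<q. (chi n)\<^sup>2) = 0"
proof -
  have q: "q \<ge> 1" using chi by (simp add: dirichlet_character_def)
  have "(\<Sum>n<q. (chi ((a * n) mod q))\<^sup>2) = (\<Sum>n<q. (chi n)\<^sup>2)"
  proof (rule sum.reindex_bij_betw)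
    have inj: "inj_on (\<lambda>n. a * n mod q) {..<q}"
    proof (rule inj_onI)
      fix x y assume xy: "x \<in> {..<q}" "y \<in> {..<q}" "a * x mod q = a * y mod q"
      then have "[x = y] (mod q)" using a(1) by (simp add: cong_def[symmetric] cong_mult_lcancel_nat)
      then show "x = y" using xy by (simp add: cong_def)
    qed
    have "(\<lambda>n. a * n mod q) ` {..<q} \<subseteq> {..<q}" using q by auto
    then have "(\<lambda>n. a * n mod q) ` {..<q} = {..<q}" using inj by (simp add: endo_inj_surj)
    with inj show "bij_betw (\<lambda>n. a * n mod q) {..<q} {..<q}" by (simp add: bij_betw_def)
  qed
  moreover have "chi ((a * n) mod q) = chi a * chi n" for n
    using dirichlet_character_mod[OF chi, of "a * n"] chi by (simp add: dirichlet_character_def)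
  ultimately have "(chi a)\<^sup>2 * (\<Sum>n<q. (chi n)\<^sup>2) = (\<Sum>n<q. (chi n)\<^sup>2)"
    by (simp add: power_mult_distrib sum_distrib_left)
  then show ?thesis using a(2) by simp
qed

lemma periodic_mean_zero_partial_sum:
  fixes \<psi> :: "nat \<Rightarrow> complex"
  assumes q: "q > 0" and per: "\<And>n. \<psi> (n + q) = \<psi> n" and z: "(\<Sum>n<q. \<psi> n) = 0" and b: "\<And>n. norm (\<psi> n) \<le> 1"
  shows "norm (\<Sum>n<N. \<psi> n) \<le> real q"
proof (induction N rule: less_induct)
  case (less N)
  show ?case
  proof (cases "N < q")
    case True
    have "norm (\<Sum>n<N. \<psi> n) \<le> (\<Sum>n<N. 1)" by (rule sum_norm_le) (use b in auto)
    then show ?thesis using True by simp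
  next
    case False
    have "(\<Sum>n<(N - q) + q. \<psi> n) = (\<Sum>n<q. \<psi> n) + (\<Sum>n\<in>{0+q..<(N-q)+q}. \<psi> n)"
      by (subst sum.union_disjoint[symmetric]) (auto intro!: sum.cong)
    also have "(\<Sum>n\<in>{0+q..<(N-q)+q}. \<psi> n) = (\<Sum>n<N - q. \<psi> n)"
      by (subst sum.shift_bounds_nat_ivl) (simp add: per lessThan_atLeast0)
    finally have "(\<Sum>n<N. \<psi> n) = (\<Sum>n<N - q. \<psi> n)" using z False by simp
    then show ?thesis using less[of "N - q"] q False by simp
  qed
qed

text \<open>If \<open>chi\<^sup>2\<close> were non-principal, its \<open>L\<close>-series would stay bounded near \<open>s = 1\<close>.\<close>

lemma square_principal_of_pretentious:
  assumes chi: "dirichlet_character q chi" and f: "\<And>p. prime p \<Longrightarrow> x p \<in> {-1..1}"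
    and C: "\<And>X. X \<ge> 3 \<Longrightarrow> (\<Sum>p | prime p \<and> real p \<le> X. 1 / real p * (1 - x p * Re (chi p))) \<le> C"
    and a: "coprime a q"
  shows "chi a ^ 2 = 1"
proof (rule ccontr)
  let ?T = "\<lambda>X. \<Sum>p | prime p \<and> real p \<le> X. 1 / real p * (1 - x p * Re (chi p))"
  assume neq: "chi a ^ 2 \<noteq> 1"
  have q: "q > 0" using chi by (simp add: dirichlet_character_def)
  define g where "g n = (chi n)\<^sup>2" for n
  have n1: "norm (g n) \<le> 1" for n using norm_dirichlet_character_le[OF chi, of n] by (simp add: g_def norm_power power_le_one)
  have g: "completely_multiplicative g"
    using chi dirichlet_character_one[OF chi] n1
    by (auto simp: completely_multiplicative_def g_def dirichlet_character_def power_mult_distrib)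
  have partial: "norm (\<Sum>n<N. g n) \<le> real q" for N
    by (rule periodic_mean_zero_partial_sum[OF q _ _ n1])
      (use chi mean_zero_of_nonprincipal[OF chi a neq] in \<open>auto simp: g_def dirichlet_character_def\<close>)
  have bounded: "norm (suminf (dirichlet_term g \<sigma>)) \<le> 2 * real q" if \<sigma>: "\<sigma> > 1" for \<sigma>
  proof (rule tendsto_upperbound)
    have "summable (dirichlet_term g \<sigma>)"
      by (rule summable_comparison_test'[OF summable_nat_powr[OF \<sigma>], of 0]) (use norm_dirichlet_term_le[OF g] in auto)
    then show "(\<lambda>N. norm (\<Sum>n<Suc N. dirichlet_term g \<sigma> n)) \<longlonglongrightarrow> norm (suminf (dirichlet_term g \<sigma>))"
      by (intro tendsto_norm LIMSEQ_Suc summable_LIMSEQ)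
    show "\<forall>\<^sub>F N in sequentially. norm (\<Sum>n<Suc N. dirichlet_term g \<sigma> n) \<le> 2 * real q"
    proof (intro always_eventually allI)
      fix N
      have "(\<Sum>n<Suc N. dirichlet_term g \<sigma> n) = (\<Sum>n\<in>{1..<1+N}. g n * of_real (real n powr - \<sigma>))"
        unfolding dirichlet_term_def[symmetric] by (rule sum.mono_neutral_right) (auto simp: not_le)
      also have "norm \<dots> \<le> 2 * real q * real 1 powr - \<sigma>"
      proof (rule norm_sum_decreasing_weights_le)
        fix m
        \<comment> \<open>\<open>partial\<close> starts at 0 but the series at 1; removing the term
          at 0 doubles the bound.\<close>
        have "(\<Sum>n\<in>{1..<1+m}. g n) = (\<Sum>n<Suc m. g n) - (\<Sum>n<1. g n)"
          by (simp add: lessThan_atLeast0 sum.atLeast_Suc_lessThan del: sum.lessThan_Suc)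
        then have "norm (\<Sum>n\<in>{1..<1+m}. g n) \<le> norm (\<Sum>n<Suc m. g n) + norm (\<Sum>n<1. g n)"
          by (simp only: norm_triangle_ineq4)
        then show "norm (\<Sum>n\<in>{1..<1+m}. g n) \<le> 2 * real q"
          using partial[of "Suc m"] partial[of 1] by linarith
      qed (use \<sigma> in \<open>auto intro!: powr_mono2'\<close>)
      finally show "norm (\<Sum>n<Suc N. dirichlet_term g \<sigma> n) \<le> 2 * real q" by simp
    qed
  qed simp
  \<comment> \<open>Squaring costs the factor 4 of \<open>one_minus_Re_power_le\<close>; every prime
    p \<le> q gets an extra 1, which covers those dividing q.\<close>
  define D where "D = 4 * C + (\<Sum>p | prime p \<and> p \<le> q. 1)"
  define c where "c = exp (- 4 * (D + 12))"
  have "c * ln X \<le> 2 * real q" if X: "X \<ge> 3" for X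
  proof -
    have "(\<Sum>p | prime p \<and> real p \<le> X. 1 / real p * (1 - Re (g p)))
        \<le> (\<Sum>p | prime p \<and> real p \<le> X. 4 * (1 / real p * (1 - x p * Re (chi p))) + (if p \<le> q then 1 else 0))"
    proof (rule sum_mono)
      fix p assume "p \<in> {p. prime p \<and> real p \<le> X}"
      then have p: "prime p" "real p \<ge> 1" using prime_ge_1_nat[of p] by auto
      show "1 / real p * (1 - Re (g p)) \<le> 4 * (1 / real p * (1 - x p * Re (chi p))) + (if p \<le> q then 1 else 0)"
      proof (cases "coprime p q")
        case True
        have "1 - Re (chi p ^ (2 * 1)) \<le> 4 * real 1 ^ 2 * (1 - x p * Re (chi p))"
          by (rule one_minus_Re_power_le) (use norm_dirichlet_character_eq[OF chi True] f[OF p(1)] in auto)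
        then have "1 / real p * (1 - Re (g p)) \<le> 1 / real p * (4 * (1 - x p * Re (chi p)))"
          using p by (intro mult_left_mono) (auto simp: g_def)
        then show ?thesis by simp
      next
        case False
        then have "p dvd q" using p prime_imp_coprime by blast
        then have "p \<le> q" using q dvd_imp_le by blast
        moreover have "chi p = 0" using chi False by (rule dirichlet_character_eq_0)
        moreover have "1 / real p \<le> 4 / real p" by (rule divide_right_mono) auto
        ultimately show ?thesis using p by (simp add: g_def)
      qed
    qed
    also have "\<dots> = 4 * ?T X
        + (\<Sum>p | prime p \<and> real p \<le> X. if p \<le> q then 1 else 0)" by (simp only: sum.distrib sum_distrib_left)
    also have "(\<Sum>p | prime p \<and> real p \<le> X. if p \<le> q then 1 else 0 :: real) \<le> (\<Sum>p | prime p \<and> p \<le> q. 1)"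
    proof -
      have "(\<Sum>p | prime p \<and> real p \<le> X. if p \<le> q then 1 else 0 :: real) = (\<Sum>p\<in>{p. prime p \<and> real p \<le> X} \<inter> {p. p \<le> q}. 1)"
        by (rule sum.mono_neutral_cong_right) (use finite_primes_le in auto)
      also have "\<dots> \<le> (\<Sum>p | prime p \<and> p \<le> q. 1)" by (rule sum_mono2) auto
      finally show ?thesis .
    qed
    also have "?T X \<le> C" by (rule C[OF X])
    finally have "(\<Sum>p | prime p \<and> real p \<le> X. 1 / real p * (1 - Re (g p))) \<le> D" by (simp add: D_def)
    from norm_dirichlet_series_ge_ln[OF g X this] have "c * ln X \<le> norm (suminf (dirichlet_term g (1 + 1 / ln X)))"
      by (simp add: c_def)
    also have "\<dots> \<le> 2 * real q" by (rule bounded) (use X in auto)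
    finally show ?thesis .
  qed
  note * = this
  have "c > 0" by (simp add: c_def)
  define X where "X = max 3 (exp ((2 * real q + 1) / c))"
  have "(2 * real q + 1) / c \<le> ln X" unfolding X_def by (subst ln_ge_iff) auto
  then have "2 * real q + 1 \<le> c * ln X" using \<open>c > 0\<close> by (simp add: field_simps)
  then show False using *[of X] by (simp add: X_def)
qed


text \<open>There are finitely many characters of modulus at most Q, so by pigeonhole a single one
  occurs for arbitrarily large X. The twist t still depends on X.\<close>

lemma not_strongly_aperiodic_witness:
  assumes bounded: "\<And>n. n > 0 \<Longrightarrow> norm (f n) \<le> 1" and nsa: "\<not> strongly_aperiodic f"
  shows "\<exists>q chi M. dirichlet_character q chi \<and>
    (\<forall>X0. \<exists>X\<ge>X0. \<exists>t. \<bar>t\<bar> \<le> X \<and> twisted_prime_sum f chi t X \<le> M)"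
proof -
  obtain Q where Q: "Q \<ge> 1" and nl: "\<not> filterlim
        (\<lambda>X. INF t\<in>{-X..X}. Min {twisted_prime_sum f chi t X | chi q. q \<le> Q \<and> dirichlet_character q chi})
        at_top at_top"
    using nsa unfolding strongly_aperiodic_def by auto
  let ?A = "\<lambda>t X. {twisted_prime_sum f chi t X | chi q. q \<le> Q \<and> dirichlet_character q chi}"
  obtain M where "\<not> eventually (\<lambda>X. M \<le> (INF t\<in>{-X..X}. Min (?A t X))) at_top"
    using nl unfolding filterlim_at_top by blast
  then have fr: "\<exists>X\<ge>X0. (INF t\<in>{-X..X}. Min (?A t X)) < M" for X0
    unfolding eventually_at_top_linorder by (meson not_le)
  let ?S = "{chi. \<exists>q\<le>Q. dirichlet_character q chi}"
  have "?S = (\<Union>q\<le>Q. {chi. dirichlet_character q chi})" by auto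
  then have finS: "finite ?S" using finite_dirichlet_characters by simp
  have ex: "\<exists>chi\<in>?S. \<exists>X\<ge>real n. \<exists>t. \<bar>t\<bar> \<le> X \<and> twisted_prime_sum f chi t X \<le> M" for n :: nat
  proof -
    obtain X where X: "X \<ge> real n" "(INF t\<in>{-X..X}. Min (?A t X)) < M" using fr by blast
    have "\<exists>y\<in>(\<lambda>t. Min (?A t X)) ` {-X..X}. y < M"
      by (rule cInf_lessD) (use X in auto)
    then obtain t where t: "t \<in> {-X..X}" "Min (?A t X) < M" by auto
    have "Min (?A t X) \<in> ?A t X" by (rule Min_in) (use strongly_aperiodic_min_set[OF Q] in auto)
    then obtain chi q where "q \<le> Q" "dirichlet_character q chi" "twisted_prime_sum f chi t X = Min (?A t X)" by auto
    then show ?thesis using t X by (intro bexI[of _ chi] exI[of _ X] conjI exI[of _ t]) auto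
  qed
  then obtain F where F: "\<And>n. F n \<in> ?S" "\<And>n. \<exists>X\<ge>real n. \<exists>t. \<bar>t\<bar> \<le> X \<and> twisted_prime_sum f (F n) t X \<le> M" by metis
  have "\<exists>chi\<in>?S. infinite {n. F n = chi}"
  proof (rule ccontr)
    assume "\<not> ?thesis"
    then have "finite (\<Union>chi\<in>?S. {n. F n = chi})" using finS by auto
    moreover have "(\<Union>chi\<in>?S. {n. F n = chi}) = UNIV" using F(1) by auto
    ultimately show False by simp
  qed
  then obtain chi where chi: "chi \<in> ?S" "infinite {n. F n = chi}" by blast
  have "\<exists>X\<ge>X0. \<exists>t. \<bar>t\<bar> \<le> X \<and> twisted_prime_sum f chi t X \<le> M" for X0
  proof -
    obtain n where "n \<ge> nat \<lceil>X0\<rceil>" "F n = chi" using chi(2) unfolding infinite_nat_iff_unbounded_le by blast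
    moreover from this have "real n \<ge> X0" by linarith
    ultimately show ?thesis using F(2)[of n] by (metis order.trans)
  qed
  then show ?thesis using chi(1) by blast
qed

text \<open>Raising \<open>chi p * p\<^sup>i\<^sup>t\<close> to the power \<open>2 * totient q\<close> removes the character, leaving only the twist.\<close>

lemma real_not_strongly_aperiodic_pretentious:
  assumes x: "\<And>p. p > 0 \<Longrightarrow> x p \<in> {-1..1::real}"
    and f: "\<And>p. p > 0 \<Longrightarrow> f p = of_real (x p)" and nsa: "\<not> strongly_aperiodic f"
  shows "\<exists>q chi C. dirichlet_character q chi \<and> (\<forall>n. coprime n q \<longrightarrow> chi n ^ 2 = 1) \<and>
     (\<forall>X. (\<Sum>p | prime p \<and> real p \<le> X. 1 / real p * (1 - x p * Re (chi p))) \<le> C)"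
proof -
  have "norm (f n) \<le> 1" if "n > 0" for n using f[OF that] x[OF that] by auto
  from not_strongly_aperiodic_witness[OF this nsa] obtain q chi M where chi: "dirichlet_character q chi"
    and M: "\<And>X0. \<exists>X\<ge>X0. \<exists>t. \<bar>t\<bar> \<le> X \<and> twisted_prime_sum f chi t X \<le> M" by auto
  let ?T = "\<lambda>X. \<Sum>p | prime p \<and> real p \<le> X. 1 / real p * (1 - x p * Re (chi p))"
  have q: "q > 0" using chi by (simp add: dirichlet_character_def)
  define k where "k = totient q"
  have k: "k > 0" using q by (simp add: k_def)
  \<comment> \<open>The last sum charges 2 to every prime p \<le> q, which covers those dividing q,
    where chi vanishes.\<close>
  define C1 where "C1 = 4 * real k ^ 2 * M + (\<Sum>p | prime p \<and> p \<le> q. 2)"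
  obtain K X1 where X1: "X1 \<ge> 3" and K: "K \<ge> 0" and small: "\<And>X \<tau>. X \<ge> X1 \<Longrightarrow> \<bar>\<tau>\<bar> \<le> 2 * real k * X \<Longrightarrow>
     (\<Sum>p | prime p \<and> real p \<le> X. 1 / real p * (1 - cos (\<tau> * ln (real p)))) \<le> C1 \<Longrightarrow> \<bar>\<tau>\<bar> \<le> K / ln X"
    using pretentious_twist_small[of "2 * real k" C1] k by auto
  \<comment> \<open>Removing p^(it) costs at most \<bar>t\<bar> times the sum of ln p / p, that is,
    K / ln X * (18 * ln X).\<close>
  define C where "C = M + 18 * K"
  have Re1: "x p * Re (chi p) \<le> 1" if "p > 0" for p
  proof -
    have "\<bar>x p * Re (chi p)\<bar> \<le> 1 * 1" unfolding abs_mult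
      using x[OF that] abs_Re_le_cmod[of "chi p"] norm_dirichlet_character_le[OF chi, of p] by (intro mult_mono) auto
    then show ?thesis by simp
  qed
  have large: "\<exists>X\<ge>X0. ?T X \<le> C" for X0
  proof -
    obtain X t where X: "X \<ge> max X0 X1" and t: "\<bar>t\<bar> \<le> X" and TM: "twisted_prime_sum f chi t X \<le> M" using M by blast
    have X3: "X \<ge> 3" "X \<ge> X1" "X \<ge> X0" using X X1 by auto
    have L: "ln X > 0" using X3 by simp
    let ?P = "{p. prime p \<and> real p \<le> X}"
    define w where "w p = chi p * cis (t * ln (real p))" for p
    have T: "(\<Sum>p\<in>?P. 1 / real p * (1 - x p * Re (w p))) \<le> M"
    proof -
      have "(\<Sum>p\<in>?P. 1 / real p * (1 - x p * Re (w p))) = twisted_prime_sum f chi t X"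
        unfolding twisted_prime_sum_eq by (rule sum.cong) (auto simp: f prime_gt_0_nat w_def mult.assoc)
      then show ?thesis using TM by simp
    qed
    define \<tau> where "\<tau> = 2 * real k * t"
    have "\<bar>\<tau>\<bar> \<le> K / ln X"
    proof (rule small)
      show "\<bar>\<tau>\<bar> \<le> 2 * real k * X" using t by (simp add: \<tau>_def abs_mult mult_left_mono)
      have "(\<Sum>p\<in>?P. 1 / real p * (1 - cos (\<tau> * ln (real p))))
         \<le> (\<Sum>p\<in>?P. 4 * real k ^ 2 * (1 / real p * (1 - x p * Re (w p))) + (if p \<le> q then 2 else 0))"
      proof (rule sum_mono)
        fix p assume "p \<in> ?P"
        then have p: "prime p" "real p \<ge> 1" "p > 0" using prime_ge_1_nat[of p] by auto
        show "1 / real p * (1 - cos (\<tau> * ln (real p))) \<le> 4 * real k ^ 2 * (1 / real p * (1 - x p * Re (w p))) + (if p \<le> q then 2 else 0)"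
        proof (cases "coprime p q")
          case True
          have "w p ^ (2 * k) = (chi p ^ totient q)\<^sup>2 * cis (t * ln (real p)) ^ (2 * k)"
            by (simp add: w_def power_mult_distrib k_def mult.commute flip: power_mult)
          also have "\<dots> = cis (\<tau> * ln (real p))"
            using dirichlet_character_power_totient[OF chi True] by (simp add: Complex.DeMoivre \<tau>_def mult_ac)
          finally have "Re (w p ^ (2 * k)) = cos (\<tau> * ln (real p))" by simp
          moreover have "1 - Re (w p ^ (2 * k)) \<le> 4 * real k ^ 2 * (1 - x p * Re (w p))"
            by (rule one_minus_Re_power_le) (use norm_dirichlet_character_eq[OF chi True] x[OF p(3)] in \<open>auto simp: w_def norm_mult\<close>)
          ultimately have "1 / real p * (1 - cos (\<tau> * ln (real p))) \<le> 1 / real p * (4 * real k ^ 2 * (1 - x p * Re (w p)))"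
            using p by (intro mult_left_mono) auto
          also have "\<dots> = 4 * real k ^ 2 * (1 / real p * (1 - x p * Re (w p)))" by simp
          finally show ?thesis by simp
        next
          case False
          then have "p dvd q" using p prime_imp_coprime by blast
          then have pq: "p \<le> q" using q dvd_imp_le by blast
          have "chi p = 0" using chi False by (rule dirichlet_character_eq_0)
          then have "4 * real k ^ 2 * (1 / real p * (1 - x p * Re (w p))) \<ge> 0" by (simp add: w_def)
          moreover have "1 / real p * (1 - cos (\<tau> * ln (real p))) \<le> 1 * 2"
          proof (rule mult_mono)
            show "1 - cos (\<tau> * ln (real p)) \<le> 2" using cos_ge_minus_one[of "\<tau> * ln (real p)"] by linarith
          qed (use p in auto)
          ultimately show ?thesis using pq by simp
        qed
      qed
      also have "\<dots> = 4 * real k ^ 2 * (\<Sum>p\<in>?P. 1 / real p * (1 - x p * Re (w p))) + (\<Sum>p\<in>?P. if p \<le> q then 2 else 0)"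
        by (simp only: sum.distrib sum_distrib_left)
      also have "\<dots> \<le> 4 * real k ^ 2 * M + (\<Sum>p | prime p \<and> p \<le> q. 2)"
      proof (rule add_mono)
        show "4 * real k ^ 2 * (\<Sum>p\<in>?P. 1 / real p * (1 - x p * Re (w p))) \<le> 4 * real k ^ 2 * M"
          using T by (intro mult_left_mono) auto
        have "(\<Sum>p\<in>?P. if p \<le> q then 2 else 0 :: real) = (\<Sum>p\<in>?P \<inter> {p. p \<le> q}. 2)"
          by (rule sum.mono_neutral_cong_right) (use finite_primes_le in auto)
        also have "\<dots> \<le> (\<Sum>p | prime p \<and> p \<le> q. 2)" by (rule sum_mono2) auto
        finally show "(\<Sum>p\<in>?P. if p \<le> q then 2 else 0 :: real) \<le> (\<Sum>p | prime p \<and> p \<le> q. 2)" .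
      qed
      finally show "(\<Sum>p\<in>?P. 1 / real p * (1 - cos (\<tau> * ln (real p)))) \<le> C1" by (simp add: C1_def)
    qed (use X3 in auto)
    moreover have "\<bar>t\<bar> \<le> \<bar>\<tau>\<bar>" using k by (simp add: \<tau>_def abs_mult mult_le_cancel_right1)
    ultimately have tK: "\<bar>t\<bar> \<le> K / ln X" by linarith
    have "(\<Sum>p\<in>?P. 1 / real p * (1 - x p * Re (chi p)))
        \<le> (\<Sum>p\<in>?P. 1 / real p * (1 - x p * Re (w p)) + \<bar>t\<bar> * (ln (real p) / real p))"
    proof (rule sum_mono)
      fix p assume "p \<in> ?P"
      then have p: "prime p" "real p \<ge> 1" "p > 0" using prime_ge_1_nat[of p] by auto
      have "\<bar>x p * (Re (w p) - Re (chi p))\<bar> \<le> 1 * (1 * \<bar>t * ln (real p)\<bar>)"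
      proof -
        have "\<bar>Re (w p) - Re (chi p)\<bar> \<le> norm (w p - chi p)" using abs_Re_le_cmod[of "w p - chi p"] by simp
        also have "w p - chi p = chi p * (cis (t * ln (real p)) - cis 0)" by (simp add: w_def algebra_simps)
        also have "norm \<dots> \<le> 1 * \<bar>t * ln (real p)\<bar>" unfolding norm_mult
          using norm_cis_diff_le[of "t * ln (real p)" 0] norm_dirichlet_character_le[OF chi] by (intro mult_mono) auto
        finally show ?thesis unfolding abs_mult using x[OF p(3)] by (intro mult_mono) (auto simp: abs_mult)
      qed
      then have "1 - x p * Re (chi p) \<le> (1 - x p * Re (w p)) + \<bar>t\<bar> * ln (real p)"
        using p by (simp add: abs_mult algebra_simps)
      then have "1 / real p * (1 - x p * Re (chi p)) \<le> 1 / real p * ((1 - x p * Re (w p)) + \<bar>t\<bar> * ln (real p))"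
        using p by (intro mult_left_mono) auto
      then show "1 / real p * (1 - x p * Re (chi p)) \<le> 1 / real p * (1 - x p * Re (w p)) + \<bar>t\<bar> * (ln (real p) / real p)"
        by (simp add: distrib_left add_divide_distrib)
    qed
    also have "\<dots> = (\<Sum>p\<in>?P. 1 / real p * (1 - x p * Re (w p))) + \<bar>t\<bar> * (\<Sum>p\<in>?P. ln (real p) / real p)"
      by (simp only: sum.distrib sum_distrib_left)
    also have "\<dots> \<le> M + K / ln X * (18 * ln X)"
      using T tK sum_ln_prime_div_le[OF X3(1)] L K
      by (intro add_mono mult_mono) (auto intro!: sum_nonneg dest: prime_ge_1_nat)
    also have "\<dots> = C" using L by (simp add: C_def)
    finally show ?thesis using X3(3) by (intro exI[of _ X] conjI)
  qed
  \<comment> \<open>The summands are nonnegative, so a bound along arbitrarily large X holds for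
    every X.\<close>
  have bound: "?T X \<le> C" for X
  proof -
    obtain Y where Y: "Y \<ge> X" "?T Y \<le> C" using large by blast
    have "?T X \<le> ?T Y"
      by (rule sum_mono2[OF finite_primes_le]) (use Y Re1 prime_gt_0_nat in auto)
    then show ?thesis using Y by linarith
  qed
  have "chi n ^ 2 = 1" if "coprime n q" for n
    by (rule square_principal_of_pretentious[OF chi _ _ that, of x C]) (use x prime_gt_0_nat bound in auto)
  then show ?thesis using chi bound by blast
qed

section \<open>Rationally almost periodic functions\<close>

text \<open>Almost periodicity in the sense of Besicovitch with rational frequencies: approximation
  by periodic functions in mean absolute value over positive n. The bounds by 1 give closure under
  products, and the domain \<open>int\<close> accommodates negative shifts.\<close>

definition rationally_almost_periodic :: "(int \<Rightarrow> complex) \<Rightarrow> bool" where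
  "rationally_almost_periodic h \<longleftrightarrow> (\<forall>n. norm (h n) \<le> 1) \<and>
     (\<forall>\<epsilon>>0. \<exists>P q. q > 0 \<and> (\<forall>n. P (n + int q) = P n) \<and> (\<forall>n. norm (P n) \<le> 1) \<and>
        (\<forall>\<^sub>F N in sequentially. (\<Sum>n=1..N. norm (h (int n) - P (int n))) \<le> \<epsilon> * real N))"

lemma rationally_almost_periodicE:
  assumes "rationally_almost_periodic h" "\<epsilon> > 0"
  obtains P q where "q > 0" "\<And>n. P (n + int q) = P n" "\<And>n. norm (P n) \<le> 1"
    "\<forall>\<^sub>F N in sequentially. (\<Sum>n=1..N. norm (h (int n) - P (int n))) \<le> \<epsilon> * real N"
  using assms unfolding rationally_almost_periodic_def by meson

lemma periodic_add_mult:
  assumes "\<And>n. P (n + int q) = P n"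
  shows "P (n + int (k * q)) = P n"
proof (induction k)
  case (Suc k)
  have "P (n + int (Suc k * q)) = P (n + int (k * q) + int q)" by (simp add: algebra_simps)
  then show ?case using assms Suc by simp
qed simp

lemma rationally_almost_periodic_const: "norm c \<le> 1 \<Longrightarrow> rationally_almost_periodic (\<lambda>_. c)"
  unfolding rationally_almost_periodic_def
  by (intro conjI allI impI exI[of _ "\<lambda>_. c"] exI[of _ 1]) auto

text \<open>A unit shift changes the sum of errors only at the two ends, raising it by at most 2,
  which \<epsilon> / 2 * N absorbs once N \<ge> 4 / \<epsilon>. Other shifts follow by
  iteration.\<close>

lemma rationally_almost_periodic_shift_unit:
  assumes h: "rationally_almost_periodic h" and d: "d \<in> {1, -1}"
  shows "rationally_almost_periodic (\<lambda>n. h (n + d))"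
  unfolding rationally_almost_periodic_def
proof (intro conjI allI impI)
  show "norm (h (n + d)) \<le> 1" for n using h by (simp add: rationally_almost_periodic_def)
  fix \<epsilon> :: real assume \<epsilon>: "\<epsilon> > 0"
  obtain P q where P: "q > 0" "\<And>n. P (n + int q) = P n" "\<And>n. norm (P n) \<le> 1"
    "\<forall>\<^sub>F N in sequentially. (\<Sum>n=1..N. norm (h (int n) - P (int n))) \<le> \<epsilon> / 2 * real N"
    by (rule rationally_almost_periodicE[OF h half_gt_zero[OF \<epsilon>]]) (rule that; assumption)
  define F where "F n = norm (h n - P n)" for n
  have F2: "F n \<le> 2" for n
    using norm_triangle_ineq4[of "h n" "P n"] P(3)[of n] h unfolding rationally_almost_periodic_def F_def
    by (smt (verit))
  have F0: "F n \<ge> 0" for n by (simp add: F_def)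
  have "(\<Sum>n=1..N. F (int n + 1)) = (\<Sum>n=1..N. F (int n)) + F (int N + 1) - F 1" for N
    by (induction N) (auto simp: add_ac)
  moreover have "(\<Sum>n=1..N. F (int n - 1)) = (\<Sum>n=1..N. F (int n)) + F 0 - F (int N)" for N
    by (induction N) auto
  ultimately have shift: "(\<Sum>n=1..N. F (int n + d)) \<le> (\<Sum>n=1..N. F (int n)) + 2" for N
    using d F2[of "int N + 1"] F2[of 0] F0[of 1] F0[of "int N"] by auto
  have "\<forall>\<^sub>F N in sequentially. (\<Sum>n=1..N. norm (h (int n + d) - P (int n + d))) \<le> \<epsilon> * real N"
    using P(4) eventually_ge_at_top[of "nat \<lceil>4 / \<epsilon>\<rceil>"]
  proof eventually_elim
    case (elim N)
    have "real N \<ge> 4 / \<epsilon>" using elim(2) by linarith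
    then have "\<epsilon> / 2 * real N \<ge> 2" using \<epsilon> by (simp add: field_simps)
    then show ?case using shift[of N] elim(1) by (simp add: F_def algebra_simps)
  qed
  then show "\<exists>P q. q > 0 \<and> (\<forall>n. P (n + int q) = P n) \<and> (\<forall>n. norm (P n) \<le> 1) \<and>
        (\<forall>\<^sub>F N in sequentially. (\<Sum>n=1..N. norm (h (int n + d) - P (int n))) \<le> \<epsilon> * real N)"
    using P(1,3) P(2)[of "_ + d"] by (intro exI[of _ "\<lambda>n. P (n + d)"] exI[of _ q]) (auto simp: add_ac)
qed

lemma rationally_almost_periodic_shift:
  assumes h: "rationally_almost_periodic h"
  shows "rationally_almost_periodic (\<lambda>n. h (n + b))"
proof (induction b rule: int_induct[where k = 0])
  case (step1 i)
  show ?case using rationally_almost_periodic_shift_unit[OF step1(2), of 1] by (simp add: add_ac)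
next
  case (step2 i)
  show ?case using rationally_almost_periodic_shift_unit[OF step2(2), of "-1"] by (simp add: algebra_simps)
qed (use h in simp)

lemma rationally_almost_periodic_mult:
  assumes h: "rationally_almost_periodic h" and k: "rationally_almost_periodic k"
  shows "rationally_almost_periodic (\<lambda>n. h n * k n)"
  unfolding rationally_almost_periodic_def
proof (intro conjI allI impI)
  have h1: "norm (h n) \<le> 1" and k1: "norm (k n) \<le> 1" for n
    using h k by (simp_all add: rationally_almost_periodic_def)
  show "norm (h n * k n) \<le> 1" for n unfolding norm_mult using h1 k1 by (simp add: mult_le_one)
  fix \<epsilon> :: real assume \<epsilon>: "\<epsilon> > 0"
  obtain P q where P: "q > 0" "\<And>n. P (n + int q) = P n" "\<And>n. norm (P n) \<le> 1"
    "\<forall>\<^sub>F N in sequentially. (\<Sum>n=1..N. norm (h (int n) - P (int n))) \<le> \<epsilon> / 2 * real N"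
    by (rule rationally_almost_periodicE[OF h half_gt_zero[OF \<epsilon>]]) (rule that; assumption)
  obtain R r where R: "r > 0" "\<And>n. R (n + int r) = R n" "\<And>n. norm (R n) \<le> 1"
    "\<forall>\<^sub>F N in sequentially. (\<Sum>n=1..N. norm (k (int n) - R (int n))) \<le> \<epsilon> / 2 * real N"
    by (rule rationally_almost_periodicE[OF k half_gt_zero[OF \<epsilon>]]) (rule that; assumption)
  have diff: "norm (h n * k n - P n * R n) \<le> norm (h n - P n) + norm (k n - R n)" for n
  proof -
    have "h n * k n - P n * R n = (h n - P n) * k n + P n * (k n - R n)" by (simp add: algebra_simps)
    also have "norm \<dots> \<le> norm ((h n - P n) * k n) + norm (P n * (k n - R n))" by (rule norm_triangle_ineq)
    also have "\<dots> \<le> norm (h n - P n) + norm (k n - R n)"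
      unfolding norm_mult using k1 P(3) by (intro add_mono mult_right_le_one_le mult_left_le_one_le) auto
    finally show ?thesis .
  qed
  show "\<exists>P q. q > 0 \<and> (\<forall>n. P (n + int q) = P n) \<and> (\<forall>n. norm (P n) \<le> 1) \<and>
        (\<forall>\<^sub>F N in sequentially. (\<Sum>n=1..N. norm (h (int n) * k (int n) - P (int n))) \<le> \<epsilon> * real N)"
  proof (intro exI[of _ "\<lambda>n. P n * R n"] exI[of _ "q * r"] conjI allI)
    show "P (n + int (q * r)) * R (n + int (q * r)) = P n * R n" for n
      using periodic_add_mult[of P q n r, OF P(2)] periodic_add_mult[of R r n q, OF R(2)] by (simp add: mult.commute)
    show "norm (P n * R n) \<le> 1" for n unfolding norm_mult using P(3) R(3) by (simp add: mult_le_one)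
    show "\<forall>\<^sub>F N in sequentially. (\<Sum>n=1..N. norm (h (int n) * k (int n) - P (int n) * R (int n))) \<le> \<epsilon> * real N"
      using P(4) R(4)
    proof eventually_elim
      case (elim N)
      have "(\<Sum>n=1..N. norm (h (int n) * k (int n) - P (int n) * R (int n)))
          \<le> (\<Sum>n=1..N. norm (h (int n) - P (int n)) + norm (k (int n) - R (int n)))"
        by (rule sum_mono) (rule diff)
      then show ?case using elim by (simp add: sum.distrib)
    qed
  qed (use P R in auto)
qed

lemma rationally_almost_periodic_prod:
  assumes "finite B" "\<And>b. b \<in> B \<Longrightarrow> rationally_almost_periodic (h b)"
  shows "rationally_almost_periodic (\<lambda>n. \<Prod>b\<in>B. h b n)"
  using assms
  by (induction B rule: finite_induct) (auto intro: rationally_almost_periodic_const rationally_almost_periodic_mult)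

text \<open>The deviation of the partial sums from N times the mean over one period is itself
  periodic in N, hence bounded.\<close>

lemma periodic_mean_convergent:
  fixes P :: "int \<Rightarrow> complex"
  assumes q: "q > 0" and per: "\<And>n. P (n + int q) = P n"
  shows "convergent (\<lambda>N. (\<Sum>n=1..N. P (int n)) / of_nat N)"
proof -
  define T where "T N = (\<Sum>n=1..N. P (int n))" for N
  define D where "D N = T N - of_nat N * (T q / of_nat q)" for N
  have "P (1 + (int N + int q)) = P (1 + int N)" for N
    using per[of "1 + int N"] by (simp add: add.assoc)
  then have "T (N + q) = T N + T q" for N
    by (induction N) (auto simp: T_def algebra_simps)
  then have Dq: "D (N + q) = D N" for N using q by (simp add: D_def field_simps)
  define B where "B = (\<Sum>m<q. norm (D m))"
  have DB: "norm (D N) \<le> B" for N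
  proof (induction N rule: less_induct)
    case (less N)
    show ?case
    proof (cases "N < q")
      case True
      then show ?thesis unfolding B_def by (intro member_le_sum) auto
    next
      case False
      then show ?thesis using less[of "N - q"] q Dq[of "N - q"] by simp
    qed
  qed
  have "(\<lambda>N. D N / of_nat N) \<longlonglongrightarrow> 0"
  proof (rule Lim_null_comparison)
    show "\<forall>\<^sub>F N in sequentially. norm (D N / of_nat N) \<le> B / real N"
      using DB by (intro always_eventually allI) (simp add: norm_divide divide_right_mono)
    show "(\<lambda>N. B / real N) \<longlonglongrightarrow> 0" by (rule lim_const_over_n)
  qed
  then have "(\<lambda>N. D N / of_nat N + T q / of_nat q) \<longlonglongrightarrow> 0 + T q / of_nat q"
    by (intro tendsto_add tendsto_const)
  moreover have "\<forall>\<^sub>F N in sequentially. D N / of_nat N + T q / of_nat q = (\<Sum>n=1..N. P (int n)) / of_nat N"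
    using eventually_ge_at_top[of 1]
    by eventually_elim (use q in \<open>simp add: D_def T_def field_simps\<close>)
  ultimately have "(\<lambda>N. (\<Sum>n=1..N. P (int n)) / of_nat N) \<longlonglongrightarrow> 0 + T q / of_nat q"
    by (rule Lim_transform_eventually)
  then show ?thesis by (rule convergentI)
qed

lemma rationally_almost_periodic_mean:
  assumes h: "rationally_almost_periodic h"
  shows "convergent (\<lambda>N. (\<Sum>n=1..N. h (int n)) / of_nat N)"
proof (rule Cauchy_convergent, rule metric_CauchyI)
  fix e :: real assume e: "e > 0"
  then have e4: "e / 4 > 0" by simp
  obtain P q where P: "q > 0" "\<And>n. P (n + int q) = P n" "\<And>n. norm (P n) \<le> 1"
    "\<forall>\<^sub>F N in sequentially. (\<Sum>n=1..N. norm (h (int n) - P (int n))) \<le> e / 4 * real N"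
    by (rule rationally_almost_periodicE[OF h e4]) (rule that; assumption)
  let ?A = "\<lambda>h N. (\<Sum>n=1..N. h (int n)) / of_nat N :: complex"
  have "Cauchy (?A P)" using periodic_mean_convergent[of q P, OF P(1) P(2)] by (rule convergent_Cauchy)
  then obtain M0 where M0: "\<And>m n. m \<ge> M0 \<Longrightarrow> n \<ge> M0 \<Longrightarrow> dist (?A P m) (?A P n) < e / 2"
    using e metric_CauchyD[of "?A P" "e / 2"] by auto
  obtain N0 where N0: "\<And>N. N \<ge> N0 \<Longrightarrow> (\<Sum>n=1..N. norm (h (int n) - P (int n))) \<le> e / 4 * real N"
    using P(4) unfolding eventually_at_top_linorder by blast
  have close: "dist (?A h N) (?A P N) \<le> e / 4" if "N \<ge> N0" "N \<ge> 1" for N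
  proof -
    have "dist (?A h N) (?A P N) = norm (\<Sum>n=1..N. h (int n) - P (int n)) / real N"
      by (simp add: dist_norm sum_subtractf norm_divide flip: diff_divide_distrib)
    also have "\<dots> \<le> (e / 4 * real N) / real N"
      by (intro divide_right_mono order.trans[OF norm_sum N0] that) auto
    finally show ?thesis using that by simp
  qed
  show "\<exists>M. \<forall>m\<ge>M. \<forall>n\<ge>M. dist (?A h m) (?A h n) < e"
  proof (intro exI[of _ "max 1 (max M0 N0)"] allI impI)
    fix m n assume mn: "m \<ge> max 1 (max M0 N0)" "n \<ge> max 1 (max M0 N0)"
    have "dist (?A h m) (?A h n) \<le> dist (?A h m) (?A P m) + dist (?A P m) (?A P n) + dist (?A h n) (?A P n)"
      using dist_triangle[of "?A h m" "?A h n" "?A P m"] dist_triangle[of "?A P m" "?A h n" "?A P n"]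
        dist_commute[of "?A P n" "?A h n"] by linarith
    then show "dist (?A h m) (?A h n) < e" using close[of m] close[of n] M0[of m n] mn by simp
  qed
qed

section \<open>Periodic approximation of pretentious functions\<close>

lemma sum_indicator_multiples_le:
  assumes "m > 0"
  shows "(\<Sum>n=1..N. if m dvd n then 1 else 0 :: real) \<le> real N / real m"
proof -
  have "(\<Sum>n=1..N. if m dvd n then 1 else 0 :: real) = real (N div m)"
    using assms by (induction N) (auto simp: div_Suc dvd_eq_mod_eq_0)
  moreover have "real (N div m * m) \<le> real N" by (simp only: of_nat_le_iff div_times_less_eq_dividend)
  ultimately show ?thesis using assms by (simp add: field_simps)
qed

lemma multiplicative_prod_primes:
  fixes f :: "nat \<Rightarrow> complex"
  assumes f1: "f 1 = (1::complex)" and f: "\<And>m n. m > 0 \<Longrightarrow> n > 0 \<Longrightarrow> coprime m n \<Longrightarrow> f (m * n) = f m * f n"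
    and A: "finite A" "\<And>p. p \<in> A \<Longrightarrow> prime (p::nat)"
  shows "f (\<Prod>A) = (\<Prod>p\<in>A. f p)"
  using A
proof (induction A rule: finite_induct)
  case (insert p A)
  have "coprime p (\<Prod>A)"
    by (rule prod_coprime_right) (use insert in \<open>auto intro: primes_coprime\<close>)
  moreover have "\<Prod>A > 0" using insert by (intro prod_pos) (auto simp: prime_gt_0_nat)
  ultimately show ?case using insert f prime_gt_0_nat by simp
qed (use f1 in simp)

text \<open>Multiplicativity says nothing about values at prime powers, so only a squarefree e is
  treated prime by prime, through the telescoping bound for a difference of products. Any other e
  has a divisor p^2 with p > y; the trivial bound 2 is charged to the second sum, which is small on
  average.\<close>

lemma norm_multiplicative_diff_le:
  fixes f g :: "nat \<Rightarrow> complex" and e N y :: nat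
  assumes f1: "f 1 = (1::complex)" "g 1 = 1"
    and f: "\<And>m n. m > 0 \<Longrightarrow> n > 0 \<Longrightarrow> coprime m n \<Longrightarrow> f (m * n) = f m * f n"
    and g: "\<And>m n. m > 0 \<Longrightarrow> n > 0 \<Longrightarrow> coprime m n \<Longrightarrow> g (m * n) = g m * g n"
    and b: "\<And>n. n > 0 \<Longrightarrow> norm (f n) \<le> 1" "\<And>n. n > 0 \<Longrightarrow> norm (g n) \<le> 1"
    and e: "0 < e" "e \<le> N" and y: "\<And>p. prime p \<Longrightarrow> p dvd e \<Longrightarrow> y < p"
  shows "norm (f e - g e) \<le> (\<Sum>p | prime p \<and> y < p \<and> p \<le> N. if p dvd e then norm (f p - g p) else 0)
      + 2 * (\<Sum>j\<in>{y<..N}. if j\<^sup>2 dvd e then 1 else 0)"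
proof (cases "\<exists>p. prime p \<and> p\<^sup>2 dvd e")
  case True
  then obtain p where p: "prime p" "p\<^sup>2 dvd e" by blast
  then have "p dvd e" by (meson dvd_trans dvd_power zero_less_numeral)
  then have pN: "y < p" "p \<le> N" using y[OF p(1)] e dvd_imp_le[of p e] by auto
  have "norm (f e - g e) \<le> 2" using norm_triangle_ineq4[of "f e" "g e"] b[OF e(1)] by linarith
  also have "\<dots> = 2 * (\<Sum>j\<in>{p}. if j\<^sup>2 dvd e then 1 else 0)" using p by simp
  also have "\<dots> \<le> 2 * (\<Sum>j\<in>{y<..N}. if j\<^sup>2 dvd e then 1 else 0)"
    using pN by (intro mult_left_mono sum_mono2) auto
  finally show ?thesis by (simp add: sum_nonneg add_increasing)
next
  case False
  have e_eq: "e = \<Prod>(prime_factors e)"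
  proof -
    have "e = (\<Prod>p\<in>prime_factors e. p ^ multiplicity p e)" using e(1) by (rule prime_factorization_nat)
    also have "\<dots> = (\<Prod>p\<in>prime_factors e. p)"
    proof (rule prod.cong[OF refl])
      fix p assume p: "p \<in> prime_factors e"
      then have "multiplicity p e > 0" using prime_factors_multiplicity by auto
      moreover have "multiplicity p e < 2"
      proof (rule ccontr)
        assume "\<not> multiplicity p e < 2"
        then have "p\<^sup>2 dvd e" by (intro multiplicity_dvd') auto
        then show False using False p by auto
      qed
      ultimately show "p ^ multiplicity p e = p" by (simp add: numeral_2_eq_2 less_Suc_eq)
    qed
    finally show ?thesis by simp
  qed
  have pf: "prime p" "p > 0" "y < p" "p \<le> N" "p dvd e" if "p \<in> prime_factors e" for p
  proof -
    show "prime p" "p dvd e" using that by auto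
    then show "p > 0" "y < p" "p \<le> N" using y e dvd_imp_le[of p e] prime_gt_0_nat by auto
  qed
  have "f e = (\<Prod>p\<in>prime_factors e. f p)"
    by (subst e_eq, rule multiplicative_prod_primes[OF f1(1) f]) auto
  moreover have "g e = (\<Prod>p\<in>prime_factors e. g p)"
    by (subst e_eq, rule multiplicative_prod_primes[OF f1(2) g]) auto
  ultimately have "norm (f e - g e) \<le> (\<Sum>p\<in>prime_factors e. norm (f p - g p))"
    using b pf by (simp add: norm_prod_diff)
  also have "\<dots> = (\<Sum>p\<in>prime_factors e. if p dvd e then norm (f p - g p) else 0)"
    by (rule sum.cong) auto
  also have "\<dots> \<le> (\<Sum>p | prime p \<and> y < p \<and> p \<le> N. if p dvd e then norm (f p - g p) else 0)"
    by (rule sum_mono2) (use pf in auto)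
  finally show ?thesis by (simp add: sum_nonneg add_increasing2)
qed

lemma dirichlet_character_add_mult: "dirichlet_character q chi \<Longrightarrow> chi (n + k * q) = chi n"
  by (metis dirichlet_character_mod mod_mult_self1)

text \<open>With \<open>d = gcd n (y!\<^sup>K)\<close>, the function \<open>n \<mapsto> f d * chi (n / d)\<close> is periodic and differs from \<open>f\<close> only through
  primes above \<open>y\<close>, unless \<open>n\<close> is divisible by \<open>p\<^sup>K\<close> for some \<open>p \<le> y\<close>.\<close>

lemma pretentious_rationally_almost_periodic:
  assumes f: "f \<in> multiplicative_disc" and x: "\<And>p. p > 0 \<Longrightarrow> f p = of_real (x p)" "\<And>p. p > 0 \<Longrightarrow> x p \<in> {-1..1::real}"
    and chi: "dirichlet_character q chi" "\<And>n. coprime n q \<Longrightarrow> chi n ^ 2 = 1"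
    and C: "\<And>X. (\<Sum>p | prime p \<and> real p \<le> X. 1 / real p * (1 - x p * Re (chi p))) \<le> C"
  shows "rationally_almost_periodic (zero_extend f)"
proof (cases "f 1 = 1")
  case False
  have mult: "f (m * n) = f m * f n" if "m > 0" "n > 0" "coprime m n" for m n using f that by (simp add: multiplicative_disc_def)
  have "f 1 = f 1 * f 1" using mult[of 1 1] by simp
  then have "f 1 = 0" using False by simp
  then have "f n = 0" if "n > 0" for n using mult[of 1 n] that by simp
  then have "zero_extend f = (\<lambda>_. 0)" by (auto simp: zero_extend_def)
  then show ?thesis using rationally_almost_periodic_const[of 0] by simp
next
  case f1: True
  have mult: "f (m * n) = f m * f n" if "m > 0" "n > 0" "coprime m n" for m n using f that by (simp add: multiplicative_disc_def)
  have fb: "norm (f n) \<le> 1" if "n > 0" for n using f that by (simp add: multiplicative_disc_def)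
  have cmult: "chi (m * n) = chi m * chi n" for m n using chi by (simp add: dirichlet_character_def)
  have cb: "norm (chi n) \<le> 1" for n by (rule norm_dirichlet_character_le[OF chi(1)])
  have c1: "chi 1 = 1" by (rule dirichlet_character_one[OF chi(1)])
  have q: "q > 0" using chi by (simp add: dirichlet_character_def)
  define a where "a n = (if prime n then 1 / real n * (1 - x n * Re (chi n)) else 0)" for n
  have a0: "a n \<ge> 0" for n
  proof (cases "prime n")
    case True
    then have "n > 0" by (rule prime_gt_0_nat)
    have "\<bar>x n * Re (chi n)\<bar> \<le> 1 * 1" unfolding abs_mult
      using x(2)[OF \<open>n > 0\<close>] abs_Re_le_cmod[of "chi n"] cb[of n] by (intro mult_mono) auto
    then show ?thesis by (simp add: a_def)
  qed (simp add: a_def)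
  have "summable a"
  proof (rule bounded_imp_summable[OF a0])
    fix n
    have "(\<Sum>k\<le>n. a k) = (\<Sum>p | prime p \<and> real p \<le> real n. 1 / real p * (1 - x p * Re (chi p)))"
      unfolding a_def by (rule sum.mono_neutral_cong_right) auto
    also have "\<dots> \<le> C" by (rule C)
    finally show "(\<Sum>k\<le>n. a k) \<le> C" .
  qed
  show ?thesis unfolding rationally_almost_periodic_def
  proof (intro conjI allI impI)
    show "norm (zero_extend f n) \<le> 1" for n using fb by (simp add: zero_extend_def)
    fix \<epsilon> :: real assume \<epsilon>: "\<epsilon> > 0"
    obtain y0 where y0: "\<And>m n. m \<ge> y0 \<Longrightarrow> norm (\<Sum>k=m..n. a k) < \<epsilon> / 4"
      using summable_partial_sum_bound[OF \<open>summable a\<close>, of "\<epsilon> / 4"] \<epsilon> by auto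
    \<comment> \<open>\<open>y \<ge> q\<close> makes chi equal to 1 or -1 at all primes above
      \<open>y\<close>; \<open>y0\<close> bounds the pretentious tail by \<epsilon> / 4; 16 /
      \<epsilon> bounds the sum of 1 / j^2 beyond \<open>y\<close> by \<epsilon> / 8.\<close>
    define y where "y = max q (max y0 (nat \<lceil>16 / \<epsilon>\<rceil>))"
    have y: "y \<ge> q" "y \<ge> y0" "real y \<ge> 16 / \<epsilon>" unfolding y_def by linarith+
    \<comment> \<open>At most y * N / 2^K of the n \<le> N are divisible by p^K for some p in
      {2..y}.\<close>
    obtain K where K: "(1 / 2) ^ K < \<epsilon> / (8 * (real y + 1))"
      using real_arch_pow_inv[of "\<epsilon> / (8 * (real y + 1))" "1 / 2"] \<epsilon> by auto
    define D where "D = (fact y :: nat) ^ K"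
    have D0: "D > 0" by (simp add: D_def)
    define P where "P n = f (gcd n D) * chi (n div gcd n D)" for n :: nat
    \<comment> \<open>The gcd is unchanged, and the cofactor of n moves by a multiple of q because
      gcd n D divides D.\<close>
    have Pper: "P (n + k * (D * q)) = P n" for n k
    proof -
      have g: "gcd (n + k * (D * q)) D = gcd n D"
        using gcd_add_mult[of D "k * q" n] by (simp add: gcd.commute mult_ac add.commute)
      obtain c where c: "D = gcd n D * c" by (meson dvdE gcd_dvd2)
      have "(n + k * (D * q)) div gcd n D = n div gcd n D + (k * c) * q"
      proof -
        have "k * (D * q) = k * ((gcd n D * c) * q)" by (simp only: c[symmetric])
        then have "n + k * (D * q) = n + gcd n D * (k * c * q)" by (simp only: mult_ac)
        then have "(n + k * (D * q)) div gcd n D = (n + gcd n D * (k * c * q)) div gcd n D" by (rule arg_cong)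
        moreover have "gcd n D \<noteq> 0" using D0 by simp
        ultimately show ?thesis by (simp only: div_mult_self2 add.commute not_False_eq_True)
      qed
      then show ?thesis unfolding P_def g using dirichlet_character_add_mult[OF chi(1)] by simp
    qed
    have Pb: "norm (P n) \<le> 1" for n
      unfolding P_def norm_mult using fb[of "gcd n D"] cb D0 by (intro mult_le_one) auto
    have point: "norm (f n - P n) \<le> 2 * (\<Sum>p\<in>{2..y}. if p ^ K dvd n then 1 else 0)
        + ((\<Sum>p | prime p \<and> y < p \<and> p \<le> N. if p dvd n then norm (f p - chi p) else 0)
          + 2 * (\<Sum>j\<in>{y<..N}. if j\<^sup>2 dvd n then 1 else 0))" if n: "n \<in> {1..N}" for n N
    proof (cases "\<exists>p. prime p \<and> p \<le> y \<and> p ^ K dvd n")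
      case True
      then obtain p where p: "prime p" "p \<le> y" "p ^ K dvd n" by blast
      have "norm (f n - P n) \<le> 2" using norm_triangle_ineq4[of "f n" "P n"] fb[of n] Pb[of n] n by simp
      also have "\<dots> = 2 * (\<Sum>p\<in>{p}. if p ^ K dvd n then 1 else 0)" using p by simp
      also have "\<dots> \<le> 2 * (\<Sum>p\<in>{2..y}. if p ^ K dvd n then 1 else 0)"
        using p prime_ge_2_nat[OF p(1)] by (intro mult_left_mono sum_mono2) auto
      finally show ?thesis by (simp add: sum_nonneg add_increasing2)
    next
      case False
      define d where "d = gcd n D"
      define e where "e = n div d"
      have de: "n = d * e" by (simp add: d_def e_def)
      have pos: "d > 0" "e > 0" using n de by (auto intro!: Nat.gr0I)
      have large: "y < p" if p: "prime p" "p dvd e" for p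
      proof (rule ccontr)
        assume "\<not> y < p"
        then have "p dvd fact y" using prime_dvd_fact_iff[OF p(1)] by simp
        then have pD: "p ^ j dvd D" if "j \<le> K" for j unfolding D_def
          by (meson dvd_power_same le_imp_power_dvd dvd_trans that)
        \<comment> \<open>If p^j divides d and p divides e, then p^(j+1) divides both n and D, hence
          d. At j = K this contradicts the case assumption.\<close>
        have "p ^ j dvd d" if "j \<le> K" for j
          using that
        proof (induction j)
          case (Suc j)
          then have "p ^ j * p dvd d * e" using p by (intro mult_dvd_mono) auto
          then show ?case using pD[OF Suc.prems] unfolding d_def de[unfolded d_def, symmetric] by (simp add: mult.commute)
        qed simp
        then have "p ^ K dvd n" using de by simp
        then show False using False p \<open>\<not> y < p\<close> by auto
      qed
      have "coprime d e"
      proof (rule ccontr)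
        assume "\<not> coprime d e"
        then obtain p where p: "prime p" "p dvd d" "p dvd e"
          by (metis coprime_iff_gcd_eq_1 gcd_dvd1 gcd_dvd2 dvd_trans prime_factor_nat)
        then have "p dvd D" unfolding d_def by (meson dvd_trans gcd_dvd2)
        then have "p \<le> y" unfolding D_def using p(1) prime_dvd_power prime_dvd_fact_iff by blast
        then show False using large[OF p(1,3)] by simp
      qed
      then have "f n = f d * f e" using mult pos de by simp
      then have "f n - P n = f d * (f e - chi e)" by (simp add: P_def d_def e_def algebra_simps)
      then have "norm (f n - P n) \<le> norm (f e - chi e)"
        unfolding norm_mult using fb[OF pos(1)] by (simp add: norm_mult mult_left_le_one_le)
      also have "e \<le> N" using de pos n by (metis atLeastAtMost_iff dvd_imp_le dvd_triv_right le_trans not_one_le_zero neq0_conv)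
      then have "norm (f e - chi e) \<le> (\<Sum>p | prime p \<and> y < p \<and> p \<le> N. if p dvd e then norm (f p - chi p) else 0)
          + 2 * (\<Sum>j\<in>{y<..N}. if j\<^sup>2 dvd e then 1 else 0)"
        by (intro norm_multiplicative_diff_le) (use f1 c1 mult cmult fb cb pos large in auto)
      also have "\<dots> \<le> (\<Sum>p | prime p \<and> y < p \<and> p \<le> N. if p dvd n then norm (f p - chi p) else 0)
          + 2 * (\<Sum>j\<in>{y<..N}. if j\<^sup>2 dvd n then 1 else 0)"
        by (intro add_mono mult_left_mono sum_mono) (auto simp: de)
      finally show ?thesis by (simp add: sum_nonneg add_increasing)
    qed
    have total: "(\<Sum>n=1..N. norm (f n - P n)) \<le> \<epsilon> * real N" for N
    proof -
      let ?I = "\<lambda>m. \<Sum>n=1..N. if m dvd n then 1 else 0 :: real"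
      have "(\<Sum>n=1..N. norm (f n - P n)) \<le> (\<Sum>n=1..N. 2 * (\<Sum>p\<in>{2..y}. if p ^ K dvd n then 1 else 0)
        + ((\<Sum>p | prime p \<and> y < p \<and> p \<le> N. if p dvd n then norm (f p - chi p) else 0)
          + 2 * (\<Sum>j\<in>{y<..N}. if j\<^sup>2 dvd n then 1 else 0)))"
        by (rule sum_mono) (rule point)
      also have "\<dots> = 2 * (\<Sum>p\<in>{2..y}. ?I (p ^ K))
        + ((\<Sum>p | prime p \<and> y < p \<and> p \<le> N. \<Sum>n=1..N. if p dvd n then norm (f p - chi p) else 0)
          + 2 * (\<Sum>j\<in>{y<..N}. ?I (j\<^sup>2)))"
        unfolding sum.distrib sum_distrib_left[symmetric]
        by (intro arg_cong2[where f = "(+)"] arg_cong2[where f = "(*)"] refl sum.swap)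
      \<comment> \<open>High powers of small numbers, the pretentious tail and square divisors each
        receive \<epsilon> / 4 * N.\<close>
      also have "\<dots> \<le> 2 * (\<epsilon> / 8 * real N) + (\<epsilon> / 4 * real N + 2 * (\<epsilon> / 8 * real N))"
      proof (intro add_mono mult_left_mono)
        have "(\<Sum>p\<in>{2..y}. ?I (p ^ K)) \<le> (\<Sum>p\<in>{2..y}. real N * (1 / 2) ^ K)"
        proof (rule sum_mono)
          fix p :: nat assume p: "p \<in> {2..y}"
          have "?I (p ^ K) \<le> real N / real (p ^ K)" by (rule sum_indicator_multiples_le) (use p in auto)
          also have "\<dots> \<le> real N / 2 ^ K"
            using p by (intro divide_left_mono) (auto intro!: power_mono)
          finally show "?I (p ^ K) \<le> real N * (1 / 2) ^ K" by (simp add: power_divide)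
        qed
        also have "\<dots> = real (card {2..y}) * (1 / 2) ^ K * real N" by simp
        also have "\<dots> \<le> (real y + 1) * (\<epsilon> / (8 * (real y + 1))) * real N"
          using K by (intro mult_right_mono mult_mono) auto
        also have "\<dots> = \<epsilon> / 8 * real N" by (simp add: field_simps)
        finally show "(\<Sum>p\<in>{2..y}. ?I (p ^ K)) \<le> \<epsilon> / 8 * real N" .
      next
        have "(\<Sum>p | prime p \<and> y < p \<and> p \<le> N. \<Sum>n=1..N. if p dvd n then norm (f p - chi p) else 0)
            \<le> (\<Sum>p | prime p \<and> y < p \<and> p \<le> N. a p * real N)"
        proof (rule sum_mono)
          fix p assume "p \<in> {p. prime p \<and> y < p \<and> p \<le> N}"
          then have p: "prime p" "y < p" "p > 0" by auto
          have "\<not> p dvd q" using p(2) y(1) q dvd_imp_le[of p q] by auto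
          then have "(chi p)\<^sup>2 = 1" using chi(2) p(1) prime_imp_coprime by blast
          then have "chi p = 1 \<or> chi p = -1" by (simp add: power2_eq_1_iff)
          then have "norm (f p - chi p) = 1 - x p * Re (chi p)"
          proof
            assume c: "chi p = 1"
            have "f p - chi p = of_real (x p - 1)" using x(1)[OF p(3)] c by simp
            then have "norm (f p - chi p) = \<bar>x p - 1\<bar>" by (simp only: norm_of_real)
            then show ?thesis using x(2)[OF p(3)] c by simp
          next
            assume c: "chi p = - 1"
            have "f p - chi p = of_real (x p + 1)" using x(1)[OF p(3)] c by simp
            then have "norm (f p - chi p) = \<bar>x p + 1\<bar>" by (simp only: norm_of_real)
            then show ?thesis using x(2)[OF p(3)] c by simp
          qed
          then have ap: "norm (f p - chi p) / real p = a p" using p by (simp add: a_def)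
          have "(\<Sum>n=1..N. if p dvd n then norm (f p - chi p) else 0) = norm (f p - chi p) * ?I p"
            by (simp add: sum_distrib_left) (rule sum.cong, auto)
          also have "\<dots> \<le> norm (f p - chi p) * (real N / real p)"
            using p by (intro mult_left_mono sum_indicator_multiples_le) auto
          also have "\<dots> = a p * real N" by (simp flip: ap)
          finally show "(\<Sum>n=1..N. if p dvd n then norm (f p - chi p) else 0) \<le> a p * real N" .
        qed
        also have "\<dots> = (\<Sum>p | prime p \<and> y < p \<and> p \<le> N. a p) * real N" by (simp add: sum_distrib_right)
        also have "\<dots> \<le> (\<Sum>p=y..N. a p) * real N"
          using a0 by (intro mult_right_mono sum_mono2) auto
        also have "\<dots> \<le> \<epsilon> / 4 * real N" using y0[OF y(2), of N] by (intro mult_right_mono) auto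
        finally show "(\<Sum>p | prime p \<and> y < p \<and> p \<le> N. \<Sum>n=1..N. if p dvd n then norm (f p - chi p) else 0) \<le> \<epsilon> / 4 * real N" .
      next
        have "(\<Sum>j\<in>{y<..N}. ?I (j\<^sup>2)) \<le> (\<Sum>j\<in>{y<..N}. 1 / (real j)\<^sup>2 * real N)"
        proof (rule sum_mono)
          fix j assume "j \<in> {y<..N}"
          then have "?I (j\<^sup>2) \<le> real N / real (j\<^sup>2)" by (intro sum_indicator_multiples_le) auto
          then show "?I (j\<^sup>2) \<le> 1 / (real j)\<^sup>2 * real N" by simp
        qed
        also have "\<dots> = (\<Sum>j\<in>{y<..N}. 1 / (real j)\<^sup>2) * real N" by (simp only: sum_distrib_right)
        also have "\<dots> \<le> \<epsilon> / 8 * real N"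
        proof (rule mult_right_mono)
          show "(\<Sum>j\<in>{y<..N}. 1 / (real j)\<^sup>2) \<le> \<epsilon> / 8"
          proof (cases "Suc y \<le> Suc N")
            case True
            have "{y<..N} = {Suc y..<Suc N}" by auto
            then have "(\<Sum>j\<in>{y<..N}. 1 / (real j)\<^sup>2) \<le> 2 / real (Suc y) - 2 / real (Suc N)"
              using sum_inverse_squares_le[OF _ True] by simp
            also have "\<dots> \<le> 2 / real (Suc y)" by simp
            also have "\<dots> \<le> \<epsilon> / 8" using y(3) \<epsilon> by (simp add: field_simps)
            finally show ?thesis .
          qed (use \<epsilon> in auto)
        qed simp
        finally show "(\<Sum>j\<in>{y<..N}. ?I (j\<^sup>2)) \<le> \<epsilon> / 8 * real N" .
      qed auto
      also have "\<dots> \<le> \<epsilon> * real N" using \<epsilon> by (simp add: field_simps)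
      finally show ?thesis .
    qed
    define W where "W = D * q"
    have W0: "W > 0" using D0 q by (simp add: W_def)
    have Pmod: "P (nat (int n mod int W)) = P n" for n
    proof -
      have "nat (int n mod int W) = n mod W" by (simp add: nat_mod_distrib flip: of_nat_mod)
      then show ?thesis using Pper[of "n mod W" "n div W"] by (simp add: W_def[symmetric])
    qed
    show "\<exists>P q. q > 0 \<and> (\<forall>n. P (n + int q) = P n) \<and> (\<forall>n. norm (P n) \<le> 1) \<and>
        (\<forall>\<^sub>F N in sequentially. (\<Sum>n=1..N. norm (zero_extend f (int n) - P (int n))) \<le> \<epsilon> * real N)"
    proof (intro exI[of _ "\<lambda>n. P (nat (n mod int W))"] exI[of _ W] conjI allI always_eventually)
      fix N
      have "(\<Sum>n=1..N. norm (zero_extend f (int n) - P (nat (int n mod int W)))) = (\<Sum>n=1..N. norm (f n - P n))"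
        by (rule sum.cong) (auto simp: zero_extend_def Pmod)
      then show "(\<Sum>n=1..N. norm (zero_extend f (int n) - P (nat (int n mod int W)))) \<le> \<epsilon> * real N" using total by simp
    qed (use W0 Pb in auto)
  qed
qed

section \<open>Representing measures\<close>

lemma compact_function_box:
  fixes S :: "'b::topological_space set"
  assumes "compact S"
  shows "compact {x :: 'i \<Rightarrow> 'b. \<forall>i. x i \<in> S}"
proof -
  have "compactin (product_topology (\<lambda>i::'i. euclidean :: 'b topology) UNIV) (PiE UNIV (\<lambda>_. S))"
    using assms by (simp add: compactin_PiE)
  then have "compact (PiE UNIV (\<lambda>_::'i. S))" by (simp add: euclidean_product_topology)
  moreover have "PiE UNIV (\<lambda>_::'i. S) = {x. \<forall>i. x i \<in> S}" by (auto simp: PiE_def)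
  ultimately show ?thesis by simp
qed

text \<open>Binary digits are kept as reals so that they enter series without conversion.\<close>

definition bit_sequences :: "(nat \<Rightarrow> real) set" where
  "bit_sequences = {a. \<forall>n. a n \<in> {0, 1}}"

lemma compact_bit_sequences: "compact bit_sequences"
  unfolding bit_sequences_def by (rule compact_function_box) simp

lemma summable_bits:
  fixes r :: real
  assumes "a \<in> bit_sequences" "0 < r" "r < 1"
  shows "summable (\<lambda>n. a (e n) * r ^ n)"
proof (rule summable_comparison_test'[of "\<lambda>n. r ^ n" 0])
  show "summable (\<lambda>n. r ^ n)" using assms by (simp add: summable_geometric)
  fix n show "norm (a (e n) * r ^ n) \<le> r ^ n"
    using assms unfolding bit_sequences_def
    by (cases "a (e n) = 0") (auto simp: abs_mult)
qed

lemma continuous_on_bits: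
  fixes r :: real
  assumes "0 < r" "r < 1"
  shows "continuous_on bit_sequences (\<lambda>a. \<Sum>n. a (e n) * r ^ n)"
proof (rule uniform_limit_theorem)
  show "uniform_limit bit_sequences (\<lambda>N a. \<Sum>n<N. a (e n) * r ^ n) (\<lambda>a. \<Sum>n. a (e n) * r ^ n) sequentially"
  proof (rule Weierstrass_m_test)
    show "summable (\<lambda>n. r ^ n)" using assms by (simp add: summable_geometric)
    fix n and a :: "nat \<Rightarrow> real" assume "a \<in> bit_sequences"
    then have "a (e n) = 0 \<or> a (e n) = 1" by (auto simp: bit_sequences_def)
    then show "norm (a (e n) * r ^ n) \<le> r ^ n" using assms by auto
  qed
  show "\<forall>\<^sub>F N in sequentially. continuous_on bit_sequences (\<lambda>a. \<Sum>n<N. a (e n) * r ^ n)"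
    by (intro always_eventually allI continuous_intros continuous_on_subset[OF continuous_on_product_coordinates]) auto
qed auto

text \<open>The first differing digit contributes (1/3)^k in absolute value, all later ones together
  at most half as much. Base 3 leaves this gap already with the digits 0 and 1.\<close>

lemma inj_on_ternary: "inj_on (\<lambda>a. \<Sum>n. a n * (1 / 3) ^ n :: real) bit_sequences"
proof (rule inj_onI, rule ccontr)
  fix a b :: "nat \<Rightarrow> real"
  assume a: "a \<in> bit_sequences" and b: "b \<in> bit_sequences" and neq: "a \<noteq> b"
    and eq: "(\<Sum>n. a n * (1 / 3) ^ n) = (\<Sum>n. b n * (1 / 3) ^ n)"
  define d where "d n = a n - b n" for n
  have d1: "\<bar>d n\<bar> \<le> 1" for n
  proof -
    have "a n = 0 \<or> a n = 1" "b n = 0 \<or> b n = 1" using a b by (auto simp: bit_sequences_def)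
    then show ?thesis by (auto simp: d_def)
  qed
  have ex: "\<exists>n. d n \<noteq> 0" using neq by (auto simp: d_def)
  define k where "k = (LEAST n. d n \<noteq> 0)"
  have k: "d k \<noteq> 0" unfolding k_def by (rule LeastI_ex[OF ex])
  have below: "d n = 0" if "n < k" for n using not_less_Least[of n "\<lambda>n. d n \<noteq> 0"] that k_def by auto
  have dk: "\<bar>d k\<bar> = 1"
  proof -
    have "a k = 0 \<or> a k = 1" "b k = 0 \<or> b k = 1" using a b by (auto simp: bit_sequences_def)
    then show ?thesis using k by (auto simp: d_def)
  qed
  have sa: "summable (\<lambda>n. a n * (1/3) ^ n)" "summable (\<lambda>n. b n * (1/3) ^ n)"
    using summable_bits[OF a, of "1/3" "\<lambda>n. n"] summable_bits[OF b, of "1/3" "\<lambda>n. n"] by simp_all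
  have sd: "summable (\<lambda>n. d n * (1/3) ^ n)"
    using summable_diff[OF sa] by (simp add: d_def algebra_simps)
  have "(\<Sum>n. d n * (1/3) ^ n) = 0"
    using suminf_diff[OF sa] eq by (simp add: d_def algebra_simps)
  moreover have "(\<Sum>n. d n * (1/3) ^ n) = (\<Sum>n. d (n + Suc k) * (1/3) ^ (n + Suc k)) + (\<Sum>n<Suc k. d n * (1/3) ^ n)"
    by (rule suminf_split_initial_segment[OF sd])
  moreover have "(\<Sum>n<Suc k. d n * (1/3) ^ n) = d k * (1/3) ^ k" using below by simp
  ultimately have "\<bar>d k * (1/3) ^ k\<bar> = \<bar>\<Sum>n. d (n + Suc k) * (1/3) ^ (n + Suc k)\<bar>" by linarith
  also have "\<dots> \<le> (\<Sum>n. (1/3) ^ Suc k * (1/3) ^ n)"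
  proof -
    have "norm (d (n + Suc k) * (1/3) ^ (n + Suc k)) \<le> (1/3) ^ Suc k * (1/3) ^ n" for n
    proof -
      have "norm (d (n + Suc k) * (1/3) ^ (n + Suc k)) = \<bar>d (n + Suc k)\<bar> * (1/3) ^ (n + Suc k)"
        by (simp add: abs_mult)
      also have "\<dots> \<le> 1 * (1/3) ^ (n + Suc k)" by (intro mult_right_mono d1) auto
      finally show ?thesis by (simp add: power_add mult_ac)
    qed
    then have "norm (\<Sum>n. d (n + Suc k) * (1/3) ^ (n + Suc k)) \<le> (\<Sum>n. (1/3) ^ Suc k * (1/3) ^ n)"
      by (rule norm_suminf_le) (intro summable_mult summable_geometric, simp)
    then show ?thesis by simp
  qed
  also have "\<dots> = (1/3) ^ Suc k * (\<Sum>n. (1/3) ^ n)"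
    by (rule suminf_mult) (simp add: summable_geometric)
  also have "\<dots> = (1/3) ^ Suc k * (3 / 2)" by (simp add: suminf_geometric)
  also have "\<dots> = (1/3) ^ k / 2" by simp
  finally have "(1/3::real) ^ k \<le> (1/3) ^ k / 2" by (simp add: abs_mult dk)
  then show False by simp
qed

text \<open>The first digit has weight 1, hence the range up to 2. The partial sum through digit N
  is the floor of 2^N * t divided by 2^N.\<close>

lemma binary_expansion:
  fixes t :: real
  assumes t: "0 \<le> t" "t < 2"
  shows "\<exists>a\<in>bit_sequences. (\<Sum>n. a n * (1 / 2) ^ n) = t"
proof -
  define a where "a n = real_of_int (\<lfloor>2 ^ n * t\<rfloor> mod 2)" for n :: nat
  have a: "a \<in> bit_sequences"
  proof -
    have "\<lfloor>2 ^ n * t\<rfloor> mod 2 = 0 \<or> \<lfloor>2 ^ n * t\<rfloor> mod 2 = 1" for n by linarith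
    then show ?thesis unfolding bit_sequences_def a_def by force
  qed
  have partial: "(\<Sum>n<Suc N. a n * (1 / 2) ^ n) = real_of_int \<lfloor>2 ^ N * t\<rfloor> / 2 ^ N" for N
  proof (induction N)
    case 0
    have "\<lfloor>t\<rfloor> = 0 \<or> \<lfloor>t\<rfloor> = 1" using t by linarith
    then show ?case by (auto simp: a_def)
  next
    case (Suc N)
    have "\<lfloor>2 ^ N * t\<rfloor> = \<lfloor>2 ^ Suc N * t\<rfloor> div 2"
      using floor_divide_real_eq_div[of 2 "2 ^ Suc N * t"] by simp
    then have "\<lfloor>2 ^ Suc N * t\<rfloor> = 2 * \<lfloor>2 ^ N * t\<rfloor> + \<lfloor>2 ^ Suc N * t\<rfloor> mod 2" by simp
    then have "real_of_int \<lfloor>2 ^ Suc N * t\<rfloor> = 2 * real_of_int \<lfloor>2 ^ N * t\<rfloor> + a (Suc N)"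
      unfolding a_def by (metis of_int_add of_int_mult of_int_numeral)
    then have "real_of_int \<lfloor>2 ^ Suc N * t\<rfloor> / 2 ^ Suc N = real_of_int \<lfloor>2 ^ N * t\<rfloor> / 2 ^ N + a (Suc N) * (1 / 2) ^ Suc N"
      by (simp add: add_divide_distrib power_divide)
    then show ?case using Suc by (simp only: sum.lessThan_Suc[of _ "Suc N"])
  qed
  have "(\<lambda>N. (\<Sum>n<Suc N. a n * (1 / 2) ^ n) - t) \<longlonglongrightarrow> 0"
  proof (rule Lim_null_comparison)
    show "\<forall>\<^sub>F N in sequentially. norm ((\<Sum>n<Suc N. a n * (1 / 2) ^ n) - t) \<le> (1 / 2) ^ N"
    proof (intro always_eventually allI)
      fix N
      have "real_of_int \<lfloor>2 ^ N * t\<rfloor> \<le> 2 ^ N * t" "2 ^ N * t \<le> real_of_int \<lfloor>2 ^ N * t\<rfloor> + 1" by linarith+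
      then have "\<bar>real_of_int \<lfloor>2 ^ N * t\<rfloor> - 2 ^ N * t\<bar> \<le> 1" by linarith
      then have "\<bar>real_of_int \<lfloor>2 ^ N * t\<rfloor> - 2 ^ N * t\<bar> / 2 ^ N \<le> 1 / 2 ^ N" by (rule divide_right_mono) simp
      moreover have "real_of_int \<lfloor>2 ^ N * t\<rfloor> / 2 ^ N - t = (real_of_int \<lfloor>2 ^ N * t\<rfloor> - 2 ^ N * t) / 2 ^ N"
        by (simp add: diff_divide_distrib)
      ultimately have "\<bar>real_of_int \<lfloor>2 ^ N * t\<rfloor> / 2 ^ N - t\<bar> \<le> 1 / 2 ^ N" by (simp only: abs_divide) simp
      then show "norm ((\<Sum>n<Suc N. a n * (1 / 2) ^ n) - t) \<le> (1 / 2) ^ N" unfolding partial by (simp add: power_divide)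
    qed
    show "(\<lambda>N. (1 / 2 :: real) ^ N) \<longlonglongrightarrow> 0" by (rule LIMSEQ_realpow_zero) auto
  qed
  then have "(\<lambda>N. \<Sum>n<Suc N. a n * (1 / 2) ^ n) \<longlonglongrightarrow> t" by (simp only: LIM_zero_iff)
  moreover have "(\<lambda>N. \<Sum>n<Suc N. a n * (1 / 2) ^ n) \<longlonglongrightarrow> (\<Sum>n. a n * (1 / 2) ^ n)"
    by (intro LIMSEQ_Suc summable_LIMSEQ) (use summable_bits[OF a, of "1/2" "\<lambda>n. n"] in simp)
  ultimately have "(\<Sum>n. a n * (1 / 2) ^ n) = t" by (rule LIMSEQ_unique[rotated])
  then show ?thesis using a by blast
qed

text \<open>A Cantor-set parametrisation: ternary digits encode, row by row, the binary digits of all coordinates.\<close>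

lemma compact_real_parametrization:
  fixes X :: "(int \<Rightarrow> complex) set"
  assumes X: "closed X" and box: "\<And>x m. x \<in> X \<Longrightarrow> \<exists>r\<in>{-1..1}. x m = of_real r"
  shows "\<exists>K \<pi>. compact (K::real set) \<and> continuous_on K \<pi> \<and> \<pi> ` K = X"
proof -
  define c where "c a = (\<Sum>n. a n * (1 / 3) ^ n :: real)" for a :: "nat \<Rightarrow> real"
  \<comment> \<open>The affine map sends [0, 2] onto [-2, 2], so every r in [-1, 1] has its preimage
    (r + 2) / 2 in [1/2, 3/2], away from the end point 2 that \<open>binary_expansion\<close>
    excludes.\<close>
  define v where "v a m = complex_of_real (2 * (\<Sum>n. a (prod_encode (int_encode m, n)) * (1 / 2) ^ n) - 2)"
    for a :: "nat \<Rightarrow> real" and m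
  define A where "A = bit_sequences \<inter> v -` X"
  have cont_v: "continuous_on bit_sequences v"
    unfolding v_def
    by (intro continuous_on_coordinatewise_then_product continuous_intros continuous_on_bits) auto
  have cont_c: "continuous_on bit_sequences c"
    unfolding c_def using continuous_on_bits[of "1/3" "\<lambda>n. n"] by simp
  have "closed A" unfolding A_def
    by (rule continuous_closed_preimage[OF cont_v _ X]) (simp add: compact_imp_closed compact_bit_sequences)
  then have "compact (bit_sequences \<inter> A)" by (rule compact_Int_closed[OF compact_bit_sequences])
  then have cA: "compact A" by (simp add: A_def Int_absorb1 inf_assoc[symmetric])
  have A_sub: "A \<subseteq> bit_sequences" by (simp add: A_def)
  have inj: "inj_on c A" using inj_on_ternary A_sub unfolding c_def by (rule inj_on_subset)
  have surj: "X \<subseteq> v ` A"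
  proof
    fix x assume x: "x \<in> X"
    have "\<exists>a\<in>bit_sequences. of_real (2 * (\<Sum>n. a n * (1 / 2) ^ n) - 2) = x m" for m
    proof -
      obtain r where r: "r \<in> {-1..1}" "x m = of_real r" using box[OF x] by blast
      obtain a where "a \<in> bit_sequences" "(\<Sum>n. a n * (1 / 2) ^ n) = (r + 2) / 2"
        using binary_expansion[of "(r + 2) / 2"] r by auto
      moreover from this have "2 * (\<Sum>n. a n * (1 / 2) ^ n) - 2 = r" by simp
      ultimately show ?thesis unfolding r(2) by (intro bexI[of _ a]) (simp_all only:)
    qed
    then obtain F where F: "\<And>m. F m \<in> bit_sequences" "\<And>m. of_real (2 * (\<Sum>n. F m n * (1 / 2) ^ n) - 2) = x m"
      by metis
    define a where "a j = F (int_decode (fst (prod_decode j))) (snd (prod_decode j))" for j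
    have "a \<in> bit_sequences" using F(1) by (auto simp: bit_sequences_def a_def)
    moreover have "v a = x" using F(2) by (simp add: v_def a_def fun_eq_iff)
    ultimately show "x \<in> v ` A" using x by (auto simp: A_def)
  qed
  show ?thesis
  proof (intro exI conjI)
    show "compact (c ` A)" using cA cont_c A_sub by (intro compact_continuous_image continuous_on_subset[OF cont_c])
    have "continuous_on (c ` A) (the_inv_into A c)"
      using cA A_sub inj by (intro continuous_on_inv_into continuous_on_subset[OF cont_c])
    moreover have im: "the_inv_into A c ` c ` A = A" using inj by (auto simp: the_inv_into_f_f image_image)
    ultimately show "continuous_on (c ` A) (v \<circ> the_inv_into A c)"
      by (intro continuous_on_compose) (auto intro: continuous_on_subset[OF cont_v A_sub])
    show "(v \<circ> the_inv_into A c) ` c ` A = X"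
      unfolding image_comp[symmetric] im using surj by (auto simp: A_def)
  qed
qed

text \<open>The point masses are lifted to the real line, where Helly's theorem provides a limit measure, which
  is then pushed forward.\<close>

lemma limit_measure_of_averages:
  fixes X :: "'a::metric_space set" and y :: "nat \<Rightarrow> 'a"
  assumes K: "compact (K::real set)" and \<pi>: "continuous_on K \<pi>" "\<pi> ` K = X" and y: "\<And>n. y n \<in> X"
    and conv: "\<And>\<phi> :: 'a \<Rightarrow> real. continuous_on X \<phi> \<Longrightarrow> convergent (\<lambda>N. (\<Sum>n=1..N. \<phi> (y n)) / real N)"
  shows "\<exists>\<nu>. borel_prob_on X \<nu> \<and>
    (\<forall>\<phi> :: 'a \<Rightarrow> real. continuous_on X \<phi> \<longrightarrow> (\<lambda>N. (\<Sum>n=1..N. \<phi> (y n)) / real N) \<longlonglongrightarrow> integral\<^sup>L \<nu> \<phi>)"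
proof -
  have "\<exists>t\<in>K. \<pi> t = y n" for n using y[of n] \<pi>(2) by auto
  then obtain k where k: "\<And>n. k n \<in> K" "\<And>n. \<pi> (k n) = y n" by metis
  \<comment> \<open>\<open>Suc N\<close> avoids the uniform measure on the empty set, which is no
    probability measure.\<close>
  define \<mu> where "\<mu> N = distr (uniform_count_measure {1..Suc N}) borel k" for N
  have rd: "real_distribution (\<mu> N)" for N
  proof -
    interpret prob_space "uniform_count_measure {1..Suc N}" by (rule prob_space_uniform_count_measure) auto
    show ?thesis unfolding \<mu>_def
      by (rule real_distribution_distr) (simp add: measurable_def space_uniform_count_measure sets_uniform_count_measure)
  qed
  have meas_k: "k \<in> measurable (uniform_count_measure {1..Suc N}) borel" for N
    by (simp add: measurable_def space_uniform_count_measure sets_uniform_count_measure)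
  have int_\<mu>: "integral\<^sup>L (\<mu> N) g = (\<Sum>n=1..Suc N. g (k n)) / real (Suc N)"
    if "g \<in> borel_measurable borel" for N and g :: "real \<Rightarrow> real"
    unfolding \<mu>_def by (subst integral_distr[OF meas_k that]) (simp add: integral_uniform_count_measure)
  obtain B where B: "\<And>t. t \<in> K \<Longrightarrow> \<bar>t\<bar> \<le> B" using compact_imp_bounded[OF K] unfolding bounded_iff by auto
  have "tight \<mu>" unfolding tight_def
  proof (intro conjI allI impI rd)
    fix \<epsilon> :: real assume \<epsilon>: "\<epsilon> > 0"
    have "measure (\<mu> n) {- \<bar>B\<bar> - 1<..\<bar>B\<bar> + 1} = 1" for n
    proof -
      have "k -` {- \<bar>B\<bar> - 1<..\<bar>B\<bar> + 1} \<inter> {1..Suc n} = {1..Suc n}"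
      proof -
        have "- \<bar>B\<bar> - 1 < k i \<and> k i \<le> \<bar>B\<bar> + 1" for i using B[OF k(1)[of i]] by linarith
        then show ?thesis by auto
      qed
      then show ?thesis unfolding \<mu>_def
        by (subst measure_distr[OF meas_k]) (auto simp: space_uniform_count_measure measure_uniform_count_measure)
    qed
    then show "\<exists>a b. a < b \<and> (\<forall>n. 1 - \<epsilon> < measure (\<mu> n) {a<..b})"
      using \<epsilon> by (intro exI[of _ "- \<bar>B\<bar> - 1"] exI[of _ "\<bar>B\<bar> + 1"]) auto
  qed
  then obtain r M where r: "strict_mono r" and M: "real_distribution M" and wc: "weak_conv_m (\<mu> \<circ> id \<circ> r) M"
    using tight_imp_convergent_subsubsequence[of \<mu> id] by (auto simp: strict_mono_def)
  interpret M: real_distribution M by fact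
  have rdr: "real_distribution ((\<mu> \<circ> id \<circ> r) n)" for n using rd by simp
  have lim: "(\<lambda>n. integral\<^sup>L (\<mu> (r n)) g) \<longlonglongrightarrow> integral\<^sup>L M g"
    if "continuous_on UNIV g" "\<And>x. norm (g x) \<le> C" for g :: "real \<Rightarrow> real" and C
  proof -
    have "isCont g x" for x using that(1) by (simp add: continuous_on_eq_continuous_at)
    from weak_conv_imp_integral_bdd_continuous_conv[OF rdr M wc this that(2)]
    show ?thesis by simp
  qed
  have Kne: "K \<noteq> {}" using k by blast
  have closedK: "closed K" using K by (rule compact_imp_closed)
  have AE_K: "AE x in M. x \<in> K"
  proof -
    \<comment> \<open>The truncated distance to K is a bounded continuous test function that
      integrates to 0 against every \<open>\<mu> n\<close>, hence against the limit, which is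
      therefore carried by K.\<close>
    define g where "g x = min 1 (infdist x K)" for x
    have g: "continuous_on UNIV g" unfolding g_def by (intro continuous_intros)
    have gb: "norm (g x) \<le> 1" "g x \<ge> 0" for x by (simp_all add: g_def infdist_nonneg)
    have gm: "g \<in> borel_measurable borel" using g by (rule borel_measurable_continuous_onI)
    have "integral\<^sup>L (\<mu> n) g = 0" for n
      unfolding int_\<mu>[OF gm] using k(1) by (simp add: g_def)
    then have "integral\<^sup>L M g = 0" using lim[OF g gb(1)] by (simp add: LIMSEQ_const_iff)
    moreover have "integrable M g"
      by (rule M.integrable_const_bound[of _ 1]) (use gb gm in auto)
    ultimately have "AE x in M. g x = 0" using gb integral_nonneg_eq_0_iff_AE by blast
    then show ?thesis
      by eventually_elim (use Kne closedK in \<open>auto simp: g_def min_def in_closed_iff_infdist_zero split: if_splits\<close>)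
  qed
  \<comment> \<open>\<open>\<pi>\<close> is controlled on K only; off K, a null set for M, a fixed
    point of X is used to stay inside X.\<close>
  define \<rho> where "\<rho> x = (if x \<in> K then \<pi> x else y 0)" for x
  have \<rho>X: "\<rho> x \<in> X" for x using \<pi>(2) y by (auto simp: \<rho>_def)
  have \<rho>: "\<rho> \<in> measurable M (restrict_space borel X)"
  proof (rule measurable_restrict_space2)
    show "\<rho> \<in> space M \<rightarrow> X" using \<rho>X by auto
    have "\<rho> \<in> borel_measurable borel" unfolding \<rho>_def
    proof (rule measurable_If_restrict_space_iff[THEN iffD2])
      show "\<pi> \<in> borel_measurable (restrict_space borel {x. x \<in> K}) \<and> (\<lambda>_. y 0) \<in> borel_measurable (restrict_space borel {x. x \<notin> K})"
        using borel_measurable_continuous_on_restrict[OF \<pi>(1)] by simp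
      show "{x \<in> space borel. x \<in> K} \<in> sets borel" using closedK by simp
    qed
    then show "\<rho> \<in> measurable M borel" by simp
  qed
  define \<nu> where "\<nu> = distr M (restrict_space borel X) \<rho>"
  have "borel_prob_on X \<nu>" unfolding borel_prob_on_def \<nu>_def using M.prob_space_distr[OF \<rho>] by simp
  moreover have "(\<lambda>N. (\<Sum>n=1..N. \<phi> (y n)) / real N) \<longlonglongrightarrow> integral\<^sup>L \<nu> \<phi>"
    if \<phi>: "continuous_on X \<phi>" for \<phi> :: "'a \<Rightarrow> real"
  proof -
    have c: "continuous_on K (\<phi> \<circ> \<pi>)" by (rule continuous_on_compose[OF \<pi>(1)]) (use \<phi> \<pi>(2) in simp)
    obtain C where C: "\<And>x. x \<in> K \<Longrightarrow> norm ((\<phi> \<circ> \<pi>) x) \<le> C"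
      using compact_imp_bounded[OF compact_continuous_image[OF c K]] unfolding bounded_iff by auto
    have "C \<ge> 0" using C[OF k(1)[of 0]] norm_ge_zero order.trans by blast
    \<comment> \<open>\<phi> composed with \<pi> is continuous on K alone; Tietze extends it to a
      bounded continuous function on the line, the kind that weak convergence tests.\<close>
    then obtain g where g: "continuous_on UNIV g" "\<And>x. x \<in> K \<Longrightarrow> g x = (\<phi> \<circ> \<pi>) x" "\<And>x. norm (g x) \<le> C"
      using Tietze[of K "\<phi> \<circ> \<pi>" UNIV C] c C closedK by auto
    have gm: "g \<in> borel_measurable borel" using g(1) by (rule borel_measurable_continuous_onI)
    have "integral\<^sup>L \<nu> \<phi> = integral\<^sup>L M (\<lambda>x. \<phi> (\<rho> x))"
      unfolding \<nu>_def by (rule integral_distr[OF \<rho> borel_measurable_continuous_on_restrict[OF \<phi>]])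
    also have "\<dots> = integral\<^sup>L M g"
    proof (rule integral_cong_AE)
      show "(\<lambda>x. \<phi> (\<rho> x)) \<in> borel_measurable M"
        by (rule measurable_compose[OF \<rho> borel_measurable_continuous_on_restrict[OF \<phi>]])
      show "AE x in M. \<phi> (\<rho> x) = g x" using AE_K by eventually_elim (simp add: g(2) \<rho>_def)
    qed (use gm in simp)
    finally have "(\<lambda>n. integral\<^sup>L (\<mu> (r n)) g) \<longlonglongrightarrow> integral\<^sup>L \<nu> \<phi>" using lim[OF g(1,3)] by simp
    moreover have "integral\<^sup>L (\<mu> n) g = (\<Sum>n=1..Suc n. \<phi> (y n)) / real (Suc n)" for n
      unfolding int_\<mu>[OF gm] using g(2)[OF k(1)] k(2) by simp
    ultimately have sub: "(\<lambda>n. (\<Sum>n=1..Suc (r n). \<phi> (y n)) / real (Suc (r n))) \<longlonglongrightarrow> integral\<^sup>L \<nu> \<phi>" by simp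
    \<comment> \<open>Helly's theorem gives a limit along \<open>r\<close> only; since the full
      averages converge, their limit must be the same.\<close>
    obtain L where L: "(\<lambda>N. (\<Sum>n=1..N. \<phi> (y n)) / real N) \<longlonglongrightarrow> L" using conv[OF \<phi>] unfolding convergent_def by blast
    have "strict_mono (\<lambda>n. Suc (r n))" using r by (simp add: strict_mono_def)
    from LIMSEQ_subseq_LIMSEQ[OF L this] sub have "L = integral\<^sup>L \<nu> \<phi>" by (simp add: o_def LIMSEQ_unique)
    then show ?thesis using L by simp
  qed
  ultimately show ?thesis by blast
qed

section \<open>Furstenberg systems of real multiplicative functions\<close>

text \<open>A nested form of polynomials in the real parts of the coordinates: \<open>coord\<close>
  multiplies by one coordinate at a time, which suits the induction on averages, and closure under
  products is derived.\<close>

inductive coordinate_polynomial :: "((int \<Rightarrow> complex) \<Rightarrow> real) \<Rightarrow> bool" where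
  const: "coordinate_polynomial (\<lambda>_. c)"
| add: "coordinate_polynomial \<phi> \<Longrightarrow> coordinate_polynomial \<psi> \<Longrightarrow> coordinate_polynomial (\<lambda>x. \<phi> x + \<psi> x)"
| coord: "coordinate_polynomial \<phi> \<Longrightarrow> coordinate_polynomial (\<lambda>x. Re (x b) * \<phi> x)"

lemma coordinate_polynomial_scale: "coordinate_polynomial \<phi> \<Longrightarrow> coordinate_polynomial (\<lambda>x. c * \<phi> x)"
proof (induction rule: coordinate_polynomial.induct)
  case (add \<phi> \<psi>)
  then show ?case using coordinate_polynomial.add[OF add.IH] by (simp add: distrib_left)
next
  case (coord \<phi> b)
  then show ?case using coordinate_polynomial.coord[OF coord.IH, of b] by (simp add: mult.left_commute)
qed (rule coordinate_polynomial.const)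

lemma coordinate_polynomial_mult:
  assumes "coordinate_polynomial \<phi>" "coordinate_polynomial \<psi>"
  shows "coordinate_polynomial (\<lambda>x. \<phi> x * \<psi> x)"
  using assms(1)
proof (induction rule: coordinate_polynomial.induct)
  case (const c)
  then show ?case by (rule coordinate_polynomial_scale[OF assms(2)])
next
  case (add \<phi> \<psi>')
  then show ?case using coordinate_polynomial.add[OF add.IH] by (simp add: distrib_right)
next
  case (coord \<phi> b)
  then show ?case using coordinate_polynomial.coord[OF coord.IH, of b] by (simp add: mult.assoc)
qed

lemma continuous_on_coordinate_polynomial: "coordinate_polynomial \<phi> \<Longrightarrow> continuous_on S \<phi>"
  by (induction rule: coordinate_polynomial.induct)
    (auto intro!: continuous_intros continuous_on_subset[OF continuous_on_product_coordinates])

text \<open>The monomial \<open>bs\<close> is carried along so that the case \<open>coord\<close>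
  can move its coordinate into it; the instance wanted later has \<open>bs = []\<close>.\<close>

lemma coordinate_polynomial_average_convergent:
  assumes mono: "\<And>bs. convergent (\<lambda>N. (\<Sum>n=1..N. prod_list (map (\<lambda>b. Re (x (b + int n))) bs)) / real N)"
    and \<phi>: "coordinate_polynomial \<phi>"
  shows "convergent (\<lambda>N. (\<Sum>n=1..N. prod_list (map (\<lambda>b. Re (x (b + int n))) bs) * \<phi> (shift_seq (int n) x)) / real N)"
  using \<phi>
proof (induction arbitrary: bs rule: coordinate_polynomial.induct)
  case (const c)
  have "convergent (\<lambda>N. c * ((\<Sum>n=1..N. prod_list (map (\<lambda>b. Re (x (b + int n))) bs)) / real N))"
    by (intro convergent_mult convergent_const mono)
  then show ?case by (simp add: sum_distrib_left mult.commute)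
next
  case (add \<phi> \<psi>)
  then show ?case using convergent_add[OF add.IH(1)[of bs] add.IH(2)[of bs]]
    by (simp add: distrib_left sum.distrib add_divide_distrib)
next
  case (coord \<phi> b)
  then show ?case using coord.IH[of "b # bs"] by (simp add: shift_seq_def mult_ac)
qed

lemma orbit_closure_subset:
  assumes "\<And>m. x m \<in> S" "closed S"
  shows "orbit_closure x \<subseteq> {y. \<forall>m. y m \<in> S}"
proof -
  have "closed (\<Inter>m. (\<lambda>y :: int \<Rightarrow> complex. y m) -` S)"
    by (intro closed_INT ballI closed_vimage[OF assms(2) continuous_on_product_coordinates])
  moreover have "(\<Inter>m. (\<lambda>y :: int \<Rightarrow> complex. y m) -` S) = {y. \<forall>m. y m \<in> S}" by auto
  ultimately have "closed {y :: int \<Rightarrow> complex. \<forall>m. y m \<in> S}" by simp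
  then show ?thesis unfolding orbit_closure_def
    by (intro closure_minimal) (use assms in \<open>auto simp: shift_seq_def\<close>)
qed

text \<open>The orbit closure is compact and consists of real sequences, so the real parts of the
  coordinates separate its points. A uniform error below e / 4 in the polynomial approximation
  passes to the averages.\<close>

lemma continuous_average_convergent:
  fixes x :: "int \<Rightarrow> complex"
  assumes x: "\<And>m. x m \<in> of_real ` {-1..1}"
    and mono: "\<And>bs. convergent (\<lambda>N. (\<Sum>n=1..N. prod_list (map (\<lambda>b. Re (x (b + int n))) bs)) / real N)"
    and \<phi>: "continuous_on (orbit_closure x) \<phi>"
  shows "convergent (\<lambda>N. (\<Sum>n=1..N. \<phi> (shift_seq (int n) x)) / real N)"
proof (rule Cauchy_convergent, rule metric_CauchyI)
  fix e :: real assume e: "e > 0"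
  let ?X = "orbit_closure x"
  let ?I = "complex_of_real ` {-1..1}"
  have cI: "compact ?I" by (intro compact_continuous_image continuous_intros) auto
  have sub: "?X \<subseteq> {y. \<forall>m. y m \<in> ?I}" using x cI by (intro orbit_closure_subset compact_imp_closed)
  have "compact ({y. \<forall>m. y m \<in> ?I} \<inter> ?X)"
    by (rule compact_Int_closed[OF compact_function_box[OF cI]]) (simp add: orbit_closure_def)
  then have cX: "compact ?X" using sub by (simp add: Int_absorb1)
  have "\<exists>g. coordinate_polynomial g \<and> (\<forall>y\<in>?X. \<bar>\<phi> y - g y\<bar> < e / 4)"
  proof (rule Stone_Weierstrass_HOL[OF cX])
    fix y z assume yz: "y \<in> ?X \<and> z \<in> ?X \<and> y \<noteq> z"
    then obtain m where m: "y m \<noteq> z m" by auto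
    have "Re (y m) \<noteq> Re (z m)"
    proof -
      have "y m \<in> ?I" "z m \<in> ?I" using yz sub by auto
      then show ?thesis using m by auto
    qed
    then show "\<exists>f. coordinate_polynomial f \<and> f y \<noteq> f z"
      by (intro exI[of _ "\<lambda>y. Re (y m) * 1"] conjI coordinate_polynomial.intros) auto
  qed (use \<phi> e in \<open>auto intro: coordinate_polynomial.intros coordinate_polynomial_mult continuous_on_coordinate_polynomial\<close>)
  then obtain g where g: "coordinate_polynomial g" "\<And>y. y \<in> ?X \<Longrightarrow> \<bar>\<phi> y - g y\<bar> < e / 4" by blast
  let ?A = "\<lambda>\<phi> N. (\<Sum>n=1..N. \<phi> (shift_seq (int n) x)) / real N"
  have "convergent (?A g)" using coordinate_polynomial_average_convergent[OF mono g(1), of "[]"] by simp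
  then have "Cauchy (?A g)" by (rule convergent_Cauchy)
  then obtain M0 where M0: "\<And>m n. m \<ge> M0 \<Longrightarrow> n \<ge> M0 \<Longrightarrow> dist (?A g m) (?A g n) < e / 2"
    using e metric_CauchyD[of "?A g" "e / 2"] by auto
  have close: "dist (?A \<phi> N) (?A g N) \<le> e / 4" for N
  proof (cases "N = 0")
    case False
    have "dist (?A \<phi> N) (?A g N) = \<bar>\<Sum>n=1..N. \<phi> (shift_seq (int n) x) - g (shift_seq (int n) x)\<bar> / real N"
      by (simp add: dist_real_def sum_subtractf abs_divide flip: diff_divide_distrib)
    also have "\<dots> \<le> (\<Sum>n=1..N. e / 4) / real N"
      by (intro divide_right_mono order.trans[OF sum_abs] sum_mono)
        (use g(2)[OF shift_in_orbit_closure] in \<open>auto intro: less_imp_le\<close>)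
    finally show ?thesis using False by simp
  qed (use e in simp)
  show "\<exists>M. \<forall>m\<ge>M. \<forall>n\<ge>M. dist (?A \<phi> m) (?A \<phi> n) < e"
  proof (intro exI[of _ M0] allI impI)
    fix m n assume mn: "m \<ge> M0" "n \<ge> M0"
    show "dist (?A \<phi> m) (?A \<phi> n) < e"
      using close[of m] close[of n] M0[OF mn] unfolding dist_real_def by linarith
  qed
qed

lemma exactly_one_furstenberg_systemI:
  assumes x: "\<And>m. zero_extend f m \<in> of_real ` {-1..1}"
    and mono: "\<And>bs. convergent (\<lambda>N. (\<Sum>n=1..N. prod_list (map (\<lambda>b. Re (zero_extend f (b + int n))) bs)) / real N)"
  shows "exactly_one_furstenberg_system f"
proof -
  let ?x = "zero_extend f"
  let ?X = "orbit_closure ?x"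
  let ?I = "complex_of_real ` {-1..1}"
  have "compact ?I" by (intro compact_continuous_image continuous_intros) auto
  then have sub: "?X \<subseteq> {y. \<forall>m. y m \<in> ?I}" using x by (intro orbit_closure_subset compact_imp_closed)
  have "closed ?X" by (simp add: orbit_closure_def)
  moreover have "\<exists>r\<in>{-1..1}. y m = of_real r" if "y \<in> ?X" for y m using sub that by auto
  ultimately obtain K \<pi> where K: "compact (K :: real set)" "continuous_on K \<pi>" "\<pi> ` K = ?X"
    using compact_real_parametrization by metis
  have "\<exists>\<nu>. borel_prob_on ?X \<nu> \<and> (\<forall>\<phi> :: _ \<Rightarrow> real. continuous_on ?X \<phi> \<longrightarrow>
      (\<lambda>N. (\<Sum>n=1..N. \<phi> (shift_seq (int n) ?x)) / real N) \<longlonglongrightarrow> integral\<^sup>L \<nu> \<phi>)"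
    using K shift_in_orbit_closure continuous_average_convergent[OF x mono]
    by (intro limit_measure_of_averages)
  then show ?thesis
    unfolding exactly_one_furstenberg_system_def weak_star_limit_def
    by (simp add: integral_empirical_measure cong: conj_cong imp_cong)
qed

section \<open>From monomials in the coordinates to correlations of powers of f\<close>

lemma multiplicative_disc_power:
  assumes "f \<in> multiplicative_disc"
  shows "(\<lambda>n. f n ^ k) \<in> multiplicative_disc"
  using assms by (auto simp: multiplicative_disc_def power_mult_distrib norm_power power_le_one)

text \<open>For k = 0 the two sides would be 0 and 1 at nonpositive m.\<close>

lemma zero_extend_power: "k > 0 \<Longrightarrow> zero_extend (\<lambda>n. f n ^ k) m = zero_extend f m ^ k"
  by (simp add: zero_extend_def)

text \<open>Brings a finite set of shifts into the indexing of the conjecture, strictly increasing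
  on {1..k}.\<close>

lemma prod_over_sorted_enumeration:
  fixes B :: "int set"
  assumes "finite B"
  shows "\<exists>b. strict_mono_on {1..card B} b \<and> bij_betw b {1..card B} B"
proof -
  define l where "l = sorted_list_of_set B"
  have l: "length l = card B" "distinct l" "set l = B" "sorted_wrt (<) l"
    using assms by (simp_all add: l_def)
  have "bij_betw (\<lambda>j. j - 1) {1..card B} {..<card B}"
    by (rule bij_betwI[where g = Suc]) auto
  moreover have "bij_betw ((!) l) {..<card B} B"
    using l by (intro bij_betw_nth) auto
  ultimately have "bij_betw ((!) l \<circ> (\<lambda>j. j - 1)) {1..card B} B" by (rule bij_betw_trans)
  moreover have "strict_mono_on {1..card B} ((!) l \<circ> (\<lambda>j. j - 1))"
    using l by (auto intro!: strict_mono_onI sorted_wrt_nth_less[of "(<)"])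
  ultimately show ?thesis by blast
qed

theorem corollary0p6:
  assumes cE_conjecture:
    "\<forall>(k::nat) (f :: nat \<Rightarrow> nat \<Rightarrow> complex) (b :: nat \<Rightarrow> int).
       k \<ge> 1 \<longrightarrow>
       (\<forall>j\<in>{1..k}. f j \<in> multiplicative_disc) \<longrightarrow>
       (\<exists>j0\<in>{1..k}. strongly_aperiodic (f j0)) \<longrightarrow>
       strict_mono_on {1..k} b \<longrightarrow>
       (\<lambda>N. (1 / of_nat N) * (\<Sum>n\<in>{1..<N}. \<Prod>j = 1..k. zero_extend (f j) (int n + b j)))
         \<longlonglongrightarrow> 0"
  shows FH_conjecture:
    "\<forall>f\<in>multiplicative_disc. (\<forall>n>0. f n \<in> \<real>) \<longrightarrow> exactly_one_furstenberg_system f"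
proof (intro ballI impI)
  fix f assume f: "f \<in> multiplicative_disc" and real: "\<forall>n>0. f n \<in> \<real>"
  have fb: "norm (f n) \<le> 1" if "n > 0" for n using f that by (simp add: multiplicative_disc_def)
  define \<xi> where "\<xi> n = Re (f n)" for n
  have \<xi>: "f n = of_real (\<xi> n)" "\<xi> n \<in> {-1..1}" if "n > 0" for n
  proof -
    show 1: "f n = of_real (\<xi> n)" using real that by (simp add: \<xi>_def)
    show "\<xi> n \<in> {-1..1}" using fb[OF that] abs_Re_le_cmod[of "f n"] by (auto simp: \<xi>_def)
  qed
  have range: "zero_extend f m \<in> of_real ` {-1..1}" for m
    using \<xi>[of "nat m"] by (auto simp: zero_extend_def image_iff intro!: bexI[of _ 0] bexI[of _ "\<xi> (nat m)"])
  show "exactly_one_furstenberg_system f"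
  proof (rule exactly_one_furstenberg_systemI[OF range])
    fix bs :: "int list"
    \<comment> \<open>Repeated entries of \<open>bs\<close> are merged, because the conjecture takes
      distinct shifts: a shift of multiplicity r carries the power f^r.\<close>
    define B where "B = set bs"
    define F where "F b n = f n ^ count_list bs b" for b n
    have pos: "count_list bs b > 0" if "b \<in> B" for b using that unfolding B_def by (meson count_list_0_iff gr0I)
    have F: "F b \<in> multiplicative_disc" for b unfolding F_def using f by (rule multiplicative_disc_power)
    have ext: "zero_extend (F b) m = zero_extend f m ^ count_list bs b" if "b \<in> B" for b m
      unfolding F_def using pos[OF that] by (rule zero_extend_power)
    have monomial: "of_real (prod_list (map (\<lambda>b. Re (zero_extend f (b + int n))) bs)) = (\<Prod>b\<in>B. zero_extend (F b) (int n + b))" for n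
    proof -
      have "of_real (Re (zero_extend f m)) = zero_extend f m" for m using range[of m] by auto
      then have "of_real (prod_list (map (\<lambda>b. Re (zero_extend f (b + int n))) bs)) = prod_list (map (\<lambda>b. zero_extend f (b + int n)) bs)"
        by (induction bs) auto
      also have "\<dots> = (\<Prod>b\<in>B. zero_extend f (b + int n) ^ count_list bs b)"
        unfolding B_def using image_prod_mset_multiplicity[of "\<lambda>b. zero_extend f (b + int n)" "mset bs"]
        by (simp add: prod_mset_prod_list[symmetric] count_mset)
      also have "\<dots> = (\<Prod>b\<in>B. zero_extend (F b) (int n + b))" by (rule prod.cong) (simp_all add: ext add.commute)
      finally show ?thesis .
    qed
    have "convergent (\<lambda>N. (\<Sum>n=1..N. \<Prod>b\<in>B. zero_extend (F b) (int n + b)) / of_nat N)"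
    proof (cases "\<exists>b\<in>B. strongly_aperiodic (F b)")
      case True
      have finB: "finite B" by (simp add: B_def)
      obtain c where c: "strict_mono_on {1..card B} c" "bij_betw c {1..card B} B"
        using prod_over_sorted_enumeration[OF finB] by blast
      let ?p = "\<lambda>n. \<Prod>b\<in>B. zero_extend (F b) (int n + b)"
      have p: "?p n = (\<Prod>j=1..card B. zero_extend (F (c j)) (int n + c j))" for n
        by (rule prod.reindex_bij_betw[OF c(2), symmetric])
      have "card B \<ge> 1" using True finB by (auto simp: Suc_le_eq card_gt_0_iff)
      moreover have "\<exists>j\<in>{1..card B}. strongly_aperiodic (F (c j))"
        using True bij_betw_imp_surj_on[OF c(2)] by force
      ultimately have "(\<lambda>N. (1 / of_nat N) * (\<Sum>n\<in>{1..<N}. \<Prod>j=1..card B. zero_extend (F (c j)) (int n + c j))) \<longlonglongrightarrow> 0"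
        using cE_conjecture[rule_format, of "card B" "\<lambda>j. F (c j)" c] F c(1) by blast
      then have lim: "(\<lambda>N. (1 / of_nat N) * (\<Sum>n\<in>{1..<N}. ?p n)) \<longlonglongrightarrow> 0" by (simp only: p)
      \<comment> \<open>The conjecture sums over n < N, the averages here run over n \<le> N; the
        extra term is O(1 / N).\<close>
      have "(\<lambda>N. ?p N / of_nat N) \<longlonglongrightarrow> 0"
      proof (rule Lim_null_comparison)
        show "\<forall>\<^sub>F N in sequentially. norm (?p N / of_nat N) \<le> 1 / real N"
        proof (intro always_eventually allI)
          fix N
          have "norm (zero_extend (F b) m) \<le> 1" for b m using F[of b] by (simp add: zero_extend_def multiplicative_disc_def)
          then have "norm (?p N) \<le> 1" unfolding prod_norm[symmetric] by (intro prod_le_1) auto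
          then show "norm (?p N / of_nat N) \<le> 1 / real N" by (simp add: norm_divide divide_right_mono)
        qed
        show "(\<lambda>N. 1 / real N) \<longlonglongrightarrow> 0" by (rule lim_const_over_n)
      qed
      from tendsto_add[OF lim this]
      have "(\<lambda>N. (1 / of_nat N) * (\<Sum>n\<in>{1..<N}. ?p n) + ?p N / of_nat N) \<longlonglongrightarrow> 0" by simp
      moreover have "\<forall>\<^sub>F N in sequentially. (1 / of_nat N) * (\<Sum>n\<in>{1..<N}. ?p n) + ?p N / of_nat N = (\<Sum>n=1..N. ?p n) / of_nat N"
        using eventually_ge_at_top[of 1]
      proof eventually_elim
        case (elim N)
        then have "{1..N} = insert N {1..<N}" by auto
        then show ?case by (simp add: add_divide_distrib)
      qed
      ultimately have "(\<lambda>N. (\<Sum>n=1..N. ?p n) / of_nat N) \<longlonglongrightarrow> 0" by (rule Lim_transform_eventually)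
      then show ?thesis by (rule convergentI)
    next
      \<comment> \<open>This case includes the empty list, whose product is constantly 1.\<close>
      case False
      have rap: "rationally_almost_periodic (zero_extend (F b))" if b: "b \<in> B" for b
      proof -
        have x1: "\<xi> n ^ count_list bs b \<in> {-1..1}" if "n > 0" for n
        proof -
          have "\<bar>\<xi> n ^ count_list bs b\<bar> \<le> 1" using \<xi>(2)[OF that] by (simp add: power_abs power_le_one abs_le_iff)
          then show ?thesis by (auto simp: abs_le_iff)
        qed
        have x2: "F b n = of_real (\<xi> n ^ count_list bs b)" if "n > 0" for n
          using \<xi>(1)[OF that] by (simp add: F_def)
        obtain q chi C where chi: "dirichlet_character q chi" "\<And>n. coprime n q \<Longrightarrow> chi n ^ 2 = 1"
           "\<And>X. (\<Sum>p | prime p \<and> real p \<le> X. 1 / real p * (1 - \<xi> p ^ count_list bs b * Re (chi p))) \<le> C"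
          using real_not_strongly_aperiodic_pretentious[of "\<lambda>n. \<xi> n ^ count_list bs b" "F b"] x1 x2 False b by blast
        show ?thesis
          by (rule pretentious_rationally_almost_periodic[OF F x2 x1 chi])
      qed
      have "rationally_almost_periodic (\<lambda>n. \<Prod>b\<in>B. zero_extend (F b) (n + b))"
        by (intro rationally_almost_periodic_prod rationally_almost_periodic_shift rap) (simp_all add: B_def)
      then show ?thesis by (rule rationally_almost_periodic_mean)
    qed
    then have "convergent (\<lambda>N. complex_of_real ((\<Sum>n=1..N. prod_list (map (\<lambda>b. Re (zero_extend f (b + int n))) bs)) / real N))"
      by (simp add: monomial)
    then show "convergent (\<lambda>N. (\<Sum>n=1..N. prod_list (map (\<lambda>b. Re (zero_extend f (b + int n))) bs)) / real N)"
      by (auto simp: convergent_def dest!: tendsto_Re)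
  qed
qed

end
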